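(* Let $\boldsymbol X_a=(X_1^{(a)},\dots,X_r^{(a)})$, $a=1,\dots,n$, be i.i.d. from a Lebesgue absolutely continuous distribution $\mu$ on $\mathbb R^{d_0}$, $d_0=\sum_{i=1}^rd_i$, with absolutely continuous marginals $\mu_i$ on $\mathbb R^{d_i}$, $1\le i\le r$. Suppose that for every $1\le i\le r$ the empirical distribution of the grid $\mathcal H_n^{d_i}=\{h_1^{d_i},\dots,h_n^{d_i}\}\subset[0,1]^{d_i}$ converges weakly to $\mathrm{Unif}([0,1]^{d_i})$ as $n\to\infty$. Let $\boldsymbol C=(C_2,\dots,C_r)$ be a given vector of non-negative weights, let $\alpha\in(0,1)$, and let $$\phi_n(\boldsymbol C)=\mathbf 1\{\mathrm{RJdCov}_n^2(\boldsymbol X;\boldsymbol C)\ge c_{\alpha,n}\},$$ where $c_{\alpha,n}$ is the upper $\alpha$ quantile of the distribution of $\mathrm{RJdCov}_n^2(\boldsymbol X;\boldsymbol C)$ under joint independence (a distribution that does not depend on the marginals). Then the test $\phi_n(\boldsymbol C)$ is universally consistent: for any such $\mu\ne\mu_1\otimes\cdots\otimes\mu_r$, $$\lim_{n\to\infty}\mathbb E_\mu[\phi_n(\boldsymbol C)]=1.$$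
   Context: The empirical rank map is $\hat R_i(X_i^{(a)})=h^{d_i}_{\hat\sigma_i(a)}$, where $\hat\sigma_i$ minimizes $\sum_{a=1}^n\|X_i^{(a)}-h^{d_i}_{\sigma(a)}\|^2$ over all permutations $\sigma$ of $\{1,\dots,n\}$. Put $\mathrm dw_i=\dfrac{\mathrm dt_i}{c_{d_i}\|t_i\|^{1+d_i}}$ with $c_d=\pi^{(1+d)/2}/\Gamma((1+d)/2)$, $d_S=\sum_{i\in S}d_i$, $\iota=\sqrt{-1}$. For $S\subseteq\{1,\dots,r\}$ with $|S|\ge2$, $$\mathrm{RdCov}_n^2(\boldsymbol X_S)=\int_{\mathbb R^{d_S}}\left|\frac1n\sum_{b=1}^n\prod_{i\in S}\left(\frac1n\sum_{a=1}^ne^{\iota\langle t_i,\hat R_i(X_i^{(a)})\rangle}-e^{\iota\langle t_i,\hat R_i(X_i^{(b)})\rangle}\right)\right|^2\prod_{i\in S}\mathrm dw_i,$$ and $\mathrm{RJdCov}_n^2(\boldsymbol X;\boldsymbol C)=\sum_{s=2}^rC_s\sum_{S\subseteq\{1,\dots,r\},|S|=s}\mathrm{RdCov}_n^2(\boldsymbol X_S)$. "Under joint independence" means that the sample is i.i.d. from a product of absolutely continuous marginals.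
   Formalization: The weights C_2,…,C_r are assumed strictly positive instead of non-negative; with C=(1,0), r=3 and a pairwise independent but jointly dependent density such as 1+cos 2π(x1+x2−x3) on [0,1]^3, the test is not consistent for small α. *)

theory Defs
  imports "HOL-Probability.Probability" "HOL-Combinatorics.Permutations"
begin

text \<open>
  The dimensions \<open>d 1, \<dots>, d r\<close> vary with the block, so \<open>\<real>\<^sup>d\<close> is modelled as the carrier of the
  product measure below (functions \<open>nat \<Rightarrow> real\<close> that are \<open>undefined\<close> outside \<open>{1..d}\<close>), and
  \<open>\<real>\<close> to the power \<open>d 1 + \<dots> + d r\<close> as the product of the blocks. An observation is
  \<open>x :: nat \<Rightarrow> nat \<Rightarrow> real\<close> (block, coordinate), and a sample is
  \<open>X :: nat \<Rightarrow> nat \<Rightarrow> nat \<Rightarrow> real\<close> (index of the observation, block, coordinate).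
\<close>

type_synonym vec = "nat \<Rightarrow> real"

definition leb :: "nat \<Rightarrow> vec measure" where
  "leb d = (\<Pi>\<^sub>M j\<in>{1..d}. lborel)"

definition leb_blocks :: "nat \<Rightarrow> (nat \<Rightarrow> nat) \<Rightarrow> (nat \<Rightarrow> vec) measure" where
  "leb_blocks r d = (\<Pi>\<^sub>M i\<in>{1..r}. leb (d i))"

definition vnorm :: "nat \<Rightarrow> vec \<Rightarrow> real" where
  "vnorm d v = L2_set v {1..d}"

definition vinner :: "nat \<Rightarrow> vec \<Rightarrow> vec \<Rightarrow> real" where
  "vinner d u v = (\<Sum>j=1..d. u j * v j)"

definition unit_cube :: "nat \<Rightarrow> vec set" where
  "unit_cube d = {1..d} \<rightarrow>\<^sub>E {0..1}"

definition ac_prob :: "'a measure \<Rightarrow> 'a measure \<Rightarrow> bool" where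
  "ac_prob L P \<longleftrightarrow> prob_space P \<and> sets P = sets L \<and> absolutely_continuous L P"

definition marginal :: "(nat \<Rightarrow> nat) \<Rightarrow> (nat \<Rightarrow> vec) measure \<Rightarrow> nat \<Rightarrow> vec measure" where
  "marginal d \<mu> i = distr \<mu> (leb (d i)) (\<lambda>x. x i)"

definition joint_indep :: "nat \<Rightarrow> (nat \<Rightarrow> vec measure) \<Rightarrow> (nat \<Rightarrow> vec) measure" where
  "joint_indep r \<nu> = (\<Pi>\<^sub>M i\<in>{1..r}. \<nu> i)"

definition iid_sample :: "nat \<Rightarrow> 'a measure \<Rightarrow> (nat \<Rightarrow> 'a) measure" where
  "iid_sample n \<mu> = (\<Pi>\<^sub>M a\<in>{1..n}. \<mu>)"

definition weak_conv_vec :: "nat \<Rightarrow> (nat \<Rightarrow> vec measure) \<Rightarrow> vec measure \<Rightarrow> bool" where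
  "weak_conv_vec d P Q \<longleftrightarrow>
     (\<forall>f. continuous_map (product_topology (\<lambda>_. euclideanreal) {1..d}) euclideanreal f \<and>
          bounded (f ` ({1..d} \<rightarrow>\<^sub>E UNIV)) \<longrightarrow>
          (\<lambda>n. \<integral>x. f x \<partial>P n) \<longlonglongrightarrow> (\<integral>x. f x \<partial>Q))"

text \<open>A grid \<open>g\<close> of size \<open>n\<close> consists of the points \<open>g 1, \<dots>, g n\<close>.\<close>

definition grid_measure :: "nat \<Rightarrow> nat \<Rightarrow> (nat \<Rightarrow> vec) \<Rightarrow> vec measure" where
  "grid_measure d n g = distr (uniform_count_measure {1..n}) (leb d) g"

text \<open>
  For data from an absolutely continuous distribution the minimizer gives almost surely unique
  values \<open>g (\<sigma> a)\<close>. On the exceptional null set \<^const>\<open>arg_min\<close> picks a minimizer that depends on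
  the data only through the set of all minimizers, so the choice does not affect measurability.
\<close>

definition opt_perm :: "nat \<Rightarrow> nat \<Rightarrow> (nat \<Rightarrow> vec) \<Rightarrow> (nat \<Rightarrow> vec) \<Rightarrow> nat \<Rightarrow> nat" where
  "opt_perm d n g y =
     arg_min (\<lambda>\<sigma>. \<Sum>a=1..n. (vnorm d (\<lambda>j. y a j - g (\<sigma> a) j))\<^sup>2) (\<lambda>\<sigma>. \<sigma> permutes {1..n})"

text \<open>The rank of the \<open>a\<close>-th of the observations \<open>y 1, \<dots>, y n\<close> in \<open>\<real>\<^sup>d\<close>.\<close>

definition emp_rank :: "nat \<Rightarrow> nat \<Rightarrow> (nat \<Rightarrow> vec) \<Rightarrow> (nat \<Rightarrow> vec) \<Rightarrow> nat \<Rightarrow> vec" where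
  "emp_rank d n g y a = g (opt_perm d n g y a)"

definition dcov_const :: "nat \<Rightarrow> real" where
  "dcov_const d = pi powr ((1 + real d) / 2) / Gamma ((1 + real d) / 2)"

definition dcov_weight :: "nat \<Rightarrow> vec measure" where
  "dcov_weight d = density (leb d) (\<lambda>t. ennreal (1 / (dcov_const d * vnorm d t ^ (1 + d))))"

text \<open>
  In the following, \<open>h e n a\<close> is the \<open>a\<close>-th of the \<open>n\<close> grid points in dimension \<open>e\<close>.
\<close>

definition RdCov2 ::
  "(nat \<Rightarrow> nat) \<Rightarrow> (nat \<Rightarrow> nat \<Rightarrow> nat \<Rightarrow> vec) \<Rightarrow> nat \<Rightarrow> nat set \<Rightarrow> (nat \<Rightarrow> nat \<Rightarrow> vec) \<Rightarrow> real" where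
  "RdCov2 d h n S X =
     (let R = (\<lambda>i. emp_rank (d i) n (h (d i) n) (\<lambda>a. X a i)) in
      \<integral>t. (cmod (1 / of_nat n * (\<Sum>b=1..n. \<Prod>i\<in>S.
              (1 / of_nat n * (\<Sum>a=1..n. exp (\<i> * complex_of_real (vinner (d i) (t i) (R i a))))
               - exp (\<i> * complex_of_real (vinner (d i) (t i) (R i b)))))))\<^sup>2
        \<partial>(\<Pi>\<^sub>M i\<in>S. dcov_weight (d i)))"

definition RJdCov2 ::
  "nat \<Rightarrow> (nat \<Rightarrow> nat) \<Rightarrow> (nat \<Rightarrow> nat \<Rightarrow> nat \<Rightarrow> vec) \<Rightarrow> (nat \<Rightarrow> real) \<Rightarrow> nat \<Rightarrow>
   (nat \<Rightarrow> nat \<Rightarrow> vec) \<Rightarrow> real" where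
  "RJdCov2 r d h C n X =
     (\<Sum>s=2..r. C s * (\<Sum>S | S \<subseteq> {1..r} \<and> card S = s. RdCov2 d h n S X))"

definition upper_quantile :: "real \<Rightarrow> real measure \<Rightarrow> real" where
  "upper_quantile \<alpha> P = Inf {q. measure P {..q} \<ge> 1 - \<alpha>}"

text \<open>The distribution of the statistic under joint independence, with marginals \<open>\<nu> 1, \<dots>, \<nu> r\<close>.\<close>

definition null_law ::
  "nat \<Rightarrow> (nat \<Rightarrow> nat) \<Rightarrow> (nat \<Rightarrow> nat \<Rightarrow> nat \<Rightarrow> vec) \<Rightarrow> (nat \<Rightarrow> real) \<Rightarrow> nat \<Rightarrow>
   (nat \<Rightarrow> vec measure) \<Rightarrow> real measure" where
  "null_law r d h C n \<nu> =
     distr (iid_sample n (joint_indep r \<nu>)) borel (RJdCov2 r d h C n)"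

text \<open>
  The critical value is formally computed from the null distribution with marginals \<open>\<nu>\<close>, because
  its independence of \<open>\<nu>\<close> is a theorem.
\<close>

definition indep_test ::
  "nat \<Rightarrow> (nat \<Rightarrow> nat) \<Rightarrow> (nat \<Rightarrow> nat \<Rightarrow> nat \<Rightarrow> vec) \<Rightarrow> (nat \<Rightarrow> real) \<Rightarrow> real \<Rightarrow>
   (nat \<Rightarrow> vec measure) \<Rightarrow> nat \<Rightarrow> (nat \<Rightarrow> nat \<Rightarrow> vec) \<Rightarrow> real" where
  "indep_test r d h C \<alpha> \<nu> n X =
     of_bool (RJdCov2 r d h C n X \<ge> upper_quantile \<alpha> (null_law r d h C n \<nu>))"

end

theory Submission
  imports Defs
begin

text \<open>
  No optimal transport theory is needed. Under joint independence, the law of the sample is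
  invariant under separate permutations of the observations of each block, and the optimal matching
  is almost surely unique, so the ranks are uniformly distributed over all arrangements of the grids.
  A second moment computation for independent uniform permutations then bounds the mean of the
  statistic by a multiple of \<open>1 / n\<close>, whence the critical values tend to \<open>0\<close>.

  It remains to bound the statistic away from \<open>0\<close> under a dependent \<open>\<mu>\<close>. Let \<open>u\<^sub>a\<^sup>i\<close> be the rank of the
  \<open>i\<close>-th block \<open>x\<^sub>a\<^sup>i\<close> of the \<open>a\<close>-th observation. If the statistic is small, then all its characteristic
  functions are small pointwise, and by trigonometric approximation the ranks
  \<open>u\<^sub>a\<^sup>1, \<dots>, u\<^sub>a\<^sup>r\<close> are nearly independent when tested against products of tent functions. An optimal
  matching is pairwise monotone, i.e. \<open>\<langle>x\<^sub>a - x\<^sub>b, u\<^sub>a - u\<^sub>b\<rangle> \<ge> 0\<close>. Hence, along each line of small cells of the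
  cube, the corresponding coordinate of the data is essentially increasing and can vary substantially
  in only boundedly many cells. Therefore a Lipschitz function of \<open>x\<^sub>a\<^sup>i\<close> agrees up to a small mean
  error with a combination of tent functions of \<open>u\<^sub>a\<^sup>i\<close>, and so the blocks \<open>x\<^sub>a\<^sup>1, \<dots>, x\<^sub>a\<^sup>r\<close> are nearly
  independent as well. By the law of large numbers this contradicts the dependence of the blocks.
\<close>

section \<open>Integrability of the empirical characteristic functions\<close>

text \<open>The obstacle is that the ranks come from a discrete minimization and have no explicit
  form. Two facts about them are enough: the matching is pairwise monotone, and the ranks rearrange
  a nearly uniform grid. They combine by counting. With mesh \<open>1 / m\<close> there are O(m ^ (d
  - 1)) lines of cells, hence O(m ^ (d - 1)) cells in which the data vary much, and each cell
  carries mass O(m ^ (- d)). The exceptional mass is therefore O(1 / m). Tents replace indicators of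
  cells because they form a continuous partition of unity: weak convergence bounds their means, and
  exponentials approximate them uniformly.

  The passage from a small statistic to near independence is deterministic. It runs along a filter
  on pairs of a sample size and a sample, on which the size tends to infinity and the statistic to
  0, and so yields thresholds that are uniform in the sample. Under a dependent law, probability
  enters only through concentration of finitely many bounded averages.\<close>

definition avg :: "nat \<Rightarrow> (nat \<Rightarrow> 'a :: real_normed_field) \<Rightarrow> 'a" where
  "avg n z = (\<Sum>a=1..n. z a) / of_nat n"

lemma avg_add: "avg n (\<lambda>a. z a + w a) = avg n z + avg n w"
  by (simp add: avg_def sum.distrib add_divide_distrib)

lemma avg_diff: "avg n (\<lambda>a. z a - w a) = avg n z - avg n w"
  by (simp add: avg_def sum_subtractf diff_divide_distrib)

lemma avg_cmult: "avg n (\<lambda>a. c * z a) = c * avg n z"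
  by (simp add: avg_def sum_distrib_left)

lemma avg_const: "1 \<le> n \<Longrightarrow> avg n (\<lambda>_. c) = c"
  by (simp add: avg_def)

lemma avg_sum: "avg n (\<lambda>a. \<Sum>k\<in>A. z k a) = (\<Sum>k\<in>A. avg n (z k))"
  unfolding avg_def sum_divide_distrib[symmetric] by (simp add: sum.swap[of _ A])

lemma norm_avg_le:
  assumes "\<And>a. a \<in> {1..n} \<Longrightarrow> norm (z a) \<le> B" "0 \<le> B"
  shows "norm (avg n z) \<le> B"
proof (cases "n = 0")
  case False
  have "norm (\<Sum>a=1..n. z a) \<le> real n * B"
    using sum_norm_bound[of "{1..n}" z B] assms by simp
  then show ?thesis using False by (simp add: avg_def norm_divide field_simps)
qed (use assms in \<open>simp add: avg_def\<close>)

lemma norm_avg_le_avg_norm: "norm (avg n z) \<le> avg n (\<lambda>a. norm (z a))"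
  unfolding avg_def norm_divide by (simp add: divide_right_mono sum_norm_le)

lemma avg_mono: "(\<And>a. a \<in> {1..n} \<Longrightarrow> z a \<le> w a) \<Longrightarrow> avg n z \<le> avg n w" for z w :: "nat \<Rightarrow> real"
  unfolding avg_def by (intro divide_right_mono sum_mono) auto

lemma avg_of_real: "avg n (\<lambda>a. of_real (z a)) = of_real (avg n z)"
  by (simp add: avg_def)

definition char_dev :: "nat \<Rightarrow> nat \<Rightarrow> (nat \<Rightarrow> vec) \<Rightarrow> vec \<Rightarrow> nat \<Rightarrow> complex" where
  "char_dev d n u t b =
     1 / of_nat n * (\<Sum>a=1..n. exp (\<i> * complex_of_real (vinner d t (u a))))
     - exp (\<i> * complex_of_real (vinner d t (u b)))"

definition dcov_char ::
  "(nat \<Rightarrow> nat) \<Rightarrow> nat \<Rightarrow> nat set \<Rightarrow> (nat \<Rightarrow> nat \<Rightarrow> vec) \<Rightarrow> (nat \<Rightarrow> vec) \<Rightarrow> complex" where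
  "dcov_char d n S R t = 1 / of_nat n * (\<Sum>b=1..n. \<Prod>i\<in>S. char_dev (d i) n (R i) (t i) b)"

text \<open>The arrangement \<open>R\<close> is an argument of its own, so that the same functional
  serves for the ranks of data and for arbitrary permutations of the grids.\<close>

definition dcov_stat :: "(nat \<Rightarrow> nat) \<Rightarrow> nat \<Rightarrow> nat set \<Rightarrow> (nat \<Rightarrow> nat \<Rightarrow> vec) \<Rightarrow> real" where
  "dcov_stat d n S R = (\<integral>t. (cmod (dcov_char d n S R t))\<^sup>2 \<partial>(\<Pi>\<^sub>M i\<in>S. dcov_weight (d i)))"

lemma RdCov2_eq_dcov_stat:
  "RdCov2 d h n S X = dcov_stat d n S (\<lambda>i. emp_rank (d i) n (h (d i) n) (\<lambda>a. X a i))"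
  by (simp add: RdCov2_def dcov_stat_def dcov_char_def char_dev_def)

section \<open>Lebesgue measure on a block and the singular weight\<close>

lemma sigma_finite_leb: "sigma_finite_measure (leb d)"
proof -
  interpret product_sigma_finite "\<lambda>_::nat. lborel :: real measure" by standard
  show ?thesis unfolding leb_def by (rule sigma_finite) simp
qed

lemma space_leb: "space (leb d) = {1..d} \<rightarrow>\<^sub>E UNIV"
  by (simp add: leb_def space_PiM)

lemma measurable_leb_component [measurable]:
  "j \<in> {1..d} \<Longrightarrow> (\<lambda>t. t j) \<in> borel_measurable (leb d)"
  unfolding leb_def by measurable

lemma measurable_vnorm [measurable]: "vnorm d \<in> borel_measurable (leb d)"
  unfolding vnorm_def L2_set_def by (measurable; simp)

lemma measurable_vinner [measurable]: "(\<lambda>t. vinner d t v) \<in> borel_measurable (leb d)"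
  unfolding vinner_def by measurable

lemma dcov_const_pos: "0 < dcov_const d"
  unfolding dcov_const_def by (intro divide_pos_pos Gamma_real_pos) auto

lemma vnorm_nonneg [simp]: "0 \<le> vnorm d t"
  by (simp add: vnorm_def)

lemma abs_component_le_vnorm: "j \<in> {1..d} \<Longrightarrow> \<bar>t j\<bar> \<le> vnorm d t"
  using member_le_L2_set[of "{1..d}" j "\<lambda>j. \<bar>t j\<bar>"] by (simp add: vnorm_def L2_set_def)

lemma sets_dcov_weight [measurable_cong]: "sets (dcov_weight d) = sets (leb d)"
  by (simp add: dcov_weight_def)

lemma measurable_dcov_weight_eq: "borel_measurable (dcov_weight d) = borel_measurable (leb d)"
  by (rule measurable_cong_sets) (simp_all add: sets_dcov_weight)

text \<open>The density is real-valued everywhere; at the origin it is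
  \<open>1 / 0 = 0\<close>.\<close>

lemma sigma_finite_dcov_weight: "sigma_finite_measure (dcov_weight d)"
proof -
  interpret sigma_finite_measure "leb d" by (rule sigma_finite_leb)
  show ?thesis
    unfolding dcov_weight_def by (subst sigma_finite_iff_density_finite) auto
qed

lemma emeasure_leb_PiE:
  assumes "\<And>j. j \<in> {1..d} \<Longrightarrow> A j \<in> sets borel"
  shows "emeasure (leb d) (PiE {1..d} A) = (\<Prod>j=1..d. emeasure lborel (A j))"
proof -
  interpret product_sigma_finite "\<lambda>_::nat. lborel :: real measure" by standard
  show ?thesis unfolding leb_def by (rule emeasure_PiM) (use assms in auto)
qed

lemma AE_leb_component_neq:
  assumes "j \<in> {1..d}"
  shows "AE t in leb d. t j \<noteq> c"
proof (rule AE_I)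
  let ?A = "\<lambda>i. if i = j then {c} else UNIV :: real set"
  show "{t \<in> space (leb d). \<not> t j \<noteq> c} \<subseteq> PiE {1..d} ?A"
    by (auto simp: space_leb PiE_iff extensional_def)
  have "(\<Prod>i=1..d. emeasure lborel (?A i)) = 0"
    using assms by (intro prod_zero bexI[of _ j]) auto
  then show "emeasure (leb d) (PiE {1..d} ?A) = 0"
    by (subst emeasure_leb_PiE) auto
  show "PiE {1..d} ?A \<in> sets (leb d)"
    unfolding leb_def by (rule sets_PiM_I_finite) auto
qed

lemma AE_leb_components_neq: "AE t in leb d. \<forall>j\<in>{1..d}. t j \<noteq> c"
  by (subst AE_finite_all) (auto intro!: AE_leb_component_neq)

text \<open>
  The product of these factors over the coordinates of \<open>t\<close> dominates \<open>min 1 \<parallel>t\<parallel>\<^sup>2 / \<parallel>t\<parallel>\<^bsup>1 + d\<^esup>\<close>, which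
  reduces the integrability of the radial weight to one dimension.
\<close>

definition radial_bound :: "nat \<Rightarrow> real \<Rightarrow> real" where
  "radial_bound d s = min (\<bar>s\<bar> powr (1 / real d - 1)) (\<bar>s\<bar> powr (- 1 / real d - 1))"

lemma measurable_radial_bound [measurable]: "radial_bound d \<in> borel_measurable borel"
  unfolding radial_bound_def by measurable

lemma radial_bound_nonneg: "0 \<le> radial_bound d s"
  by (simp add: radial_bound_def)

text \<open>The exponents \<open>1 / d - 1\<close> and \<open>- 1 / d - 1\<close> lie on either side
  of the critical exponent -1: the first branch is integrable at 0, the second at infinity.\<close>

lemma nn_integral_radial_bound:
  assumes "1 \<le> d"
  shows "(\<integral>\<^sup>+s. ennreal (radial_bound d s) \<partial>lborel) < \<infinity>"
proof -
  let ?f = "\<lambda>s::real. s powr (1 / real d - 1)" and ?g = "\<lambda>s::real. s powr (- 1 / real d - 1)"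
  have half: "(\<integral>\<^sup>+s. indicator {0..1} s * ennreal (?f s) \<partial>lborel) < \<infinity>"
    using nn_integral_has_integral_lebesgue[OF _ has_integral_powr_from_0[of "1 / real d - 1" 1]] assms
    by (simp add: field_simps ennreal_mult'' flip: ennreal_indicator)
  have half': "(\<integral>\<^sup>+s. indicator {1..} s * ennreal (?g s) \<partial>lborel) < \<infinity>"
    using nn_integral_has_integral_lebesgue[OF _ has_integral_powr_to_inf[of "- 1 / real d - 1" 1]] assms
    by (simp add: field_simps ennreal_mult'' flip: ennreal_indicator)
  \<comment> \<open>\<open>k\<close> dominates the bound on the positive half-line; its reflection
    takes care of the negative one.\<close>
  define k where "k = (\<lambda>s. indicator {0..1} s * ennreal (?f s) + indicator {1..} s * ennreal (?g s))"
  have k_meas: "k \<in> borel_measurable borel" unfolding k_def by measurable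
  have k_fin: "(\<integral>\<^sup>+s. k s \<partial>lborel) < \<infinity>"
    using half half' unfolding k_def by (subst nn_integral_add) auto
  have k_fin': "(\<integral>\<^sup>+s. k (- s) \<partial>lborel) < \<infinity>"
    using nn_integral_real_affine[of k "-1" 0] k_meas k_fin by simp
  have "(\<integral>\<^sup>+s. ennreal (radial_bound d s) \<partial>lborel) \<le> (\<integral>\<^sup>+s. k s + k (- s) \<partial>lborel)"
  proof (rule nn_integral_mono)
    fix s :: real
    consider "0 \<le> s" "s \<le> 1" | "1 < s" | "s < 0" "-1 \<le> s" | "s < -1" by linarith
    then show "ennreal (radial_bound d s) \<le> k s + k (- s)"
      by cases (auto simp: k_def radial_bound_def indicator_def min_def intro!: add_increasing2)
  qed
  also have "\<dots> < \<infinity>"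
    using k_meas k_fin k_fin' by (subst nn_integral_add) auto
  finally show ?thesis .
qed

text \<open>Both exponents are nonpositive. The point 0 is excluded because
  \<open>0 powr a = 0\<close> breaks the monotonicity there.\<close>

lemma radial_bound_antimono:
  assumes "s \<noteq> 0" "\<bar>s\<bar> \<le> T" "1 \<le> d"
  shows "radial_bound d T \<le> radial_bound d s"
proof -
  have "1 / real d - 1 \<le> 0" "- 1 / real d - 1 \<le> 0" using assms by (auto simp: field_simps)
  then show ?thesis
    unfolding radial_bound_def using assms by (intro min.mono powr_mono2') auto
qed

text \<open>This explains the exponents: the \<open>d\<close>-th power of
  \<open>T powr (e / d - 1)\<close> is \<open>T powr e / T ^ d\<close>, and \<open>e = 1\<close>,
  \<open>e = - 1\<close> give the two cases of the minimum on the left.\<close>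

lemma radial_bound_power:
  assumes "0 < T" "1 \<le> d"
  shows "min 1 (T\<^sup>2) / T ^ (1 + d) \<le> radial_bound d T ^ d"
proof -
  have pw: "(T powr (e / real d - 1)) ^ d = T powr e / T ^ d" for e
  proof -
    have "(e / real d - 1) * real d = e - real d" using assms by (simp add: field_simps)
    then show ?thesis
      using assms by (simp add: powr_realpow[symmetric] powr_powr powr_diff[symmetric])
  qed
  have 1: "(T powr (1 / real d - 1)) ^ d = T\<^sup>2 / T ^ (1 + d)"
    using pw[of 1] assms by (simp add: power2_eq_square)
  have 2: "(T powr (- 1 / real d - 1)) ^ d = 1 / T ^ (1 + d)"
    using pw[of "- 1"] assms by (simp add: powr_minus field_simps)
  have "radial_bound d T \<in> {T powr (1 / real d - 1), T powr (- 1 / real d - 1)}"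
    using assms by (auto simp: radial_bound_def min_def)
  then show ?thesis
    using 1 2 assms by (auto intro!: divide_right_mono simp: min_def)
qed

text \<open>Each coordinate is at most the norm in absolute value and the bound is antimonotone, so
  the \<open>d\<close>-th power at the norm lies below the product over the coordinates.\<close>

lemma min_vnorm_le_prod_radial_bound:
  assumes "1 \<le> d" "\<And>j. j \<in> {1..d} \<Longrightarrow> t j \<noteq> 0"
  shows "min 1 ((vnorm d t)\<^sup>2) / vnorm d t ^ (1 + d) \<le> (\<Prod>j=1..d. radial_bound d (t j))"
proof -
  have "0 < \<bar>t 1\<bar>" using assms by simp
  also have "\<dots> \<le> vnorm d t" using assms by (intro abs_component_le_vnorm) auto
  finally have pos: "0 < vnorm d t" .
  have "radial_bound d (vnorm d t) ^ d = (\<Prod>j=1..d. radial_bound d (vnorm d t))" by simp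
  also have "\<dots> \<le> (\<Prod>j=1..d. radial_bound d (t j))"
    using assms by (intro prod_mono conjI radial_bound_nonneg radial_bound_antimono abs_component_le_vnorm) auto
  finally show ?thesis using radial_bound_power[OF pos assms(1)] by linarith
qed

lemma nn_integral_dcov_weight_min:
  assumes "1 \<le> d"
  shows "(\<integral>\<^sup>+t. ennreal (min 1 ((vnorm d t)\<^sup>2)) \<partial>dcov_weight d) < \<infinity>"
proof -
  interpret product_sigma_finite "\<lambda>_::nat. lborel :: real measure" by standard
  let ?c = "dcov_const d"
  have "(\<integral>\<^sup>+t. ennreal (min 1 ((vnorm d t)\<^sup>2)) \<partial>dcov_weight d)
      = (\<integral>\<^sup>+t. ennreal (1 / (?c * vnorm d t ^ (1 + d))) * ennreal (min 1 ((vnorm d t)\<^sup>2)) \<partial>leb d)"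
    unfolding dcov_weight_def by (subst nn_integral_density) auto
  also have "\<dots> \<le> (\<integral>\<^sup>+t. ennreal (1 / ?c) * (\<Prod>j=1..d. ennreal (radial_bound d (t j))) \<partial>leb d)"
  \<comment> \<open>The product bound requires nonzero coordinates; the coordinate hyperplanes are
    null sets.\<close>
  proof (rule nn_integral_mono_AE, use AE_leb_components_neq[of d 0] in eventually_elim)
    case (elim t)
    have "1 / (?c * vnorm d t ^ (1 + d)) * min 1 ((vnorm d t)\<^sup>2)
        = (1 / ?c) * (min 1 ((vnorm d t)\<^sup>2) / vnorm d t ^ (1 + d))" by simp
    also have "\<dots> \<le> (1 / ?c) * (\<Prod>j=1..d. radial_bound d (t j))"
      using elim assms dcov_const_pos[of d]
      by (intro mult_left_mono min_vnorm_le_prod_radial_bound) auto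
    finally show ?case
      using dcov_const_pos[of d]
      by (simp add: ennreal_mult''[symmetric] prod_ennreal radial_bound_nonneg prod_nonneg del: power_Suc)
  qed
  also have "\<dots> = ennreal (1 / ?c) * (\<Prod>j=1..d. \<integral>\<^sup>+s. ennreal (radial_bound d s) \<partial>lborel)"
  proof -
    have "(\<lambda>t. \<Prod>j=1..d. ennreal (radial_bound d (t j))) \<in> borel_measurable (\<Pi>\<^sub>M j\<in>{1..d}. lborel)"
      unfolding leb_def[symmetric] by (intro borel_measurable_prod_ennreal) measurable
    then show ?thesis
      unfolding leb_def by (subst nn_integral_cmult) (auto intro!: arg_cong2[where f="(*)"] product_nn_integral_prod simp del: prod_constant)
  qed
  also have "\<dots> < \<infinity>"
    using nn_integral_radial_bound[OF assms]
    by (auto simp: ennreal_mult_less_top ennreal_prod_eq_top power_less_top_ennreal)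
  finally show ?thesis .
qed

text \<open>The constant 2 controls large \<open>t\<close>, and the linear term compensates the
  singularity of order \<open>1 + d\<close> of the weight at the origin; the square is then
  integrable.\<close>

definition dev_bound :: "nat \<Rightarrow> vec \<Rightarrow> real" where
  "dev_bound d t = min 2 (real d * vnorm d t)"

lemma dev_bound_nonneg: "0 \<le> dev_bound d t"
  by (simp add: dev_bound_def)

lemma measurable_dev_bound [measurable]: "dev_bound d \<in> borel_measurable (leb d)"
  unfolding dev_bound_def by measurable

lemma integrable_dev_bound:
  assumes "1 \<le> d"
  shows "integrable (dcov_weight d) (\<lambda>t. (dev_bound d t)\<^sup>2)"
proof -
  have le: "(dev_bound d t)\<^sup>2 \<le> 4 * (real d)\<^sup>2 * min 1 ((vnorm d t)\<^sup>2)" for t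
  proof -
    have 1: "(dev_bound d t)\<^sup>2 \<le> 2\<^sup>2"
      using dev_bound_nonneg by (intro power_mono) (auto simp: dev_bound_def)
    have 2: "(dev_bound d t)\<^sup>2 \<le> (real d * vnorm d t)\<^sup>2"
      using dev_bound_nonneg by (intro power_mono) (auto simp: dev_bound_def)
    have 3: "1 \<le> (real d)\<^sup>2" using assms by simp
    have 4: "0 \<le> (real d)\<^sup>2 * (vnorm d t)\<^sup>2" by simp
    show ?thesis using 1 2 3 4 unfolding power_mult_distrib min_def by (auto; linarith)
  qed
  have "(\<integral>\<^sup>+t. ennreal (norm ((dev_bound d t)\<^sup>2)) \<partial>dcov_weight d)
      \<le> (\<integral>\<^sup>+t. ennreal (4 * (real d)\<^sup>2) * ennreal (min 1 ((vnorm d t)\<^sup>2)) \<partial>dcov_weight d)"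
    using le by (intro nn_integral_mono) (auto simp: ennreal_mult''[symmetric] intro!: ennreal_leI)
  also have "\<dots> < \<infinity>"
    using nn_integral_dcov_weight_min[OF assms]
    by (subst nn_integral_cmult) (auto simp: ennreal_mult_less_top)
  finally show ?thesis
    by (subst integrable_iff_bounded) (auto simp: measurable_dcov_weight_eq)
qed

section \<open>Domination of the centred characteristic functions\<close>

lemma norm_iexp_diff_le:
  "cmod (exp (\<i> * complex_of_real x) - exp (\<i> * complex_of_real y)) \<le> \<bar>x - y\<bar>"
proof -
  have "exp (\<i> * complex_of_real x) - exp (\<i> * complex_of_real y)
      = exp (\<i> * complex_of_real y) * (exp (\<i> * complex_of_real (x - y)) - 1)"
    by (simp add: algebra_simps flip: exp_add)
  also have "cmod \<dots> \<le> \<bar>x - y\<bar>"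
    using iexp_approx1[of "x - y" 0] by (simp add: norm_mult)
  finally show ?thesis .
qed

lemma vinner_diff_le:
  assumes "\<And>j. j \<in> {1..d} \<Longrightarrow> \<bar>u j - v j\<bar> \<le> 1"
  shows "\<bar>vinner d t u - vinner d t v\<bar> \<le> (\<Sum>j=1..d. \<bar>t j\<bar>)"
proof -
  have "vinner d t u - vinner d t v = (\<Sum>j=1..d. t j * (u j - v j))"
    by (simp add: vinner_def sum_subtractf right_diff_distrib)
  also have "\<bar>\<dots>\<bar> \<le> (\<Sum>j=1..d. \<bar>t j\<bar> * 1)"
    by (intro order.trans[OF sum_abs] sum_mono, unfold abs_mult)
      (intro mult_left_mono assms; simp)
  finally show ?thesis by simp
qed

lemma sum_abs_le_vnorm: "(\<Sum>j=1..d. \<bar>t j\<bar>) \<le> real d * vnorm d t"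
  using sum_bounded_above[of "{1..d}" "\<lambda>j. \<bar>t j\<bar>" "vnorm d t"] abs_component_le_vnorm by simp

lemma unit_cubeD: "u \<in> unit_cube d \<Longrightarrow> j \<in> {1..d} \<Longrightarrow> 0 \<le> u j \<and> u j \<le> 1"
  by (auto simp: unit_cube_def PiE_iff)

lemma norm_mean_le:
  fixes z :: "nat \<Rightarrow> complex"
  assumes "\<And>a. a \<in> {1..n} \<Longrightarrow> cmod (z a) \<le> B" "0 \<le> B"
  shows "cmod (1 / of_nat n * (\<Sum>a=1..n. z a)) \<le> B"
  using norm_avg_le[of n z B] assms by (simp add: avg_def)

text \<open>As a mean of differences of exponentials, the deviation is seen to vanish linearly as
  \<open>t\<close> tends to 0.\<close>

lemma char_dev_eq_mean:
  assumes "b \<in> {1..n}"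
  shows "char_dev d n u t b = 1 / of_nat n * (\<Sum>a=1..n. exp (\<i> * complex_of_real (vinner d t (u a)))
     - exp (\<i> * complex_of_real (vinner d t (u b))))"
  using assms by (simp add: char_dev_def sum_subtractf field_simps)

lemma char_dev_bound:
  assumes "\<And>a. a \<in> {1..n} \<Longrightarrow> u a \<in> unit_cube d" and b: "b \<in> {1..n}"
  shows "cmod (char_dev d n u t b) \<le> dev_bound d t"
  unfolding char_dev_eq_mean[OF b]
proof (rule norm_mean_le[OF _ dev_bound_nonneg])
  fix a assume a: "a \<in> {1..n}"
  let ?e = "\<lambda>a. exp (\<i> * complex_of_real (vinner d t (u a)))"
  have "cmod (?e a - ?e b) \<le> cmod (?e a) + cmod (?e b)" by (rule norm_triangle_ineq4)
  then have 1: "cmod (?e a - ?e b) \<le> 2" by simp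
  have "cmod (?e a - ?e b) \<le> \<bar>vinner d t (u a) - vinner d t (u b)\<bar>" by (rule norm_iexp_diff_le)
  also have "\<dots> \<le> (\<Sum>j=1..d. \<bar>t j\<bar>)"
    using unit_cubeD[OF assms(1)[OF a]] unit_cubeD[OF assms(1)[OF b]]
    by (intro vinner_diff_le) (force simp: abs_le_iff)
  also note sum_abs_le_vnorm
  finally show "cmod (?e a - ?e b) \<le> dev_bound d t" using 1 by (simp add: dev_bound_def)
qed

lemma dcov_char_bound:
  assumes "\<And>i a. i \<in> S \<Longrightarrow> a \<in> {1..n} \<Longrightarrow> R i a \<in> unit_cube (d i)"
  shows "(cmod (dcov_char d n S R t))\<^sup>2 \<le> (\<Prod>i\<in>S. (dev_bound (d i) (t i))\<^sup>2)"
proof -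
  have "cmod (dcov_char d n S R t) \<le> (\<Prod>i\<in>S. dev_bound (d i) (t i))"
    unfolding dcov_char_def
  proof (rule norm_mean_le)
    fix b assume "b \<in> {1..n}"
    then show "cmod (\<Prod>i\<in>S. char_dev (d i) n (R i) (t i) b) \<le> (\<Prod>i\<in>S. dev_bound (d i) (t i))"
      unfolding prod_norm[symmetric] using assms by (intro prod_mono conjI char_dev_bound norm_ge_zero) auto
  qed (simp add: prod_nonneg dev_bound_nonneg)
  then show ?thesis unfolding prod_power_distrib[symmetric] by (intro power_mono) auto
qed

lemma product_sigma_finite_dcov_weight: "product_sigma_finite (\<lambda>i. dcov_weight (d i))"
  by (intro product_sigma_finite.intro sigma_finite_dcov_weight)

lemma measurable_char_dev [measurable]: "(\<lambda>t. char_dev d n u t b) \<in> borel_measurable (leb d)"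
  unfolding char_dev_def by measurable

lemma measurable_dcov_char [measurable]:
  "dcov_char d n S R \<in> borel_measurable (\<Pi>\<^sub>M i\<in>S. dcov_weight (d i))"
proof -
  have [measurable]: "(\<lambda>t. char_dev (d i) n (R i) (t i) b) \<in> borel_measurable (\<Pi>\<^sub>M i\<in>S. dcov_weight (d i))"
    if "i \<in> S" for i b
    by (rule measurable_compose[OF measurable_component_singleton[OF that]])
      (simp add: measurable_dcov_weight_eq)
  show ?thesis unfolding dcov_char_def by measurable
qed

lemma integrable_prod_dev_bound:
  assumes "finite S" "\<And>i. i \<in> S \<Longrightarrow> 1 \<le> d i"
  shows "integrable (\<Pi>\<^sub>M i\<in>S. dcov_weight (d i)) (\<lambda>t. \<Prod>i\<in>S. (dev_bound (d i) (t i))\<^sup>2)"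
  using assms
  by (intro product_sigma_finite.product_integrable_prod[OF product_sigma_finite_dcov_weight]
        integrable_dev_bound) auto

lemma integrable_dcov_char:
  assumes "finite S" "\<And>i. i \<in> S \<Longrightarrow> 1 \<le> d i"
    and "\<And>i a. i \<in> S \<Longrightarrow> a \<in> {1..n} \<Longrightarrow> R i a \<in> unit_cube (d i)"
  shows "integrable (\<Pi>\<^sub>M i\<in>S. dcov_weight (d i)) (\<lambda>t. (cmod (dcov_char d n S R t))\<^sup>2)"
  by (rule Bochner_Integration.integrable_bound[OF integrable_prod_dev_bound[OF assms(1,2)]])
    (auto simp: prod_nonneg intro!: AE_I2 dcov_char_bound assms(3))

lemma dcov_stat_nonneg: "0 \<le> dcov_stat d n S R"
  by (simp add: dcov_stat_def)

section \<open>Pointwise smallness of the characteristic functions\<close>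

lemma char_dev_norm_le_2: "cmod (char_dev d n u t b) \<le> 2"
proof -
  have "cmod (1 / of_nat n * (\<Sum>a=1..n. exp (\<i> * complex_of_real (vinner d t (u a))))) \<le> 1"
    by (intro norm_mean_le) auto
  moreover have "cmod (exp (\<i> * complex_of_real (vinner d t (u b)))) = 1" by simp
  ultimately show ?thesis
    unfolding char_dev_def by (intro order.trans[OF norm_triangle_ineq4]) linarith
qed

lemma vinner_left_diff_le:
  assumes "u \<in> unit_cube d" "\<And>j. j \<in> {1..d} \<Longrightarrow> \<bar>t j - s j\<bar> \<le> \<rho>"
  shows "\<bar>vinner d t u - vinner d s u\<bar> \<le> real d * \<rho>"
proof -
  have "vinner d t u - vinner d s u = (\<Sum>j=1..d. (t j - s j) * u j)"
    by (simp add: vinner_def sum_subtractf left_diff_distrib)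
  also have "\<bar>\<dots>\<bar> \<le> (\<Sum>j=1..d. \<rho> * 1)"
  proof (intro order.trans[OF sum_abs] sum_mono)
    fix j assume j: "j \<in> {1..d}"
    show "\<bar>(t j - s j) * u j\<bar> \<le> \<rho> * 1"
      unfolding abs_mult using assms(2)[OF j] unit_cubeD[OF assms(1) j]
      by (intro mult_mono) auto
  qed
  finally show ?thesis by simp
qed

lemma diff_diff_diff_swap: "(a - b) - (c - e) = (a - c) - (b - e)" for a b c e :: "'a :: ab_group_add"
  by simp

lemma char_dev_lipschitz:
  assumes u: "\<And>a. a \<in> {1..n} \<Longrightarrow> u a \<in> unit_cube d" and b: "b \<in> {1..n}"
    and ts: "\<And>j. j \<in> {1..d} \<Longrightarrow> \<bar>t j - s j\<bar> \<le> \<rho>" and \<rho>: "0 \<le> \<rho>"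
  shows "cmod (char_dev d n u t b - char_dev d n u s b) \<le> 2 * real d * \<rho>"
proof -
  let ?e = "\<lambda>t a. exp (\<i> * complex_of_real (vinner d t (u a)))"
  have le: "cmod (?e t a - ?e s a) \<le> real d * \<rho>" if "a \<in> {1..n}" for a
  proof -
    have "cmod (?e t a - ?e s a) \<le> \<bar>vinner d t (u a) - vinner d s (u a)\<bar>"
      by (rule norm_iexp_diff_le)
    also have "\<dots> \<le> real d * \<rho>" by (rule vinner_left_diff_le[OF u[OF that]]) (rule ts)
    finally show ?thesis .
  qed
  have eq: "char_dev d n u t b - char_dev d n u s b
      = 1 / of_nat n * (\<Sum>a=1..n. ?e t a - ?e s a) - (?e t b - ?e s b)"
    unfolding char_dev_def sum_subtractf right_diff_distrib by (rule diff_diff_diff_swap)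
  have mean: "cmod (1 / of_nat n * (\<Sum>a=1..n. ?e t a - ?e s a)) \<le> real d * \<rho>"
    using \<rho> by (intro norm_mean_le le) simp_all
  show ?thesis
    using norm_triangle_ineq4[of "1 / of_nat n * (\<Sum>a=1..n. ?e t a - ?e s a)" "?e t b - ?e s b"] mean le[OF b]
    unfolding eq by linarith
qed

lemma norm_prod_diff_bounded:
  fixes z w :: "'i \<Rightarrow> complex"
  assumes "finite S" "\<And>i. i \<in> S \<Longrightarrow> cmod (z i) \<le> 2" "\<And>i. i \<in> S \<Longrightarrow> cmod (w i) \<le> 2"
  shows "cmod (prod z S - prod w S) \<le> 2 ^ card S * (\<Sum>i\<in>S. cmod (z i - w i))"
proof -
  \<comment> \<open>Halving all factors brings them into the unit disc, where the product is
    Lipschitz with constant 1 in each factor.\<close>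
  have "cmod ((\<Prod>i\<in>S. z i / 2) - (\<Prod>i\<in>S. w i / 2)) \<le> (\<Sum>i\<in>S. cmod (z i / 2 - w i / 2))"
    using assms by (intro norm_prod_diff) (auto simp: norm_divide)
  also have "(\<Prod>i\<in>S. z i / 2) - (\<Prod>i\<in>S. w i / 2) = (prod z S - prod w S) / 2 ^ card S"
    unfolding prod_dividef diff_divide_distrib by simp
  also have "cmod \<dots> = cmod (prod z S - prod w S) / 2 ^ card S"
    by (simp add: norm_divide norm_power)
  also have "(\<Sum>i\<in>S. cmod (z i / 2 - w i / 2)) \<le> (\<Sum>i\<in>S. cmod (z i - w i))"
    unfolding diff_divide_distrib[symmetric] by (intro sum_mono) (simp add: norm_divide)
  finally show ?thesis by (simp add: divide_le_eq mult.commute)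
qed

lemma dcov_char_lipschitz:
  assumes "finite S"
    and u: "\<And>i a. i \<in> S \<Longrightarrow> a \<in> {1..n} \<Longrightarrow> R i a \<in> unit_cube (d i)"
    and ts: "\<And>i j. i \<in> S \<Longrightarrow> j \<in> {1..d i} \<Longrightarrow> \<bar>t i j - s i j\<bar> \<le> \<rho>" and \<rho>: "0 \<le> \<rho>"
  shows "cmod (dcov_char d n S R t - dcov_char d n S R s) \<le> 2 ^ card S * (\<Sum>i\<in>S. 2 * real (d i)) * \<rho>"
proof -
  have eq: "dcov_char d n S R t - dcov_char d n S R s = 1 / of_nat n *
      (\<Sum>b=1..n. (\<Prod>i\<in>S. char_dev (d i) n (R i) (t i) b) - (\<Prod>i\<in>S. char_dev (d i) n (R i) (s i) b))"
    unfolding dcov_char_def sum_subtractf right_diff_distrib ..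
  show ?thesis
    unfolding eq
  proof (rule norm_mean_le)
    fix b assume b: "b \<in> {1..n}"
    have "cmod ((\<Prod>i\<in>S. char_dev (d i) n (R i) (t i) b) - (\<Prod>i\<in>S. char_dev (d i) n (R i) (s i) b))
      \<le> 2 ^ card S * (\<Sum>i\<in>S. cmod (char_dev (d i) n (R i) (t i) b - char_dev (d i) n (R i) (s i) b))"
      using \<open>finite S\<close> by (intro norm_prod_diff_bounded char_dev_norm_le_2)
    also have "\<dots> \<le> 2 ^ card S * (\<Sum>i\<in>S. 2 * real (d i) * \<rho>)"
      using u ts \<rho> b by (intro mult_left_mono sum_mono char_dev_lipschitz) auto
    finally show "cmod ((\<Prod>i\<in>S. char_dev (d i) n (R i) (t i) b) - (\<Prod>i\<in>S. char_dev (d i) n (R i) (s i) b))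
      \<le> 2 ^ card S * (\<Sum>i\<in>S. 2 * real (d i)) * \<rho>" by (simp add: sum_distrib_right mult.assoc)
  qed (use \<rho> in \<open>simp add: sum_nonneg\<close>)
qed

text \<open>The density is positive off the null hyperplane \<open>t 1 = 0\<close>, so the weight
  charges every set that Lebesgue measure charges.\<close>

lemma emeasure_dcov_weight_pos:
  assumes "1 \<le> d" "A \<in> sets (leb d)" "0 < emeasure (leb d) A"
  shows "0 < emeasure (dcov_weight d) A"
proof (rule ccontr)
  let ?f = "\<lambda>t. ennreal (1 / (dcov_const d * vnorm d t ^ (1 + d)))"
  assume "\<not> 0 < emeasure (dcov_weight d) A"
  then have "(\<integral>\<^sup>+t. ?f t * indicator A t \<partial>leb d) = 0"
    using assms by (simp add: dcov_weight_def emeasure_density)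
  then have "AE t in leb d. ?f t * indicator A t = 0"
    using assms by (subst (asm) nn_integral_0_iff_AE) auto
  moreover have "AE t in leb d. t 1 \<noteq> 0" using assms by (intro AE_leb_component_neq) auto
  ultimately have "AE t in leb d. t \<notin> A"
  proof eventually_elim
    case (elim t)
    have "0 < \<bar>t 1\<bar>" using elim assms by simp
    also have "\<dots> \<le> vnorm d t" using assms by (intro abs_component_le_vnorm) auto
    finally have "0 < 1 / (dcov_const d * vnorm d t ^ (1 + d))" using dcov_const_pos[of d] by simp
    then show ?case using elim(1) by (auto simp: indicator_def split: if_splits)
  qed
  then have "emeasure (leb d) A = 0"
    using assms by (subst (asm) AE_iff_measurable[of A]) (auto dest: sets.sets_into_space)
  then show False using assms by simp
qed

text \<open>The Lipschitz constant in \<open>t\<close> depends neither on \<open>n\<close> nor on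
  the arrangement. A value of size \<open>\<epsilon>\<close> at \<open>t\<^sub>0\<close> therefore
  persists, up to a factor 2, on a box of fixed size around it, and contributes a fixed positive
  amount to the integral.\<close>

lemma dcov_char_small_of_dcov_stat_small:
  fixes t\<^sub>0 :: "nat \<Rightarrow> vec"
  assumes "finite S" and d: "\<And>i. i \<in> S \<Longrightarrow> 1 \<le> d i" and \<epsilon>: "0 < \<epsilon>"
  obtains \<eta> where "0 < \<eta>"
    and "\<And>n R. (\<And>i a. i \<in> S \<Longrightarrow> a \<in> {1..n} \<Longrightarrow> R i a \<in> unit_cube (d i)) \<Longrightarrow>
      dcov_stat d n S R < \<eta> \<Longrightarrow> cmod (dcov_char d n S R t\<^sub>0) < \<epsilon>"
proof -
  let ?M = "\<Pi>\<^sub>M i\<in>S. dcov_weight (d i)"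
  define B where "B = 2 ^ card S * (\<Sum>i\<in>S. 2 * real (d i))"
  have B: "0 \<le> B" by (simp add: B_def sum_nonneg)
  \<comment> \<open>Half-width of the box, small enough that the function varies by at most
    \<open>\<epsilon> / 2\<close> on it; \<open>B + 1\<close> keeps the denominator
    positive.\<close>
  define \<rho> where "\<rho> = \<epsilon> / (2 * (B + 1))"
  have \<rho>: "0 < \<rho>" using \<epsilon> B by (simp add: \<rho>_def)
  have B\<rho>: "B * \<rho> \<le> \<epsilon> / 2"
  proof -
    have "B * \<rho> = (\<epsilon> / 2) * (B / (B + 1))" by (simp add: \<rho>_def)
    also have "\<dots> \<le> (\<epsilon> / 2) * 1" using \<epsilon> B by (intro mult_left_mono) (auto simp: field_simps)
    finally show ?thesis by simp
  qed
  define Q where "Q = (\<lambda>i. PiE {1..d i} (\<lambda>j. {t\<^sub>0 i j - \<rho>..t\<^sub>0 i j + \<rho>}))"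
  have Q_sets: "Q i \<in> sets (dcov_weight (d i))" for i
    unfolding Q_def sets_dcov_weight leb_def by (rule sets_PiM_I_finite) auto
  have Q_pos: "0 < emeasure (dcov_weight (d i)) (Q i)" if "i \<in> S" for i
  proof (rule emeasure_dcov_weight_pos[OF d[OF that]])
    show "Q i \<in> sets (leb (d i))" using Q_sets by (simp add: sets_dcov_weight)
    have "emeasure (leb (d i)) (Q i) = (\<Prod>j=1..d i. emeasure lborel {t\<^sub>0 i j - \<rho>..t\<^sub>0 i j + \<rho>})"
      unfolding Q_def by (rule emeasure_leb_PiE) simp
    also have "\<dots> = (ennreal (2 * \<rho>)) ^ d i" using \<rho> by simp
    also have "\<dots> = ennreal ((2 * \<rho>) ^ d i)" using \<rho> by (simp add: ennreal_power)
    also have "\<dots> > 0" using \<rho> by simp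
    finally show "0 < emeasure (leb (d i)) (Q i)" .
  qed
  interpret product_sigma_finite "\<lambda>i. dcov_weight (d i)" by (rule product_sigma_finite_dcov_weight)
  define P where "P = emeasure ?M (PiE S Q)"
  have P_sets: "PiE S Q \<in> sets ?M" using \<open>finite S\<close> Q_sets by (intro sets_PiM_I_finite) auto
  have P: "0 < P"
  proof -
    have "P = (\<Prod>i\<in>S. emeasure (dcov_weight (d i)) (Q i))"
      unfolding P_def using \<open>finite S\<close> Q_sets by (intro emeasure_PiM) auto
    also have "\<dots> \<noteq> 0" using \<open>finite S\<close> by (auto dest!: Q_pos)
    finally show ?thesis by (simp add: zero_less_iff_neq_zero)
  qed
  have "0 < ennreal ((\<epsilon> / 2)\<^sup>2) * P" using P \<epsilon> by (simp add: ennreal_zero_less_mult_iff)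
  then obtain \<eta> where \<eta>: "0 < \<eta>" "ennreal \<eta> \<le> ennreal ((\<epsilon> / 2)\<^sup>2) * P"
  proof (cases "ennreal ((\<epsilon> / 2)\<^sup>2) * P")
    case (real r)
    then show ?thesis using that[of r] \<open>0 < ennreal ((\<epsilon> / 2)\<^sup>2) * P\<close> by auto
  next
    \<comment> \<open>The weight is not finite near the origin of a block, so the box can have
      infinite mass; any threshold then works.\<close>
    case top
    then show ?thesis using that[of 1] by auto
  qed
  show thesis
  proof (rule that[OF \<eta>(1)], rule ccontr)
    fix n R assume R: "\<And>i a. i \<in> S \<Longrightarrow> a \<in> {1..n} \<Longrightarrow> R i a \<in> unit_cube (d i)"
      and small: "dcov_stat d n S R < \<eta>" and "\<not> cmod (dcov_char d n S R t\<^sub>0) < \<epsilon>"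
    then have big: "\<epsilon> \<le> cmod (dcov_char d n S R t\<^sub>0)" by simp
    have lower: "(\<epsilon> / 2)\<^sup>2 \<le> (cmod (dcov_char d n S R t))\<^sup>2" if t: "t \<in> PiE S Q" for t
    proof -
      have near: "\<bar>t\<^sub>0 i j - t i j\<bar> \<le> \<rho>" if ij: "i \<in> S" "j \<in> {1..d i}" for i j
      proof -
        have "t i j \<in> {t\<^sub>0 i j - \<rho>..t\<^sub>0 i j + \<rho>}" using t ij by (auto simp: Q_def PiE_iff)
        then show ?thesis by auto
      qed
      have "cmod (dcov_char d n S R t\<^sub>0 - dcov_char d n S R t) \<le> B * \<rho>"
        unfolding B_def using near R \<rho> by (intro dcov_char_lipschitz[OF \<open>finite S\<close>]) auto
      then have "\<epsilon> / 2 \<le> cmod (dcov_char d n S R t)"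
        using big B\<rho> norm_triangle_ineq2[of "dcov_char d n S R t\<^sub>0" "dcov_char d n S R t"] by linarith
      then show ?thesis using \<epsilon> by (intro power_mono) auto
    qed
    have "ennreal \<eta> \<le> ennreal ((\<epsilon> / 2)\<^sup>2) * P" by (rule \<eta>(2))
    also have "\<dots> = (\<integral>\<^sup>+t. ennreal ((\<epsilon> / 2)\<^sup>2) * indicator (PiE S Q) t \<partial>?M)"
      using P_sets by (simp add: P_def nn_integral_cmult_indicator)
    also have "\<dots> \<le> (\<integral>\<^sup>+t. ennreal ((cmod (dcov_char d n S R t))\<^sup>2) \<partial>?M)"
      using lower by (intro nn_integral_mono) (auto simp: indicator_def intro!: ennreal_leI)
    also have "\<dots> = ennreal (dcov_stat d n S R)"
      unfolding dcov_stat_def using assms R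
      by (intro nn_integral_eq_integral integrable_dcov_char) auto
    finally show False using small \<eta>(1) by (simp add: ennreal_le_iff2)
  qed
qed

section \<open>Monotone matchings and tent functions\<close>

definition hat :: "real \<Rightarrow> real" where
  "hat s = max 0 (1 - \<bar>s\<bar>)"

text \<open>Tensor products of linear B-splines on the mesh of width \<open>1 / m\<close>. With
  nodes \<open>0, ..., m\<close> in every direction they sum to 1 on the cube.\<close>

definition tent :: "nat \<Rightarrow> nat \<Rightarrow> (nat \<Rightarrow> nat) \<Rightarrow> vec \<Rightarrow> real" where
  "tent d m k u = (\<Prod>j=1..d. hat (real m * u j - real (k j)))"

definition cells :: "nat \<Rightarrow> nat \<Rightarrow> (nat \<Rightarrow> nat) set" where
  "cells d m = {1..d} \<rightarrow>\<^sub>E {0..m}"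

lemma finite_cells [simp]: "finite (cells d m)"
  unfolding cells_def by (intro finite_PiE) auto

lemma hat_nonneg: "0 \<le> hat s" and hat_le_1: "hat s \<le> 1" and hat_pos_iff: "0 < hat s \<longleftrightarrow> \<bar>s\<bar> < 1"
  by (auto simp: hat_def)

lemma sum_hat:
  assumes "0 \<le> s" "s \<le> real m"
  shows "(\<Sum>k=0..m. hat (s - real k)) = 1"
  using assms(2)
proof (induction m)
  case 0
  then show ?case using assms(1) by (simp add: hat_def)
next
  case (Suc m)
  show ?case
  proof (cases "s \<le> real m")
    case True
    then show ?thesis using Suc by (simp add: hat_def)
  next
    case False
    have "(\<Sum>k=0..m. hat (s - real k)) = (\<Sum>k\<in>{m}. hat (s - real k))"
      using False by (intro sum.mono_neutral_right) (auto simp: hat_def max_def)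
    then show ?thesis using False Suc.prems by (simp add: hat_def)
  qed
qed

lemma tent_nonneg: "0 \<le> tent d m k u"
  unfolding tent_def by (intro prod_nonneg) (simp add: hat_nonneg)

lemma tent_le_1: "tent d m k u \<le> 1"
  unfolding tent_def by (intro prod_le_1) (simp add: hat_nonneg hat_le_1)

lemma tent_posD:
  assumes "0 < tent d m k u" "j \<in> {1..d}"
  shows "\<bar>real m * u j - real (k j)\<bar> < 1"
proof -
  have "hat (real m * u j - real (k j)) \<noteq> 0"
    using assms unfolding tent_def by (metis finite_atLeastAtMost less_irrefl prod_zero)
  then show ?thesis using hat_pos_iff hat_nonneg by (metis order_less_le)
qed

lemma sum_tent:
  assumes "u \<in> unit_cube d"
  shows "(\<Sum>k\<in>cells d m. tent d m k u) = 1"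
proof -
  have "(\<Sum>k\<in>cells d m. tent d m k u) = (\<Prod>j=1..d. \<Sum>k=0..m. hat (real m * u j - real k))"
    unfolding cells_def tent_def by (rule prod_sum_PiE[symmetric]) auto
  also have "\<dots> = (\<Prod>j=1..d. 1)"
    using assms by (intro prod.cong refl sum_hat) (auto simp: unit_cube_def PiE_iff mult_left_le)
  finally show ?thesis by simp
qed

text \<open>
  Pairwise monotonicity controls the \<open>j\<close>-th coordinate between cells that are far apart in
  direction \<open>j\<close>: the other coordinates contribute at most \<open>4 K d\<close> to the scaled inner product.
\<close>

lemma monotone_far_cells:
  assumes m: "1 \<le> m" and j: "j \<in> {1..d}"
    and mono: "0 \<le> (\<Sum>i=1..d. (x i - y i) * (u i - v i))"
    and x: "\<And>i. i \<in> {1..d} \<Longrightarrow> \<bar>x i\<bar> \<le> K" and y: "\<And>i. i \<in> {1..d} \<Longrightarrow> \<bar>y i\<bar> \<le> K"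
    and k: "0 < tent d m k u" and l: "0 < tent d m l v"
    and agree: "\<And>i. i \<in> {1..d} \<Longrightarrow> i \<noteq> j \<Longrightarrow> k i = l i"
    and far: "k j + L + 2 \<le> l j" and L: "1 \<le> L" "4 * K * real d \<le> real L * \<delta>" and \<delta>: "0 < \<delta>"
  shows "x j - \<delta> \<le> y j"
proof (rule ccontr)
  assume "\<not> x j - \<delta> \<le> y j"
  then have gap: "\<delta> < x j - y j" by simp
  \<comment> \<open>Displacement of the ranks in units of the mesh. It differs from the difference
    of the indices by two offsets below 1 each: it exceeds \<open>L\<close> in direction
    \<open>j\<close>, which accounts for \<open>L + 2\<close>, and is at most 2 in absolute value in
    the other directions.\<close>
  define w where "w = (\<lambda>i. real m * (v i - u i))"
  have w: "w i = (real m * v i - real (l i)) - (real m * u i - real (k i)) + (real (l i) - real (k i))" for i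
    by (simp add: w_def algebra_simps)
  have wj: "real L < w j"
    using tent_posD[OF k j] tent_posD[OF l j] far unfolding w by linarith
  have wi: "\<bar>w i\<bar> \<le> 2" if "i \<in> {1..d}" "i \<noteq> j" for i
    using tent_posD[OF k that(1)] tent_posD[OF l that(1)] agree[OF that] unfolding w by linarith
  have K: "0 \<le> K" using x[OF j] by linarith
  have "0 \<le> real m * (\<Sum>i=1..d. (x i - y i) * (u i - v i))" using mono by simp
  also have "\<dots> = (\<Sum>i=1..d. (y i - x i) * w i)"
    unfolding w_def sum_distrib_left by (intro sum.cong refl) (simp add: algebra_simps)
  also have "\<dots> = (y j - x j) * w j + (\<Sum>i\<in>{1..d}-{j}. (y i - x i) * w i)"
    using j by (simp add: sum.remove)
  also have "(\<Sum>i\<in>{1..d}-{j}. (y i - x i) * w i) \<le> (\<Sum>i\<in>{1..d}-{j}. 4 * K)"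
  proof (rule sum_mono)
    fix i assume i: "i \<in> {1..d} - {j}"
    have "(y i - x i) * w i \<le> \<bar>y i - x i\<bar> * \<bar>w i\<bar>" by (metis abs_ge_self abs_mult)
    also have "\<dots> \<le> (2 * K) * 2"
      using x[of i] y[of i] wi[of i] i by (intro mult_mono) auto
    finally show "(y i - x i) * w i \<le> 4 * K" by simp
  qed
  also have "\<dots> \<le> 4 * K * real d"
  proof -
    have "(\<Sum>i\<in>{1..d}-{j}. 4 * K) \<le> (\<Sum>i=1..d. 4 * K)" using K by (intro sum_mono2) auto
    then show ?thesis by (simp add: algebra_simps)
  qed
  also note L(2)
  finally have "(x j - y j) * w j \<le> real L * \<delta>" by (simp add: algebra_simps)
  moreover have "real L * \<delta> < w j * (x j - y j)"
    using wj gap \<delta> L(1) by (intro mult_strict_mono) auto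
  ultimately show False by (simp add: mult.commute)
qed

definition wide_cell ::
  "nat \<Rightarrow> nat \<Rightarrow> nat set \<Rightarrow> (nat \<Rightarrow> vec) \<Rightarrow> (nat \<Rightarrow> vec) \<Rightarrow> real \<Rightarrow> nat \<Rightarrow> (nat \<Rightarrow> nat) \<Rightarrow> bool" where
  "wide_cell d m G x u \<delta> j k \<longleftrightarrow>
     (\<exists>a\<in>G. \<exists>b\<in>G. 0 < tent d m k (u a) \<and> 0 < tent d m k (u b) \<and> 2 * \<delta> < x a j - x b j)"

text \<open>
  Along each line of cells in direction \<open>j\<close>, the ranges of the \<open>j\<close>-th coordinates of cells that are
  far apart are essentially ordered, hence only boundedly many of them can be wide.
\<close>

lemma card_wide_cells:
  assumes m: "1 \<le> m" and j: "j \<in> {1..d}"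
    and mono: "\<And>a b. a \<in> G \<Longrightarrow> b \<in> G \<Longrightarrow> 0 \<le> (\<Sum>i=1..d. (x a i - x b i) * (u a i - u b i))"
    and bd: "\<And>a i. a \<in> G \<Longrightarrow> i \<in> {1..d} \<Longrightarrow> \<bar>x a i\<bar> \<le> K"
    and L: "1 \<le> L" "4 * K * real d \<le> real L * \<delta>" and \<delta>: "0 < \<delta>" and N: "K \<le> real N * \<delta>"
  shows "card {k \<in> cells d m. wide_cell d m G x u \<delta> j k} \<le> (L + 2) * (m + 1) ^ (d - 1) * (2 * N + 1)"
proof -
  let ?W = "{k \<in> cells d m. wide_cell d m G x u \<delta> j k}"
  obtain A B where AB: "\<And>k. k \<in> ?W \<Longrightarrow> A k \<in> G \<and> B k \<in> G \<and> 0 < tent d m k (u (A k)) \<and>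
      0 < tent d m k (u (B k)) \<and> 2 * \<delta> < x (A k) j - x (B k) j"
  proof -
    have "\<forall>k\<in>?W. \<exists>a b. a \<in> G \<and> b \<in> G \<and> 0 < tent d m k (u a) \<and> 0 < tent d m k (u b) \<and> 2 * \<delta> < x a j - x b j"
      unfolding wide_cell_def by blast
    then obtain A where "\<forall>k\<in>?W. \<exists>b. A k \<in> G \<and> b \<in> G \<and> 0 < tent d m k (u (A k)) \<and>
        0 < tent d m k (u b) \<and> 2 * \<delta> < x (A k) j - x b j"
      by (drule_tac bchoice) blast
    then obtain B where "\<forall>k\<in>?W. A k \<in> G \<and> B k \<in> G \<and> 0 < tent d m k (u (A k)) \<and>
        0 < tent d m k (u (B k)) \<and> 2 * \<delta> < x (A k) j - x (B k) j"
      by (drule_tac bchoice) blast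
    then show ?thesis by (intro that[of A B]) blast
  qed
  \<comment> \<open>Counting by an injection. The index in direction \<open>j\<close> is recorded
    only modulo \<open>L + 2\<close>, since distinct indices with equal residues are far enough
    apart for the cells to be ordered; the rounded data value then separates them. The codomain has
    \<open>L + 2\<close> residues, \<open>m + 1\<close> values for each other index and
    \<open>2 * N + 1\<close> rounded values.\<close>
  define \<phi> where "\<phi> = (\<lambda>k. (\<lambda>i\<in>{1..d}. if i = j then k j mod (L + 2) else k i :: nat, \<lfloor>x (A k) j / \<delta>\<rfloor>))"
  have less: "\<lfloor>x (A k) j / \<delta>\<rfloor> < \<lfloor>x (A l) j / \<delta>\<rfloor>"
    if kl: "k \<in> ?W" "l \<in> ?W" "\<And>i. i \<in> {1..d} \<Longrightarrow> i \<noteq> j \<Longrightarrow> k i = l i"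
      and md: "k j mod (L + 2) = l j mod (L + 2)" and lt: "k j < l j" for k l
  proof -
    have "(L + 2) dvd (l j - k j)" using md lt mod_eq_dvd_iff_nat[of "k j" "l j" "L + 2"] by linarith
    then have "L + 2 \<le> l j - k j" using lt by (intro dvd_imp_le) auto
    then have far: "k j + L + 2 \<le> l j" using lt by linarith
    have "x (A k) j - \<delta> \<le> x (B l) j"
    proof (rule monotone_far_cells[where k=k and l=l and L=L and K=K and d=d and m=m
          and u="u (A k)" and v="u (B l)"])
      show "0 \<le> (\<Sum>i=1..d. (x (A k) i - x (B l) i) * (u (A k) i - u (B l) i))"
        using AB[OF kl(1)] AB[OF kl(2)] by (intro mono) auto
      show "k i = l i" if "i \<in> {1..d}" "i \<noteq> j" for i by (rule kl(3)[OF that])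
    qed (fact m j far L \<delta> | use AB[OF kl(1)] AB[OF kl(2)] bd in blast)+
    \<comment> \<open>The width above \<open>2 * \<delta>\<close> of the cell \<open>l\<close>
      outweighs the possible overlap \<open>\<delta>\<close> with the cell \<open>k\<close>; the net
      gain \<open>\<delta>\<close> is one full unit of the floor.\<close>
    then have "x (A k) j + \<delta> \<le> x (A l) j" using AB[OF kl(2)] by linarith
    then have "(x (A k) j + \<delta>) / \<delta> \<le> x (A l) j / \<delta>" using \<delta> by (intro divide_right_mono) auto
    then have "x (A k) j / \<delta> + 1 \<le> x (A l) j / \<delta>" using \<delta> by (simp add: add_divide_distrib)
    then show ?thesis by linarith
  qed
  have "inj_on \<phi> ?W"
  proof (rule inj_onI, rule ccontr)
    fix k l assume k: "k \<in> ?W" and l: "l \<in> ?W" and eq: "\<phi> k = \<phi> l" and ne: "k \<noteq> l"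
    have eqi: "(if i = j then k j mod (L + 2) else k i) = (if i = j then l j mod (L + 2) else l i)"
      if "i \<in> {1..d}" for i
    proof -
      have "fst (\<phi> k) i = fst (\<phi> l) i" using eq by simp
      then show ?thesis using that by (simp add: \<phi>_def)
    qed
    have agree: "k i = l i" if "i \<in> {1..d}" "i \<noteq> j" for i using eqi[OF that(1)] that(2) by simp
    have md: "k j mod (L + 2) = l j mod (L + 2)" using eqi[OF j] by simp
    have fl: "\<lfloor>x (A k) j / \<delta>\<rfloor> = \<lfloor>x (A l) j / \<delta>\<rfloor>" using eq by (simp add: \<phi>_def)
    have "k j \<noteq> l j"
    proof
      assume "k j = l j"
      then have "k = l" using k l agree
        by (intro PiE_ext[of _ "{1..d}" "\<lambda>_. {0..m}"]) (auto simp: cells_def)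
      then show False using ne by simp
    qed
    then consider "k j < l j" | "l j < k j" by linarith
    then show False
      using less[OF k l agree md] less[OF l k agree[symmetric] md[symmetric]] fl by cases auto
  qed
  moreover have "\<phi> ` ?W \<subseteq> (PiE {1..d} (\<lambda>i. if i = j then {..<L + 2} else {..m})) \<times> {- int N..int N}"
  proof (rule image_subsetI)
    fix k assume k: "k \<in> ?W"
    obtain c z where eq: "\<phi> k = (c, z)" by fastforce
    have c: "c \<in> PiE {1..d} (\<lambda>i. if i = j then {..<L + 2} else {..m})"
      using k eq by (auto simp: \<phi>_def cells_def PiE_iff)
    have "\<bar>x (A k) j\<bar> \<le> K" using AB[OF k] j bd by auto
    then have "\<bar>x (A k) j\<bar> \<le> real N * \<delta>" using N by linarith
    then have "- real N \<le> x (A k) j / \<delta>" "x (A k) j / \<delta> \<le> real N"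
      using \<delta> by (auto simp: field_simps abs_le_iff)
    then have "z \<in> {- int N..int N}" using eq by (auto simp: \<phi>_def le_floor_iff floor_le_iff)
    then show "\<phi> k \<in> (PiE {1..d} (\<lambda>i. if i = j then {..<L + 2} else {..m})) \<times> {- int N..int N}"
      using c eq by simp
  qed
  ultimately have "card ?W \<le> card ((PiE {1..d} (\<lambda>i. if i = j then {..<L + 2} else {..m})) \<times> {- int N..int N})"
    by (rule card_inj_on_le) (auto intro!: finite_PiE)
  also have "\<dots> = (\<Prod>i=1..d. if i = j then L + 2 else m + 1) * (2 * N + 1)"
    by (simp add: card_cartesian_product card_PiE if_distrib[of card] nat_add_distrib nat_mult_distrib cong: if_cong)
  also have "(\<Prod>i=1..d. if i = j then L + 2 else m + 1) = (L + 2) * (\<Prod>i\<in>{1..d}-{j}. m + 1)"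
    using j by (subst prod.remove[of _ j]) (auto intro!: prod.cong)
  also have "(\<Prod>i\<in>{1..d}-{j}. m + 1) = (m + 1) ^ (d - 1)" using j by simp
  finally show ?thesis .
qed

text \<open>On a cell that is not wide in any direction, \<open>f\<close> is nearly constant on the
  data in the box of radius \<open>K\<close>, and its value at one representative serves as the
  coefficient. The wide cells number at most a multiple of \<open>m ^ (d - 1)\<close> and have mass
  at most \<open>2 * (2 / m) ^ d\<close> each, which is negligible for large \<open>m\<close>. The
  mesh is fixed before the sample and \<open>f\<close>; it depends only on \<open>d\<close>,
  \<open>\<epsilon>\<close>, \<open>K\<close> and \<open>\<Lambda>\<close>.\<close>

lemma block_approx:
  assumes d: "1 \<le> d" and \<epsilon>: "0 < \<epsilon>" and K: "0 \<le> K" and \<Lambda>: "0 \<le> \<Lambda>"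
  obtains m :: nat where "1 \<le> m"
    and "\<And>n u x f. 1 \<le> n \<Longrightarrow> (\<And>a. a \<in> {1..n} \<Longrightarrow> u a \<in> unit_cube d) \<Longrightarrow>
      (\<And>a b. a \<in> {1..n} \<Longrightarrow> b \<in> {1..n} \<Longrightarrow> 0 \<le> (\<Sum>i=1..d. (x a i - x b i) * (u a i - u b i))) \<Longrightarrow>
      (\<And>y. 0 \<le> f y \<and> f y \<le> 1) \<Longrightarrow>
      (\<And>y z. \<bar>f y - f z\<bar> \<le> \<Lambda> * (\<Sum>i=1..d. \<bar>y i - z i\<bar>)) \<Longrightarrow>
      (\<And>k. k \<in> cells d m \<Longrightarrow> (\<Sum>a=1..n. tent d m k (u a)) / real n \<le> 2 * (2 / real m) ^ d) \<Longrightarrow>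
      \<exists>g. (\<forall>k. 0 \<le> g k \<and> g k \<le> (1::real)) \<and>
        (\<Sum>a=1..n. \<bar>f (x a) - (\<Sum>k\<in>cells d m. g k * tent d m k (u a))\<bar>) / real n
          \<le> \<epsilon> + real (card {a\<in>{1..n}. \<exists>i\<in>{1..d}. K < \<bar>x a i\<bar>}) / real n"
proof -
  \<comment> \<open>In a cell that is not wide, the \<open>d\<close> coordinates vary by at most
    \<open>2 * \<delta>\<close> each, so \<open>f\<close> varies by at most
    \<open>\<epsilon> / 2\<close>.\<close>
  define \<delta> where "\<delta> = \<epsilon> / (4 * real d * (\<Lambda> + 1))"
  have \<delta>: "0 < \<delta>" using d \<epsilon> \<Lambda> by (simp add: \<delta>_def)
  have \<delta>_le: "\<Lambda> * (real d * (2 * \<delta>)) \<le> \<epsilon> / 2"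
  proof -
    have "real d * (2 * \<delta>) = (\<epsilon> / 2) / (\<Lambda> + 1)" using d by (simp add: \<delta>_def)
    then have "\<Lambda> * (real d * (2 * \<delta>)) = (\<epsilon> / 2) * (\<Lambda> / (\<Lambda> + 1))" by simp
    also have "\<dots> \<le> (\<epsilon> / 2) * 1" using \<epsilon> \<Lambda> by (intro mult_left_mono) (auto simp: field_simps)
    finally show ?thesis by simp
  qed
  \<comment> \<open>The distance, in cells, beyond which the other coordinates can no longer
    compensate a decrease by \<open>\<delta>\<close> in the monotonicity inequality.\<close>
  define L where "L = nat \<lceil>4 * K * real d / \<delta>\<rceil> + 1"
  have L: "1 \<le> L" "4 * K * real d \<le> real L * \<delta>"
  proof -
    have "4 * K * real d / \<delta> \<le> real L" unfolding L_def by linarith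
    then show "4 * K * real d \<le> real L * \<delta>" using \<delta> by (simp add: field_simps)
  qed (simp add: L_def)
  define N where "N = nat \<lceil>K / \<delta>\<rceil>"
  have N: "K \<le> real N * \<delta>"
  proof -
    have "K / \<delta> \<le> real N" unfolding N_def by linarith
    then show ?thesis using \<delta> by (simp add: field_simps)
  qed
  define B where "B = real d * real (L + 2) * real (2 * N + 1)"
  \<comment> \<open>Makes the total mass of the wide cells, at most \<open>B * 4 ^ d / m\<close>, no
    larger than \<open>\<epsilon> / 2\<close>.\<close>
  define m where "m = nat \<lceil>2 * B * 4 ^ d / \<epsilon>\<rceil> + 1"
  have m: "1 \<le> m" by (simp add: m_def)
  have B: "0 \<le> B" by (simp add: B_def)
  have m_ge: "B * 4 ^ d / real m \<le> \<epsilon> / 2"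
  proof -
    have "2 * B * 4 ^ d / \<epsilon> \<le> real m" unfolding m_def by linarith
    then show ?thesis using \<epsilon> m by (simp add: field_simps)
  qed
  show ?thesis
  proof (rule that[OF m])
    fix n :: nat and u x :: "nat \<Rightarrow> vec" and f :: "vec \<Rightarrow> real"
    assume n: "1 \<le> n" and u: "\<And>a. a \<in> {1..n} \<Longrightarrow> u a \<in> unit_cube d"
      and mono: "\<And>a b. a \<in> {1..n} \<Longrightarrow> b \<in> {1..n} \<Longrightarrow> 0 \<le> (\<Sum>i=1..d. (x a i - x b i) * (u a i - u b i))"
      and f: "\<And>y. 0 \<le> f y \<and> f y \<le> 1"
      and lip: "\<And>y z. \<bar>f y - f z\<bar> \<le> \<Lambda> * (\<Sum>i=1..d. \<bar>y i - z i\<bar>)"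
      and unif: "\<And>k. k \<in> cells d m \<Longrightarrow> (\<Sum>a=1..n. tent d m k (u a)) / real n \<le> 2 * (2 / real m) ^ d"
    define G where "G = {a\<in>{1..n}. \<forall>i\<in>{1..d}. \<bar>x a i\<bar> \<le> K}"
    define W where "W = (\<Union>j\<in>{1..d}. {k \<in> cells d m. wide_cell d m G x u \<delta> j k})"
    have W: "finite W" "W \<subseteq> cells d m" by (auto simp: W_def)
    have "real (card W) \<le> B * real (m + 1) ^ (d - 1)"
    proof -
      have "card W \<le> (\<Sum>j=1..d. card {k \<in> cells d m. wide_cell d m G x u \<delta> j k})"
        unfolding W_def by (rule card_UN_le) simp
      also have "\<dots> \<le> (\<Sum>j=1..d. (L + 2) * (m + 1) ^ (d - 1) * (2 * N + 1))"
        using mono by (intro sum_mono card_wide_cells[where K=K] m L \<delta> N) (auto simp: G_def)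
      finally have "real (card W) \<le> real (\<Sum>j=1..d. (L + 2) * (m + 1) ^ (d - 1) * (2 * N + 1))"
        by (rule of_nat_mono)
      then show ?thesis by (simp add: B_def algebra_simps)
    qed
    also have "\<dots> \<le> B * (2 * real m) ^ (d - 1)"
      using m B by (intro mult_left_mono power_mono) auto
    finally have card_W: "real (card W) \<le> B * (2 * real m) ^ (d - 1)" .
    have W_mass: "(\<Sum>k\<in>W. (\<Sum>a=1..n. tent d m k (u a)) / real n) \<le> \<epsilon> / 2"
    proof -
      have "(\<Sum>k\<in>W. (\<Sum>a=1..n. tent d m k (u a)) / real n) \<le> (\<Sum>k\<in>W. 2 * (2 / real m) ^ d)"
        using W by (intro sum_mono unif) auto
      also have "\<dots> = real (card W) * (2 * (2 / real m) ^ d)" by simp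
      also have "\<dots> \<le> (B * (2 * real m) ^ (d - 1)) * (2 * (2 / real m) ^ d)"
        by (intro mult_right_mono card_W) simp
      also have "\<dots> = B * 4 ^ d / real m"
      proof -
        obtain e where e: "d = Suc e" using d by (cases d) auto
        have "(4::real) ^ e = 2 ^ e * 2 ^ e" by (simp flip: power_mult_distrib)
        then show ?thesis using m unfolding e by (simp add: power_mult_distrib power_divide)
      qed
      also note m_ge
      finally show ?thesis .
    qed
    \<comment> \<open>The default 0 occurs only for cells that meet no point of \<open>G\<close>. A
      tent of such a cell is positive only at observations outside \<open>G\<close>, and these are
      charged to the tail count.\<close>
    define g where "g = (\<lambda>k. if \<exists>b\<in>G. 0 < tent d m k (u b) then f (x (SOME b. b \<in> G \<and> 0 < tent d m k (u b))) else 0)"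
    have g: "0 \<le> g k" "g k \<le> 1" for k using f by (auto simp: g_def)
    have point: "\<bar>f (x a) - (\<Sum>k\<in>cells d m. g k * tent d m k (u a))\<bar>
        \<le> \<epsilon> / 2 + (\<Sum>k\<in>W. tent d m k (u a)) + of_bool (a \<notin> G)" if a: "a \<in> {1..n}" for a
    proof -
      have cell: "\<bar>f (x a) - g k\<bar> * tent d m k (u a)
          \<le> (\<epsilon> / 2 + of_bool (k \<in> W) + of_bool (a \<notin> G)) * tent d m k (u a)" if k: "k \<in> cells d m" for k
      proof (cases "tent d m k (u a) = 0")
        case False
        then have pos: "0 < tent d m k (u a)" using tent_nonneg[of d m k "u a"] by linarith
        have le1: "\<bar>f (x a) - g k\<bar> \<le> 1" using f[of "x a"] g[of k] by linarith
        have "\<bar>f (x a) - g k\<bar> \<le> \<epsilon> / 2 + of_bool (k \<in> W) + of_bool (a \<notin> G)"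
        proof (cases "k \<in> W \<or> a \<notin> G")
          case True
          then show ?thesis using le1 \<epsilon> by (auto simp: of_bool_def)
        next
          case False
          define b where "b = (SOME b. b \<in> G \<and> 0 < tent d m k (u b))"
          have ex: "\<exists>b. b \<in> G \<and> 0 < tent d m k (u b)" using False pos by auto
          have b: "b \<in> G" "0 < tent d m k (u b)" using someI_ex[OF ex] by (simp_all add: b_def)
          have gk: "g k = f (x b)" using ex by (auto simp: g_def b_def)
          have "\<bar>x a j - x b j\<bar> \<le> 2 * \<delta>" if j: "j \<in> {1..d}" for j
          proof -
            have "\<not> wide_cell d m G x u \<delta> j k" using False k j by (auto simp: W_def)
            then have le: "x p j - x q j \<le> 2 * \<delta>"
              if "p \<in> G" "q \<in> G" "0 < tent d m k (u p)" "0 < tent d m k (u q)" for p q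
              using that unfolding wide_cell_def by (meson not_le)
            show ?thesis using le[of a b] le[of b a] b pos False by (simp add: abs_le_iff)
          qed
          then have "(\<Sum>i=1..d. \<bar>x a i - x b i\<bar>) \<le> real d * (2 * \<delta>)"
            using sum_bounded_above[of "{1..d}" "\<lambda>i. \<bar>x a i - x b i\<bar>" "2 * \<delta>"] by simp
          then have "\<Lambda> * (\<Sum>i=1..d. \<bar>x a i - x b i\<bar>) \<le> \<Lambda> * (real d * (2 * \<delta>))"
            using \<Lambda> by (rule mult_left_mono)
          then show ?thesis using lip[of "x a" "x b"] \<delta>_le False by (simp add: gk)
        qed
        then show ?thesis using pos by (intro mult_right_mono) auto
      qed simp
      \<comment> \<open>The tents sum to 1 at \<open>u a\<close>, so \<open>f (x a)\<close> can be
        distributed over the cells and compared with \<open>g\<close> cell by cell.\<close>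
      have "f (x a) - (\<Sum>k\<in>cells d m. g k * tent d m k (u a)) = (\<Sum>k\<in>cells d m. (f (x a) - g k) * tent d m k (u a))"
        using sum_tent[OF u[OF a], of m] by (simp add: left_diff_distrib sum_subtractf flip: sum_distrib_left)
      also have "\<bar>\<dots>\<bar> \<le> (\<Sum>k\<in>cells d m. \<bar>f (x a) - g k\<bar> * tent d m k (u a))"
        by (rule order.trans[OF sum_abs]) (simp add: abs_mult tent_nonneg)
      also have "\<dots> \<le> (\<Sum>k\<in>cells d m. (\<epsilon> / 2 + of_bool (k \<in> W) + of_bool (a \<notin> G)) * tent d m k (u a))"
        by (intro sum_mono cell)
      also have "\<dots> = (\<epsilon> / 2 + of_bool (a \<notin> G)) * (\<Sum>k\<in>cells d m. tent d m k (u a))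
          + (\<Sum>k\<in>cells d m. of_bool (k \<in> W) * tent d m k (u a))"
        unfolding sum_distrib_left sum.distrib[symmetric] by (intro sum.cong refl) (simp add: algebra_simps)
      also have "(\<Sum>k\<in>cells d m. of_bool (k \<in> W) * tent d m k (u a)) = (\<Sum>k\<in>W. tent d m k (u a))"
        using W by (intro sum.mono_neutral_cong_right) auto
      finally show ?thesis using sum_tent[OF u[OF a], of m] by simp
    qed
    have "(\<Sum>a=1..n. \<bar>f (x a) - (\<Sum>k\<in>cells d m. g k * tent d m k (u a))\<bar>)
        \<le> (\<Sum>a=1..n. \<epsilon> / 2 + (\<Sum>k\<in>W. tent d m k (u a)) + of_bool (a \<notin> G))"
      by (intro sum_mono point)
    also have "\<dots> = real n * (\<epsilon> / 2) + (\<Sum>k\<in>W. \<Sum>a=1..n. tent d m k (u a)) + (\<Sum>a=1..n. of_bool (a \<notin> G))"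
      by (simp add: sum.distrib) (rule sum.swap)
    also have "(\<Sum>a=1..n. of_bool (a \<notin> G) :: real) = real (card {a\<in>{1..n}. \<exists>i\<in>{1..d}. K < \<bar>x a i\<bar>})"
    proof -
      have "{a\<in>{1..n}. \<exists>i\<in>{1..d}. K < \<bar>x a i\<bar>} = {a\<in>{1..n}. a \<notin> G}" by (auto simp: G_def not_le)
      then show ?thesis by (simp add: of_bool_def sum.If_cases Int_def)
    qed
    finally have "(\<Sum>a=1..n. \<bar>f (x a) - (\<Sum>k\<in>cells d m. g k * tent d m k (u a))\<bar>) / real n
      \<le> (real n * (\<epsilon> / 2) + (\<Sum>k\<in>W. \<Sum>a=1..n. tent d m k (u a))
          + real (card {a\<in>{1..n}. \<exists>i\<in>{1..d}. K < \<bar>x a i\<bar>})) / real n"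
      by (rule divide_right_mono) simp
    also have "\<dots> = \<epsilon> / 2 + (\<Sum>k\<in>W. (\<Sum>a=1..n. tent d m k (u a)) / real n)
        + real (card {a\<in>{1..n}. \<exists>i\<in>{1..d}. K < \<bar>x a i\<bar>}) / real n"
      using n by (simp add: add_divide_distrib sum_divide_distrib)
    also have "\<dots> \<le> \<epsilon> + real (card {a\<in>{1..n}. \<exists>i\<in>{1..d}. K < \<bar>x a i\<bar>}) / real n"
      using W_mass by simp
    finally show "\<exists>g. (\<forall>k. 0 \<le> g k \<and> g k \<le> 1) \<and>
        (\<Sum>a=1..n. \<bar>f (x a) - (\<Sum>k\<in>cells d m. g k * tent d m k (u a))\<bar>) / real n
          \<le> \<epsilon> + real (card {a\<in>{1..n}. \<exists>i\<in>{1..d}. K < \<bar>x a i\<bar>}) / real n"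
      using g by blast
  qed
qed

section \<open>Asymptotic independence by trigonometric approximation\<close>

definition expi :: "nat \<Rightarrow> vec \<Rightarrow> vec \<Rightarrow> complex" where
  "expi d t v = exp (\<i> * complex_of_real (vinner d t v))"

lemma norm_expi [simp]: "cmod (expi d t v) = 1"
  by (simp add: expi_def)

lemma char_dev_eq_avg: "char_dev d n u t b = avg n (\<lambda>a. expi d t (u a)) - expi d t (u b)"
  by (simp add: char_dev_def avg_def expi_def)

lemma dcov_char_eq_avg: "dcov_char d n S R t = avg n (\<lambda>b. \<Prod>i\<in>S. char_dev (d i) n (R i) (t i) b)"
  by (simp add: dcov_char_def avg_def)

definition joint_gap ::
  "nat \<Rightarrow> nat set \<Rightarrow> (nat \<Rightarrow> vec \<Rightarrow> complex) \<Rightarrow> (nat \<Rightarrow> nat \<Rightarrow> vec) \<Rightarrow> complex" where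
  "joint_gap n I \<psi> u = avg n (\<lambda>b. \<Prod>i\<in>I. \<psi> i (u i b)) - (\<Prod>i\<in>I. avg n (\<lambda>b. \<psi> i (u i b)))"

text \<open>Expand \<open>\<Prod> e\<^sub>i = \<Prod> (\<phi>\<^sub>i - (\<phi>\<^sub>i - e\<^sub>i))\<close>, where \<open>\<phi>\<^sub>i\<close> is the mean of \<open>e\<^sub>i\<close>; singletons contribute nothing.\<close>

lemma joint_gap_expi_le:
  assumes n: "1 \<le> n" and I: "finite I"
  shows "cmod (joint_gap n I (\<lambda>i. expi (d i) (t i)) u)
    \<le> (\<Sum>S | S \<subseteq> I \<and> 2 \<le> card S. cmod (dcov_char d n S u t))"
proof -
  define \<phi> where "\<phi> = (\<lambda>i. avg n (\<lambda>b. expi (d i) (t i) (u i b)))"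
  define z where "z = (\<lambda>i. char_dev (d i) n (u i) (t i))"
  define c where "c = (\<lambda>S. (- 1) ^ card S * (\<Prod>i\<in>I - S. \<phi> i))"
  have "(\<Prod>i\<in>I. expi (d i) (t i) (u i b)) = (\<Sum>S\<in>Pow I. c S * (\<Prod>i\<in>S. z i b))" for b
  proof -
    have "(\<Prod>i\<in>I. expi (d i) (t i) (u i b)) = (\<Prod>i\<in>I. - z i b + \<phi> i)"
      by (simp add: z_def char_dev_eq_avg \<phi>_def)
    also have "\<dots> = (\<Sum>S\<in>Pow I. (\<Prod>i\<in>S. - z i b) * (\<Prod>i\<in>I - S. \<phi> i))"
      by (rule prod_add[OF I])
    also have "\<dots> = (\<Sum>S\<in>Pow I. c S * (\<Prod>i\<in>S. z i b))"
      by (intro sum.cong refl) (simp add: c_def prod_uminus)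
    finally show ?thesis .
  qed
  then have "avg n (\<lambda>b. \<Prod>i\<in>I. expi (d i) (t i) (u i b)) = (\<Sum>S\<in>Pow I. c S * dcov_char d n S u t)"
    by (simp add: avg_sum avg_cmult dcov_char_eq_avg z_def)
  also have "\<dots> = c {} * dcov_char d n {} u t + (\<Sum>S\<in>Pow I - {{}}. c S * dcov_char d n S u t)"
    using I by (subst sum.remove[of _ "{}"]) auto
  also have "c {} * dcov_char d n {} u t = (\<Prod>i\<in>I. \<phi> i)"
    using n by (simp add: c_def dcov_char_eq_avg avg_const)
  also have "(\<Sum>S\<in>Pow I - {{}}. c S * dcov_char d n S u t)
      = (\<Sum>S | S \<subseteq> I \<and> 2 \<le> card S. c S * dcov_char d n S u t)"
  proof (rule sum.mono_neutral_right)
    show "\<forall>S\<in>Pow I - {{}} - {S. S \<subseteq> I \<and> 2 \<le> card S}. c S * dcov_char d n S u t = 0"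
    proof
      fix S assume S: "S \<in> Pow I - {{}} - {S. S \<subseteq> I \<and> 2 \<le> card S}"
      then have "finite S" using I by (auto intro: finite_subset)
      then have "card S \<noteq> 0" "card S < 2" using S by auto
      then have "card S = 1" by linarith
      then obtain i where "S = {i}" by (auto simp: card_1_singleton_iff)
      then show "c S * dcov_char d n S u t = 0"
        using n by (simp add: dcov_char_eq_avg char_dev_eq_avg avg_diff avg_const)
    qed
  qed (use I in auto)
  finally have "joint_gap n I (\<lambda>i. expi (d i) (t i)) u
      = (\<Sum>S | S \<subseteq> I \<and> 2 \<le> card S. c S * dcov_char d n S u t)"
    by (simp add: joint_gap_def \<phi>_def)
  also have "cmod \<dots> \<le> (\<Sum>S | S \<subseteq> I \<and> 2 \<le> card S. 1 * cmod (dcov_char d n S u t))"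
  proof (rule sum_norm_le)
    fix S
    have "cmod (\<phi> i) \<le> 1" for i unfolding \<phi>_def by (rule norm_avg_le) auto
    then have "cmod (c S) \<le> 1"
      unfolding c_def norm_mult prod_norm[symmetric] by (simp add: norm_power prod_le_1)
    then show "cmod (c S * dcov_char d n S u t) \<le> 1 * cmod (dcov_char d n S u t)"
      unfolding norm_mult by (rule mult_right_mono) simp
  qed
  finally show ?thesis by simp
qed

section \<open>The algebra of uniform limits of exponential sums on the cube\<close>

inductive trig_poly :: "nat \<Rightarrow> (vec \<Rightarrow> complex) \<Rightarrow> bool" for d where
  expi: "trig_poly d (expi d t)"
| add: "trig_poly d f \<Longrightarrow> trig_poly d g \<Longrightarrow> trig_poly d (\<lambda>v. f v + g v)"
| scale: "trig_poly d f \<Longrightarrow> trig_poly d (\<lambda>v. c * f v)"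

text \<open>The frequencies range over all real vectors, so no periodicity is forced on the cube.
  This is why even the coordinate functions belong to the closure.\<close>

definition trig_limit :: "nat \<Rightarrow> (vec \<Rightarrow> complex) \<Rightarrow> bool" where
  "trig_limit d f \<longleftrightarrow> (\<forall>\<epsilon>>0. \<exists>g. trig_poly d g \<and> (\<forall>v\<in>unit_cube d. cmod (f v - g v) \<le> \<epsilon>))"

lemma expi_mult: "expi d t v * expi d s v = expi d (\<lambda>j. t j + s j) v"
  by (simp add: expi_def vinner_def distrib_right sum.distrib distrib_left flip: exp_add)

lemma trig_poly_mult:
  assumes "trig_poly d f" "trig_poly d g"
  shows "trig_poly d (\<lambda>v. f v * g v)"
  using assms(1)
proof induction
  case (expi t)
  show ?case
    using assms(2)
  proof induction
    case (expi s)
    then show ?case unfolding expi_mult by (rule trig_poly.expi)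
  next
    case (add g h)
    then show ?case using trig_poly.add by (fastforce simp: distrib_left)
  next
    case (scale g c)
    then show ?case using trig_poly.scale[of d _ c] by (fastforce simp: mult.left_commute)
  qed
next
  case (add f h)
  then show ?case using trig_poly.add by (fastforce simp: distrib_right)
next
  case (scale f c)
  then show ?case using trig_poly.scale[of d _ c] by (fastforce simp: mult.assoc)
qed

lemma trig_poly_bounded:
  assumes "trig_poly d f"
  shows "\<exists>B\<ge>0. \<forall>v. cmod (f v) \<le> B"
  using assms
proof induction
  case (expi t)
  show ?case by (rule exI[of _ 1]) simp
next
  case (add f g)
  then obtain A B where "0 \<le> A" "0 \<le> B" "\<And>v. cmod (f v) \<le> A" "\<And>v. cmod (g v) \<le> B" by blast
  then show ?case by (intro exI[of _ "A + B"]) (auto intro: norm_triangle_le add_mono)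
next
  case (scale f c)
  then obtain A where "0 \<le> A" "\<And>v. cmod (f v) \<le> A" by blast
  then show ?case by (intro exI[of _ "cmod c * A"]) (auto simp: norm_mult intro: mult_left_mono)
qed

lemma trig_limit_poly: "trig_poly d f \<Longrightarrow> trig_limit d f"
  unfolding trig_limit_def by (metis diff_self less_imp_le norm_zero)

lemma trig_limit_expi: "trig_limit d (expi d t)"
  by (intro trig_limit_poly trig_poly.expi)

lemma trig_limit_bounded:
  assumes "trig_limit d f"
  shows "\<exists>B\<ge>0. \<forall>v\<in>unit_cube d. cmod (f v) \<le> B"
proof -
  obtain g where g: "trig_poly d g" "\<And>v. v \<in> unit_cube d \<Longrightarrow> cmod (f v - g v) \<le> 1"
    using assms unfolding trig_limit_def by (metis zero_less_one)
  obtain B where B: "0 \<le> B" "\<And>v. cmod (g v) \<le> B" using trig_poly_bounded[OF g(1)] by blast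
  have "cmod (f v) \<le> B + 1" if "v \<in> unit_cube d" for v
    using g(2)[OF that] B(2)[of v] norm_triangle_sub[of "f v" "g v"] by linarith
  then show ?thesis using B(1) by (intro exI[of _ "B + 1"]) auto
qed

lemma trig_limit_uniform_limit:
  assumes "\<And>\<epsilon>. 0 < \<epsilon> \<Longrightarrow> \<exists>g. trig_limit d g \<and> (\<forall>v\<in>unit_cube d. cmod (f v - g v) \<le> \<epsilon>)"
  shows "trig_limit d f"
  unfolding trig_limit_def
proof (intro allI impI)
  fix \<epsilon> :: real assume \<epsilon>: "0 < \<epsilon>"
  obtain g where g: "trig_limit d g" "\<And>v. v \<in> unit_cube d \<Longrightarrow> cmod (f v - g v) \<le> \<epsilon> / 2"
    using assms[of "\<epsilon> / 2"] \<epsilon> by auto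
  obtain h where h: "trig_poly d h" "\<And>v. v \<in> unit_cube d \<Longrightarrow> cmod (g v - h v) \<le> \<epsilon> / 2"
    using g(1) \<epsilon> unfolding trig_limit_def by (metis half_gt_zero)
  have "cmod (f v - h v) \<le> \<epsilon>" if "v \<in> unit_cube d" for v
    using g(2)[OF that] h(2)[OF that] norm_triangle_ineq[of "f v - g v" "g v - h v"] by simp
  then show "\<exists>g. trig_poly d g \<and> (\<forall>v\<in>unit_cube d. cmod (f v - g v) \<le> \<epsilon>)" using h(1) by blast
qed

lemma trig_limit_add:
  assumes "trig_limit d f" "trig_limit d g"
  shows "trig_limit d (\<lambda>v. f v + g v)"
proof (rule trig_limit_uniform_limit)
  fix \<epsilon> :: real assume \<epsilon>: "0 < \<epsilon>"
  obtain p where p: "trig_poly d p" "\<And>v. v \<in> unit_cube d \<Longrightarrow> cmod (f v - p v) \<le> \<epsilon> / 2"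
    using assms(1) \<epsilon> unfolding trig_limit_def by (metis half_gt_zero)
  obtain q where q: "trig_poly d q" "\<And>v. v \<in> unit_cube d \<Longrightarrow> cmod (g v - q v) \<le> \<epsilon> / 2"
    using assms(2) \<epsilon> unfolding trig_limit_def by (metis half_gt_zero)
  have "cmod (f v + g v - (p v + q v)) \<le> \<epsilon>" if "v \<in> unit_cube d" for v
    using norm_diff_triangle_ineq[of "f v" "g v" "p v" "q v"] p(2)[OF that] q(2)[OF that] by linarith
  then show "\<exists>h. trig_limit d h \<and> (\<forall>v\<in>unit_cube d. cmod (f v + g v - h v) \<le> \<epsilon>)"
    using trig_limit_poly[OF trig_poly.add[OF p(1) q(1)]] by blast
qed

lemma trig_limit_mult:
  assumes "trig_limit d f" "trig_limit d g"
  shows "trig_limit d (\<lambda>v. f v * g v)"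
proof (rule trig_limit_uniform_limit)
  fix \<epsilon> :: real assume \<epsilon>: "0 < \<epsilon>"
  obtain B where B: "0 \<le> B" "\<And>v. v \<in> unit_cube d \<Longrightarrow> cmod (g v) \<le> B"
    using trig_limit_bounded[OF assms(2)] by blast
  have "0 < \<epsilon> / (2 * (B + 1))" using \<epsilon> B by simp
  then obtain p where p: "trig_poly d p" "\<And>v. v \<in> unit_cube d \<Longrightarrow> cmod (f v - p v) \<le> \<epsilon> / (2 * (B + 1))"
    using assms(1) unfolding trig_limit_def by metis
  obtain A where A: "0 \<le> A" "\<And>v. cmod (p v) \<le> A" using trig_poly_bounded[OF p(1)] by blast
  have "0 < \<epsilon> / (2 * (A + 1))" using \<epsilon> A by simp
  then obtain q where q: "trig_poly d q" "\<And>v. v \<in> unit_cube d \<Longrightarrow> cmod (g v - q v) \<le> \<epsilon> / (2 * (A + 1))"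
    using assms(2) unfolding trig_limit_def by metis
  have "cmod (f v * g v - p v * q v) \<le> \<epsilon>" if v: "v \<in> unit_cube d" for v
  proof -
    have 1: "cmod ((f v - p v) * g v) \<le> \<epsilon> / (2 * (B + 1)) * (B + 1)"
      unfolding norm_mult using p(2)[OF v] B \<epsilon> v by (intro mult_mono) (auto intro: add_increasing2)
    have 2: "cmod (p v * (g v - q v)) \<le> (A + 1) * (\<epsilon> / (2 * (A + 1)))"
      unfolding norm_mult using q(2)[OF v] A \<epsilon> by (intro mult_mono) (auto intro: add_increasing2)
    have cancel: "\<epsilon> / (2 * x) * x = \<epsilon> / 2" "x * (\<epsilon> / (2 * x)) = \<epsilon> / 2" if "x \<noteq> 0" for x
      using that by simp_all
    have "\<epsilon> / (2 * (B + 1)) * (B + 1) = \<epsilon> / 2" by (rule cancel(1)) (use B(1) in linarith)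
    moreover have "(A + 1) * (\<epsilon> / (2 * (A + 1))) = \<epsilon> / 2" by (rule cancel(2)) (use A(1) in linarith)
    ultimately have "cmod ((f v - p v) * g v) \<le> \<epsilon> / 2" "cmod (p v * (g v - q v)) \<le> \<epsilon> / 2"
      using 1 2 by (simp_all only:)
    moreover have eq: "f v * g v - p v * q v = (f v - p v) * g v + p v * (g v - q v)"
      by (simp add: algebra_simps)
    ultimately show ?thesis
      unfolding eq using norm_triangle_ineq[of "(f v - p v) * g v" "p v * (g v - q v)"] by linarith
  qed
  then show "\<exists>h. trig_limit d h \<and> (\<forall>v\<in>unit_cube d. cmod (f v * g v - h v) \<le> \<epsilon>)"
    using trig_limit_poly[OF trig_poly_mult[OF p(1) q(1)]] by blast
qed

lemma trig_poly_const: "trig_poly d (\<lambda>_. c)"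
proof -
  have "expi d (\<lambda>_. 0) = (\<lambda>_. 1)" by (simp add: expi_def vinner_def fun_eq_iff)
  then show ?thesis using trig_poly.scale[OF trig_poly.expi[of d "\<lambda>_. 0"], of c] by simp
qed

lemma trig_limit_const: "trig_limit d (\<lambda>_. c)"
  by (intro trig_limit_poly trig_poly_const)

lemma trig_limit_power: "trig_limit d f \<Longrightarrow> trig_limit d (\<lambda>v. f v ^ k)"
  by (induction k) (auto intro: trig_limit_const trig_limit_mult)

lemma trig_limit_sum: "(\<And>k. k \<in> A \<Longrightarrow> trig_limit d (f k)) \<Longrightarrow> trig_limit d (\<lambda>v. \<Sum>k\<in>A. f k v)"
  by (induction A rule: infinite_finite_induct) (auto intro: trig_limit_const trig_limit_add)

lemma trig_limit_prod: "(\<And>k. k \<in> A \<Longrightarrow> trig_limit d (f k)) \<Longrightarrow> trig_limit d (\<lambda>v. \<Prod>k\<in>A. f k v)"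
  by (induction A rule: infinite_finite_induct) (auto intro: trig_limit_const trig_limit_mult)

text \<open>A coordinate \<open>v\<^sub>j\<close> is the uniform limit of \<open>(exp (\<i> s v\<^sub>j) - 1) / (\<i> s)\<close> as \<open>s \<rightarrow> 0\<close>.\<close>

lemma trig_limit_component:
  assumes j: "j \<in> {1..d}"
  shows "trig_limit d (\<lambda>v. complex_of_real (v j))"
proof (rule trig_limit_uniform_limit)
  fix \<epsilon> :: real assume \<epsilon>: "0 < \<epsilon>"
  define t :: vec where "t = (\<lambda>l. if l = j then \<epsilon> else 0)"
  define g where "g = (\<lambda>v. 1 / (\<i> * complex_of_real \<epsilon>) * expi d t v + - 1 / (\<i> * complex_of_real \<epsilon>))"
  have "trig_poly d g"
    unfolding g_def by (intro trig_poly.add trig_poly.scale trig_poly.expi trig_poly_const)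
  moreover have "cmod (complex_of_real (v j) - g v) \<le> \<epsilon>" if v: "v \<in> unit_cube d" for v
  proof -
    have vj: "0 \<le> v j" "v j \<le> 1" using unit_cubeD[OF v j] by auto
    have vin: "vinner d t v = \<epsilon> * v j"
    proof -
      have "vinner d t v = (\<Sum>l=1..d. if l = j then \<epsilon> * v l else 0)"
        unfolding vinner_def t_def by (intro sum.cong) auto
      also have "\<dots> = \<epsilon> * v j" using j by (subst sum.delta) auto
      finally show ?thesis .
    qed
    have "complex_of_real (v j) - g v
        = - (expi d t v - (1 + \<i> * complex_of_real (\<epsilon> * v j))) / (\<i> * complex_of_real \<epsilon>)"
      using \<epsilon> by (simp add: g_def field_simps)
    also have "cmod \<dots> = cmod (iexp (\<epsilon> * v j) - (\<Sum>k\<le>1. (\<i> * (\<epsilon> * v j)) ^ k / fact k)) / \<epsilon>"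
      using \<epsilon> by (simp add: norm_divide norm_mult expi_def vin norm_minus_commute)
    also have "\<dots> \<le> (\<bar>\<epsilon> * v j\<bar> ^ 2 / 2) / \<epsilon>"
      using iexp_approx1[of "\<epsilon> * v j" 1] \<epsilon>
      by (intro divide_right_mono) (auto simp: numeral_2_eq_2)
    also have "\<dots> = \<epsilon> * (v j)\<^sup>2 / 2" using \<epsilon> by (simp add: power_mult_distrib power2_eq_square)
    also have "\<dots> \<le> \<epsilon>"
      using \<epsilon> vj power_le_one[of "v j" 2] mult_left_mono[of "(v j)\<^sup>2" 1 \<epsilon>] by simp
    finally show ?thesis .
  qed
  ultimately show "\<exists>g. trig_limit d g \<and> (\<forall>v\<in>unit_cube d. cmod (complex_of_real (v j) - g v) \<le> \<epsilon>)"
    using trig_limit_poly by blast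
qed

text \<open>The closure is an algebra containing the constants and the coordinates, hence all
  polynomials in one coordinate. Bernstein polynomials approximate \<open>f\<close> uniformly, so no
  general Stone-Weierstrass argument is required.\<close>

lemma trig_limit_continuous_component:
  fixes f :: "real \<Rightarrow> real"
  assumes j: "j \<in> {1..d}" and f: "continuous_on {0..1} f"
  shows "trig_limit d (\<lambda>v. complex_of_real (f (v j)))"
proof (rule trig_limit_uniform_limit)
  fix \<epsilon> :: real assume "0 < \<epsilon>"
  then obtain n where n: "\<And>x. x \<in> {0..1} \<Longrightarrow> \<bar>f x - (\<Sum>k\<le>n. f (k / n) * Bernstein n k x)\<bar> < \<epsilon>"
    using Bernstein_Weierstrass[OF f] by (metis order_refl)
  let ?g = "\<lambda>v. complex_of_real (\<Sum>k\<le>n. f (k / n) * Bernstein n k (v j))"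
  have diff: "trig_limit d (\<lambda>v. 1 + (- 1) * complex_of_real (v j))"
    by (intro trig_limit_add trig_limit_mult trig_limit_const trig_limit_component[OF j])
  have "trig_limit d (\<lambda>v. \<Sum>k\<le>n. complex_of_real (f (k / n)) * (complex_of_real (n choose k)
      * complex_of_real (v j) ^ k * (1 + (- 1) * complex_of_real (v j)) ^ (n - k)))"
    by (intro trig_limit_sum trig_limit_mult trig_limit_const trig_limit_power diff trig_limit_component[OF j])
  then have "trig_limit d ?g" by (simp add: Bernstein_def)
  moreover have "cmod (complex_of_real (f (v j)) - ?g v) \<le> \<epsilon>" if "v \<in> unit_cube d" for v
    using n[of "v j"] unit_cubeD[OF that j] unfolding of_real_diff[symmetric] norm_of_real by auto
  ultimately show "\<exists>g. trig_limit d g \<and> (\<forall>v\<in>unit_cube d. cmod (complex_of_real (f (v j)) - g v) \<le> \<epsilon>)"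
    by blast
qed

section \<open>From exponentials to general test functions, one slot at a time\<close>

lemma joint_gap_remove:
  assumes "finite I" "j \<in> I"
  shows "joint_gap n I (\<psi>(j := f)) u = avg n (\<lambda>b. f (u j b) * (\<Prod>i\<in>I - {j}. \<psi> i (u i b)))
    - avg n (\<lambda>b. f (u j b)) * (\<Prod>i\<in>I - {j}. avg n (\<lambda>b. \<psi> i (u i b)))"
proof -
  have 1: "(\<Prod>i\<in>I. (\<psi>(j := f)) i (u i b)) = f (u j b) * (\<Prod>i\<in>I - {j}. \<psi> i (u i b))" for b
    using assms by (subst prod.remove[of _ j]) (auto intro!: prod.cong)
  have 2: "(\<Prod>i\<in>I. avg n (\<lambda>b. (\<psi>(j := f)) i (u i b)))
      = avg n (\<lambda>b. f (u j b)) * (\<Prod>i\<in>I - {j}. avg n (\<lambda>b. \<psi> i (u i b)))"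
    using assms by (subst prod.remove[of _ j]) (auto intro!: prod.cong)
  show ?thesis unfolding joint_gap_def 1 2 ..
qed

text \<open>The gap is linear in the function in slot \<open>j\<close>, which settles exponential
  sums. A uniform error in this slot changes the gap by a bounded multiple of that error, uniformly
  in the sample, because the other slots are bounded on the cube.\<close>

lemma joint_gap_tendsto_trig_limit_slot:
  assumes I: "finite I" "j \<in> I"
    and cube: "\<And>c i a. i \<in> I \<Longrightarrow> a \<in> {1..N c} \<Longrightarrow> U c i a \<in> unit_cube (d i)"
    and bd: "\<And>i. i \<in> I \<Longrightarrow> \<exists>B\<ge>0. \<forall>v\<in>unit_cube (d i). cmod (\<psi> i v) \<le> B"
    and expi: "\<And>t. ((\<lambda>c. joint_gap (N c) I (\<psi>(j := expi (d j) t)) (U c)) \<longlongrightarrow> 0) F"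
    and f: "trig_limit (d j) f"
  shows "((\<lambda>c. joint_gap (N c) I (\<psi>(j := f)) (U c)) \<longlongrightarrow> 0) F"
proof -
  have poly: "((\<lambda>c. joint_gap (N c) I (\<psi>(j := g)) (U c)) \<longlongrightarrow> 0) F" if "trig_poly (d j) g" for g
    using that
  proof induction
    case (expi t)
    show ?case by (rule assms(5))
  next
    case (add g h)
    have eq: "joint_gap (N c) I (\<psi>(j := \<lambda>v. g v + h v)) (U c)
        = joint_gap (N c) I (\<psi>(j := g)) (U c) + joint_gap (N c) I (\<psi>(j := h)) (U c)" for c
      unfolding joint_gap_remove[OF I] distrib_right avg_add by (simp add: algebra_simps)
    show ?case using tendsto_add[OF add.IH] unfolding eq by (simp only: add_0)
  next
    case (scale g k)
    have eq: "joint_gap (N c) I (\<psi>(j := \<lambda>v. k * g v)) (U c) = k * joint_gap (N c) I (\<psi>(j := g)) (U c)" for c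
      unfolding joint_gap_remove[OF I] mult.assoc avg_cmult by (simp add: algebra_simps)
    show ?case using tendsto_mult_left[OF scale.IH, of k] unfolding eq by (simp only: mult_zero_right)
  qed
  obtain B where B: "\<And>i. i \<in> I \<Longrightarrow> 0 \<le> B i" "\<And>i v. i \<in> I \<Longrightarrow> v \<in> unit_cube (d i) \<Longrightarrow> cmod (\<psi> i v) \<le> B i"
    using bd by metis
  define P where "P = (\<Prod>i\<in>I - {j}. B i)"
  have P: "0 \<le> P" unfolding P_def using B by (intro prod_nonneg) auto
  show ?thesis
  proof (rule tendstoI)
    fix \<epsilon> :: real assume \<epsilon>: "0 < \<epsilon>"
    \<comment> \<open>The mean of the product and the product of the means change by at most
      \<open>\<delta> * P\<close> each; the factor 4 leaves the other half of
      \<open>\<epsilon>\<close> for the gap of the approximating sum.\<close>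
    define \<delta> where "\<delta> = \<epsilon> / (4 * (P + 1))"
    have \<delta>: "0 < \<delta>" using \<epsilon> P by (simp add: \<delta>_def)
    have \<delta>P: "\<delta> * P < \<epsilon> / 4"
    proof -
      have "\<delta> * P = (\<epsilon> / 4) * (P / (P + 1))" by (simp add: \<delta>_def)
      also have "\<dots> < (\<epsilon> / 4) * 1" using \<epsilon> P by (intro mult_strict_left_mono) auto
      finally show ?thesis by simp
    qed
    obtain g where g: "trig_poly (d j) g" "\<And>v. v \<in> unit_cube (d j) \<Longrightarrow> cmod (f v - g v) \<le> \<delta>"
      using f \<delta> unfolding trig_limit_def by blast
    have close: "cmod (joint_gap (N c) I (\<psi>(j := f)) (U c) - joint_gap (N c) I (\<psi>(j := g)) (U c)) < \<epsilon> / 2" for c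
    proof -
      let ?w = "\<lambda>b. \<Prod>i\<in>I - {j}. \<psi> i (U c i b)" and ?p = "\<Prod>i\<in>I - {j}. avg (N c) (\<lambda>b. \<psi> i (U c i b))"
      let ?h = "\<lambda>b. f (U c j b) - g (U c j b)"
      have eq: "joint_gap (N c) I (\<psi>(j := f)) (U c) - joint_gap (N c) I (\<psi>(j := g)) (U c)
          = avg (N c) (\<lambda>b. ?h b * ?w b) - avg (N c) ?h * ?p"
        unfolding joint_gap_remove[OF I] left_diff_distrib avg_diff by simp
      have "cmod (avg (N c) (\<lambda>b. ?h b * ?w b)) \<le> \<delta> * P"
      proof (rule norm_avg_le)
        fix b assume b: "b \<in> {1..N c}"
        have "cmod (?w b) \<le> P"
          unfolding P_def prod_norm[symmetric] using B cube b by (intro prod_mono) auto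
        then show "cmod (?h b * ?w b) \<le> \<delta> * P"
          unfolding norm_mult using g(2) cube[OF I(2) b] \<delta> by (intro mult_mono) auto
      qed (use \<delta> P in simp)
      moreover have "cmod (avg (N c) ?h * ?p) \<le> \<delta> * P"
      proof -
        have "cmod ?p \<le> P"
          unfolding P_def prod_norm[symmetric] using B cube by (intro prod_mono conjI norm_avg_le) auto
        moreover have "cmod (avg (N c) ?h) \<le> \<delta>" using g(2) cube[OF I(2)] \<delta> by (intro norm_avg_le) auto
        ultimately show ?thesis unfolding norm_mult using \<delta> by (intro mult_mono) auto
      qed
      ultimately show ?thesis
        unfolding eq
        using \<delta>P norm_triangle_ineq4[of "avg (N c) (\<lambda>b. ?h b * ?w b)" "avg (N c) ?h * ?p"] by linarith
    qed
    have "\<forall>\<^sub>F c in F. cmod (joint_gap (N c) I (\<psi>(j := g)) (U c)) < \<epsilon> / 2"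
      using tendstoD[OF poly[OF g(1)], of "\<epsilon> / 2"] \<epsilon> by simp
    then show "\<forall>\<^sub>F c in F. dist (joint_gap (N c) I (\<psi>(j := f)) (U c)) 0 < \<epsilon>"
    proof eventually_elim
      case (elim c)
      then show ?case
        using close[of c] norm_triangle_sub[of "joint_gap (N c) I (\<psi>(j := f)) (U c)"
          "joint_gap (N c) I (\<psi>(j := g)) (U c)"] by simp
    qed
  qed
qed

text \<open>The index \<open>c\<close> and the filter are arbitrary, so that a growing sample size
  and a vanishing statistic can later be encoded in a single filter.\<close>

lemma joint_gap_tendsto_trig_limit:
  assumes I: "finite I" and N: "\<forall>\<^sub>F c in F. 1 \<le> N c"
    and cube: "\<And>c i a. i \<in> I \<Longrightarrow> a \<in> {1..N c} \<Longrightarrow> U c i a \<in> unit_cube (d i)"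
    and lim: "\<And>S t. S \<subseteq> I \<Longrightarrow> 2 \<le> card S \<Longrightarrow> ((\<lambda>c. dcov_char d (N c) S (U c) t) \<longlongrightarrow> 0) F"
    and \<psi>: "\<And>i. i \<in> I \<Longrightarrow> trig_limit (d i) (\<psi> i)"
  shows "((\<lambda>c. joint_gap (N c) I \<psi> (U c)) \<longlongrightarrow> 0) F"
proof -
  have base: "((\<lambda>c. joint_gap (N c) I (\<lambda>i. expi (d i) (t i)) (U c)) \<longlongrightarrow> 0) F" for t
  proof (rule Lim_null_comparison)
    show "\<forall>\<^sub>F c in F. cmod (joint_gap (N c) I (\<lambda>i. expi (d i) (t i)) (U c))
        \<le> (\<Sum>S | S \<subseteq> I \<and> 2 \<le> card S. cmod (dcov_char d (N c) S (U c) t))"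
      using N by eventually_elim (rule joint_gap_expi_le[OF _ I])
    show "((\<lambda>c. \<Sum>S | S \<subseteq> I \<and> 2 \<le> card S. cmod (dcov_char d (N c) S (U c) t)) \<longlongrightarrow> 0) F"
      by (intro tendsto_null_sum tendsto_norm_zero lim) auto
  qed
  \<comment> \<open>\<open>J\<close> collects the slots that may carry arbitrary uniform limits; all
    slots outside it still carry exponentials.\<close>
  have "((\<lambda>c. joint_gap (N c) I \<psi> (U c)) \<longlongrightarrow> 0) F"
    if "finite J" "J \<subseteq> I" "\<And>i. i \<in> I \<Longrightarrow> trig_limit (d i) (\<psi> i)"
      "\<And>i. i \<in> I - J \<Longrightarrow> \<exists>t. \<psi> i = expi (d i) t" for J \<psi>
    using that
  proof (induction J arbitrary: \<psi> rule: finite_induct)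
    case empty
    then obtain t where t: "\<And>i. i \<in> I \<Longrightarrow> \<psi> i = expi (d i) (t i)" by (metis Diff_empty)
    have "joint_gap (N c) I \<psi> (U c) = joint_gap (N c) I (\<lambda>i. expi (d i) (t i)) (U c)" for c
      unfolding joint_gap_def using t by (auto intro!: arg_cong2[where f="(-)"] prod.cong arg_cong[where f="avg (N c)"])
    then show ?case using base by simp
  next
    case (insert j J)
    have "((\<lambda>c. joint_gap (N c) I (\<psi>(j := \<psi> j)) (U c)) \<longlongrightarrow> 0) F"
    proof (rule joint_gap_tendsto_trig_limit_slot[OF I, where d=d])
      show "((\<lambda>c. joint_gap (N c) I (\<psi>(j := expi (d j) t)) (U c)) \<longlongrightarrow> 0) F" for t
        using insert.prems by (intro insert.IH) (auto simp: trig_limit_expi)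
      show "\<exists>B\<ge>0. \<forall>v\<in>unit_cube (d i). cmod (\<psi> i v) \<le> B" if "i \<in> I" for i
        using insert.prems that by (intro trig_limit_bounded) auto
    qed (use insert.prems cube in auto)
    then show ?case by simp
  qed
  from this[of I \<psi>] show ?thesis using I \<psi> by auto
qed

section \<open>Laws of large numbers and factorizing distributions\<close>

lemma prob_space_iid_sample: "prob_space \<mu> \<Longrightarrow> prob_space (iid_sample n \<mu>)"
  unfolding iid_sample_def by (rule prob_space_PiM)

text \<open>Hoeffding's inequality gives an exponentially small probability. Most of the proof
  verifies that the coordinates of the product space are independent with law
  \<open>\<mu>\<close>.\<close>

lemma avg_iid_concentrates:
  assumes \<mu>: "prob_space \<mu>" and f [measurable]: "f \<in> borel_measurable \<mu>"
    and bd: "\<And>x. 0 \<le> f x \<and> f x \<le> 1" and \<epsilon>: "0 < (\<epsilon>::real)"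
  shows "(\<lambda>n. measure (iid_sample n \<mu>)
    {X \<in> space (iid_sample n \<mu>). \<epsilon> \<le> \<bar>avg n (\<lambda>a. f (X a)) - (\<integral>x. f x \<partial>\<mu>)\<bar>}) \<longlonglongrightarrow> 0"
proof (rule Lim_null_comparison)
  show "(\<lambda>n. 2 * exp (- 2 * real n * \<epsilon>\<^sup>2)) \<longlonglongrightarrow> 0"
  proof -
    have "(\<lambda>n. exp (- 2 * \<epsilon>\<^sup>2) ^ n) \<longlonglongrightarrow> 0" using \<epsilon> by (intro LIMSEQ_realpow_zero) auto
    then have "(\<lambda>n. 2 * exp (- 2 * \<epsilon>\<^sup>2) ^ n) \<longlonglongrightarrow> 0" by (rule tendsto_mult_right_zero)
    moreover have "exp (- 2 * \<epsilon>\<^sup>2) ^ n = exp (- 2 * real n * \<epsilon>\<^sup>2)" for n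
      by (simp add: exp_of_nat_mult[symmetric] mult.assoc mult.left_commute)
    ultimately show ?thesis by simp
  qed
  show "\<forall>\<^sub>F n in sequentially. norm (measure (iid_sample n \<mu>)
    {X \<in> space (iid_sample n \<mu>). \<epsilon> \<le> \<bar>avg n (\<lambda>a. f (X a)) - (\<integral>x. f x \<partial>\<mu>)\<bar>})
      \<le> 2 * exp (- 2 * real n * \<epsilon>\<^sup>2)"
  proof (rule eventually_sequentiallyI[of 1])
    fix n :: nat assume n: "1 \<le> n"
    interpret P: prob_space "iid_sample n \<mu>" by (rule prob_space_iid_sample[OF \<mu>])
    have proj: "distr (iid_sample n \<mu>) \<mu> (\<lambda>X. X a) = \<mu>" if "a \<in> {1..n}" for a
      unfolding iid_sample_def using that by (intro distr_PiM_component[where M="\<lambda>_. \<mu>"] \<mu>)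
    have proj_meas [measurable]: "(\<lambda>X. X a) \<in> measurable (iid_sample n \<mu>) \<mu>" if "a \<in> {1..n}" for a
      unfolding iid_sample_def using that by measurable
    have "P.indep_vars (\<lambda>_. \<mu>) (\<lambda>a X. X a) {1..n}"
    proof (subst P.indep_vars_iff_distr_eq_PiM')
      have "(\<Pi>\<^sub>M a\<in>{1..n}. distr (iid_sample n \<mu>) \<mu> (\<lambda>X. X a)) = (\<Pi>\<^sub>M a\<in>{1..n}. \<mu>)"
        by (rule PiM_cong[OF refl proj])
      moreover have "distr (iid_sample n \<mu>) (\<Pi>\<^sub>M a\<in>{1..n}. \<mu>) (\<lambda>X. \<lambda>a\<in>{1..n}. X a)
          = distr (iid_sample n \<mu>) (iid_sample n \<mu>) (\<lambda>X. X)"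
        by (rule distr_cong) (auto simp: iid_sample_def space_PiM)
      moreover have "distr (iid_sample n \<mu>) (iid_sample n \<mu>) (\<lambda>X. X) = (\<Pi>\<^sub>M a\<in>{1..n}. \<mu>)"
        by (simp only: distr_id iid_sample_def)
      ultimately show "distr (iid_sample n \<mu>) (\<Pi>\<^sub>M a\<in>{1..n}. \<mu>) (\<lambda>X. \<lambda>a\<in>{1..n}. X a)
          = (\<Pi>\<^sub>M a\<in>{1..n}. distr (iid_sample n \<mu>) \<mu> (\<lambda>X. X a))"
        by (simp only:)
      show "{1..n} \<noteq> {}" using n by simp
    qed (rule proj_meas)
    then have indep: "P.indep_vars (\<lambda>_. borel) (\<lambda>a X. f (X a)) {1..n}"
      by (rule P.indep_vars_compose2) simp
    have law: "distr (iid_sample n \<mu>) borel (\<lambda>X. f (X a)) = distr \<mu> borel f" if "a \<in> {1..n}" for a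
    proof -
      have "distr \<mu> borel f = distr (distr (iid_sample n \<mu>) \<mu> (\<lambda>X. X a)) borel f"
        using proj[OF that] by simp
      also have "\<dots> = distr (iid_sample n \<mu>) borel (\<lambda>X. f (X a))"
        using that by (subst distr_distr) (auto simp: comp_def)
      finally show ?thesis ..
    qed
    have one: "1 \<in> {1..n}" using n by simp
    interpret Hf: Hoeffding_ineq_iid "iid_sample n \<mu>" "{1..n}" "\<lambda>a X. f (X a)" "\<lambda>X. f (X 1)" 0 1
      "P.expectation (\<lambda>X. f (X 1))"
    proof unfold_locales
      show "P.indep_vars (\<lambda>_. borel) (\<lambda>a X. f (X a)) {1..n}" by (rule indep)
      show "distr (iid_sample n \<mu>) borel (\<lambda>X. f (X a)) = distr (iid_sample n \<mu>) borel (\<lambda>X. f (X 1))"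
        if "a \<in> {1..n}" for a
        by (simp only: law[OF that] law[OF one])
      show "(\<lambda>X. f (X 1)) \<in> borel_measurable (iid_sample n \<mu>)"
        by (rule measurable_compose[OF proj_meas[OF one] f])
      show "AE X in iid_sample n \<mu>. f (X 1) \<in> {0..1}" by (rule AE_I2) (simp add: bd)
    qed simp_all
    have "P.expectation (\<lambda>X. f (X 1)) = (\<integral>x. f x \<partial>distr (iid_sample n \<mu>) \<mu> (\<lambda>X. X 1))"
      by (rule integral_distr[OF proj_meas[OF one] f, symmetric])
    also have "\<dots> = (\<integral>x. f x \<partial>\<mu>)" unfolding proj[OF one] ..
    finally have mean: "P.expectation (\<lambda>X. f (X 1)) = (\<integral>x. f x \<partial>\<mu>)" .
    have "P.prob {X \<in> space (iid_sample n \<mu>). \<epsilon> \<le> \<bar>(\<Sum>a=1..n. f (X a)) / real (card {1..n}) - (\<integral>x. f x \<partial>\<mu>)\<bar>}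
        \<le> 2 * exp (- 2 * real (card {1..n}) * \<epsilon>\<^sup>2 / (1 - 0)\<^sup>2)"
      unfolding mean[symmetric] using \<epsilon> one by (intro Hf.Hoeffding_ineq_abs_ge') auto
    then show "norm (measure (iid_sample n \<mu>)
      {X \<in> space (iid_sample n \<mu>). \<epsilon> \<le> \<bar>avg n (\<lambda>a. f (X a)) - (\<integral>x. f x \<partial>\<mu>)\<bar>})
        \<le> 2 * exp (- 2 * real n * \<epsilon>\<^sup>2)"
      by (simp add: avg_def)
  qed
qed

section \<open>Independence from factorization over Lipschitz functions\<close>

lemma sets_leb_lower_orthants:
  "sets (leb d) = sigma_sets (space (leb d)) {{y \<in> space (leb d). \<forall>j\<in>{1..d}. y j \<le> c j} | c. True}"
  (is "_ = sigma_sets ?\<Omega> ?E")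
proof
  have E: "?E \<subseteq> sets (leb d)" by auto
  then show "sigma_sets ?\<Omega> ?E \<subseteq> sets (leb d)" by (rule sets.sigma_sets_subset)
  define N where "N = sigma ?\<Omega> ?E"
  have "?E \<subseteq> Pow ?\<Omega>" by auto
  then have N: "space N = ?\<Omega>" "sets N = sigma_sets ?\<Omega> ?E" by (simp_all add: N_def)
  have comp: "(\<lambda>y. y j) \<in> borel_measurable N" if j: "j \<in> {1..d}" for j
  proof (subst borel_measurable_iff_le, intro allI)
    fix a :: real
    \<comment> \<open>A half-space in direction \<open>j\<close> is the union over \<open>n\<close>
      of lower orthants whose remaining bounds are \<open>n\<close>.\<close>
    define c where "c = (\<lambda>n l. if l = j then a else real n)"
    have "{y \<in> space N. y j \<le> a} = (\<Union>n. {y \<in> ?\<Omega>. \<forall>l\<in>{1..d}. y l \<le> c n l})"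
    proof safe
      fix y assume y: "y \<in> space N" "y j \<le> a"
      obtain n :: nat where n: "Max ((\<lambda>l. y l) ` {1..d}) \<le> real n" using real_arch_simple by blast
      have "y l \<le> c n l" if "l \<in> {1..d}" for l
      proof -
        have "y l \<le> Max ((\<lambda>l. y l) ` {1..d})" using that by (intro Max_ge) auto
        then show ?thesis using n y by (auto simp: c_def)
      qed
      then show "y \<in> (\<Union>n. {y \<in> ?\<Omega>. \<forall>l\<in>{1..d}. y l \<le> c n l})" using y N by (intro UN_I[of n]) auto
    next
      fix y n assume y: "y \<in> ?\<Omega>" "\<forall>l\<in>{1..d}. y l \<le> c n l"
      show "y \<in> space N" using y(1) N by simp
      show "y j \<le> a" using y(2) j by (auto simp: c_def dest!: bspec[of _ _ j])
    qed
    also have "\<dots> \<in> sets N" unfolding N(2) by (intro sigma_sets.Union) (auto intro!: sigma_sets.Basic)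
    finally show "{y \<in> space N. y j \<le> a} \<in> sets N" .
  qed
  have "(\<lambda>y. y) \<in> measurable N (\<Pi>\<^sub>M j\<in>{1..d}. lborel)"
    by (rule measurable_PiM_single') (use comp N in \<open>auto simp: space_leb\<close>)
  then have id: "(\<lambda>y. y) \<in> measurable N (leb d)" by (simp add: leb_def)
  show "sets (leb d) \<subseteq> sigma_sets ?\<Omega> ?E"
  proof
    fix A assume A: "A \<in> sets (leb d)"
    have "(\<lambda>y. y) -` A \<inter> space N \<in> sets N" using measurable_sets[OF id A] .
    moreover have "(\<lambda>y. y) -` A \<inter> space N = A" using sets.sets_into_space[OF A] N by auto
    ultimately show "A \<in> sigma_sets ?\<Omega> ?E" using N by simp
  qed
qed

text \<open>A Lipschitz majorant of the indicator of \<open>{..c}\<close>; its slope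
  \<open>k\<close> tends to infinity later.\<close>

definition ramp :: "nat \<Rightarrow> real \<Rightarrow> real \<Rightarrow> real" where
  "ramp k c s = max 0 (min 1 (1 - real k * (s - c)))"

lemma ramp_bounds: "0 \<le> ramp k c s" "ramp k c s \<le> 1"
  by (auto simp: ramp_def)

lemma ramp_lipschitz: "\<bar>ramp k c s - ramp k c s'\<bar> \<le> real k * \<bar>s - s'\<bar>"
proof -
  have clip: "\<bar>max 0 (min 1 p) - max 0 (min 1 q)\<bar> \<le> \<bar>p - q\<bar>" for p q :: real by linarith
  have "\<bar>ramp k c s - ramp k c s'\<bar> \<le> \<bar>(1 - real k * (s - c)) - (1 - real k * (s' - c))\<bar>"
    unfolding ramp_def by (rule clip)
  also have "\<dots> = \<bar>real k * (s - s')\<bar>" by (simp add: algebra_simps abs_minus_commute)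
  finally show ?thesis by (simp add: abs_mult)
qed

lemma ramp_tendsto: "(\<lambda>k. ramp k c s) \<longlonglongrightarrow> of_bool (s \<le> c)"
proof (cases "s \<le> c")
  case True
  have "real k * (s - c) \<le> 0" for k using True by (simp add: mult_le_0_iff)
  then have "ramp k c s = 1" for k by (auto simp: ramp_def min_def)
  then show ?thesis using True by simp
next
  case False
  obtain m :: nat where m: "1 / (s - c) \<le> real m" using real_arch_simple by blast
  have "ramp k c s = 0" if "m \<le> k" for k
  proof -
    have "1 / (s - c) \<le> real k" using m that by linarith
    then have "1 \<le> real k * (s - c)" using False by (simp add: field_simps)
    then show ?thesis by (simp add: ramp_def)
  qed
  then have "\<forall>\<^sub>F k in sequentially. ramp k c s = 0" by (rule eventually_sequentiallyI)
  then show ?thesis using False by (simp add: tendsto_eventually)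
qed

lemma measurable_block [measurable]: "i \<in> {1..r} \<Longrightarrow> (\<lambda>x. x i) \<in> measurable (leb_blocks r d) (leb (d i))"
  unfolding leb_blocks_def by measurable

text \<open>Products of ramps converge boundedly to indicators of lower orthants, so the
  factorization passes to orthants by dominated convergence. Orthants are stable under intersection
  and generate the sets of a block, which extends it to independence of the blocks.\<close>

lemma eq_joint_indep_if_factorizes:
  assumes r: "1 \<le> r" and \<mu>: "prob_space \<mu>" "sets \<mu> = sets (leb_blocks r d)"
    and fac: "\<And>f \<Lambda>. (\<And>i y. 0 \<le> f i y \<and> f i y \<le> 1) \<Longrightarrow>
      (\<And>i y z. \<bar>f i y - f i z\<bar> \<le> real \<Lambda> * (\<Sum>j=1..d i. \<bar>y j - z j\<bar>)) \<Longrightarrow>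
      (\<And>i. f i \<in> borel_measurable (leb (d i))) \<Longrightarrow>
      (\<integral>x. (\<Prod>i=1..r. f i (x i)) \<partial>\<mu>) = (\<Prod>i=1..r. \<integral>x. f i (x i) \<partial>\<mu>)"
  shows "\<mu> = joint_indep r (marginal d \<mu>)"
proof -
  interpret prob_space \<mu> by fact
  have sp: "space \<mu> = (\<Pi>\<^sub>E i\<in>{1..r}. space (leb (d i)))"
    using sets_eq_imp_space_eq[OF \<mu>(2)] by (simp add: leb_blocks_def space_PiM)
  have block [measurable]: "(\<lambda>x. x i) \<in> measurable \<mu> (leb (d i))" if "i \<in> {1..r}" for i
    using measurable_block[OF that, of d] by (simp add: measurable_cong_sets[OF \<mu>(2) refl])
  define Q where "Q = (\<lambda>i c. {y \<in> space (leb (d i)). \<forall>j\<in>{1..d i}. y j \<le> c j})"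
  define V where "V = (\<lambda>i c. (\<lambda>x. x i) -` Q i c \<inter> space \<mu>)"
  define G where "G = (\<lambda>i. {V i c | c. True})"
  have Q_sets [measurable]: "Q i c \<in> sets (leb (d i))" for i c
    unfolding Q_def by measurable
  have V_sets: "V i c \<in> events" if "i \<in> {1..r}" for i c
    unfolding V_def using that by measurable
  have factor: "prob (\<Inter>i\<in>J. V i (c i)) = (\<Prod>i\<in>J. prob (V i (c i)))"
    if J: "J \<subseteq> {1..r}" "J \<noteq> {}" for J c
  proof -
    \<comment> \<open>Independence demands factorization over every subfamily \<open>J\<close>,
      whereas the hypothesis concerns all blocks at once; the blocks outside \<open>J\<close>
      receive the constant 1.\<close>
    define f where "f = (\<lambda>k i y. if i \<in> J then \<Prod>j=1..d i. ramp k (c i j) (y j) else 1)"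
    define g where "g = (\<lambda>i y. if i \<in> J then of_bool (\<forall>j\<in>{1..d i}. y j \<le> c i j) else (1::real))"
    have f_bd: "0 \<le> f k i y \<and> f k i y \<le> 1" for k i y
      unfolding f_def by (auto intro!: prod_nonneg prod_le_1 simp: ramp_bounds)
    have f_meas [measurable]: "f k i \<in> borel_measurable (leb (d i))" for k i
      unfolding f_def ramp_def by measurable
    have f_lip: "\<bar>f k i y - f k i z\<bar> \<le> real k * (\<Sum>j=1..d i. \<bar>y j - z j\<bar>)" for k i y z
    proof (cases "i \<in> J")
      case True
      have "\<bar>f k i y - f k i z\<bar> \<le> (\<Sum>j=1..d i. \<bar>ramp k (c i j) (y j) - ramp k (c i j) (z j)\<bar>)"
        using True norm_prod_diff[of "{1..d i}" "\<lambda>j. ramp k (c i j) (y j)" "\<lambda>j. ramp k (c i j) (z j)"]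
        by (simp add: f_def ramp_bounds)
      also have "\<dots> \<le> (\<Sum>j=1..d i. real k * \<bar>y j - z j\<bar>)" by (intro sum_mono ramp_lipschitz)
      finally show ?thesis by (simp add: sum_distrib_left)
    qed (simp add: f_def sum_nonneg)
    have g_eq: "g i y = (if i \<in> J then \<Prod>j=1..d i. of_bool (y j \<le> c i j) else 1)" for i y
    proof -
      have "(\<Prod>j\<in>A. of_bool (y j \<le> c i j)) = (of_bool (\<forall>j\<in>A. y j \<le> c i j) :: real)" if "finite A" for A
        using that by induction auto
      then show ?thesis by (simp add: g_def)
    qed
    have lim: "(\<lambda>k. f k i y) \<longlonglongrightarrow> g i y" for i y
      unfolding g_eq f_def by (auto intro!: tendsto_prod ramp_tendsto)
    have g_meas [measurable]: "g i \<in> borel_measurable (leb (d i))" for i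
      unfolding g_eq[abs_def] by measurable
    have prod_bd: "\<bar>\<Prod>i=1..r. f k i (x i)\<bar> \<le> 1" for k x
      unfolding abs_prod using f_bd by (intro prod_le_1) auto
    have L1: "(\<lambda>k. \<integral>x. (\<Prod>i=1..r. f k i (x i)) \<partial>\<mu>) \<longlonglongrightarrow> (\<integral>x. (\<Prod>i=1..r. g i (x i)) \<partial>\<mu>)"
      using prod_bd
      by (intro integral_dominated_convergence[where w="\<lambda>_. 1"] AE_I2 tendsto_prod lim) auto
    have L2: "(\<lambda>k. \<Prod>i=1..r. \<integral>x. f k i (x i) \<partial>\<mu>) \<longlonglongrightarrow> (\<Prod>i=1..r. \<integral>x. g i (x i) \<partial>\<mu>)"
      using f_bd
      by (intro tendsto_prod integral_dominated_convergence[where w="\<lambda>_. 1"] AE_I2 lim) auto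
    have eq: "(\<integral>x. (\<Prod>i=1..r. f k i (x i)) \<partial>\<mu>) = (\<Prod>i=1..r. \<integral>x. f k i (x i) \<partial>\<mu>)" for k
      using f_bd f_lip f_meas by (rule fac)
    have lim_eq: "(\<integral>x. (\<Prod>i=1..r. g i (x i)) \<partial>\<mu>) = (\<Prod>i=1..r. \<integral>x. g i (x i) \<partial>\<mu>)"
      using LIMSEQ_unique[OF L1[unfolded eq] L2] .
    have g_ind: "g i (x i) = indicator (V i (c i)) x" if "x \<in> space \<mu>" "i \<in> J" for i x
      using that J by (auto simp: g_def V_def Q_def sp indicator_def PiE_iff)
    have "(\<Prod>i=1..r. g i (x i)) = indicator (\<Inter>i\<in>J. V i (c i)) x" if x: "x \<in> space \<mu>" for x
    proof -
      have "finite J" using J finite_subset by blast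
      have "(\<Prod>i=1..r. g i (x i)) = (\<Prod>i\<in>J. g i (x i))"
        using J by (intro prod.mono_neutral_right) (auto simp: g_def)
      also have "\<dots> = (\<Prod>i\<in>J. indicator (V i (c i)) x)" using g_ind[OF x] by simp
      also have "\<dots> = indicator (\<Inter>i\<in>J. V i (c i)) x"
      proof (cases "\<forall>i\<in>J. x \<in> V i (c i)")
        case False
        then obtain i where "i \<in> J" "indicator (V i (c i)) x = (0::real)" by auto
        then have "\<exists>i\<in>J. indicator (V i (c i)) x = (0::real)" by blast
        then have "(\<Prod>i\<in>J. indicator (V i (c i)) x) = (0::real)" using \<open>finite J\<close> by (rule prod_zero[rotated])
        then show ?thesis using False by simp
      qed simp
      finally show ?thesis .
    qed
    then have "(\<integral>x. (\<Prod>i=1..r. g i (x i)) \<partial>\<mu>) = (\<integral>x. indicator (\<Inter>i\<in>J. V i (c i)) x \<partial>\<mu>)"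
      by (intro Bochner_Integration.integral_cong) auto
    also have "\<dots> = prob (\<Inter>i\<in>J. V i (c i))"
      using J V_sets by (auto simp: V_def Int_absorb2 intro!: arg_cong[where f=prob])
    finally have lhs: "(\<integral>x. (\<Prod>i=1..r. g i (x i)) \<partial>\<mu>) = prob (\<Inter>i\<in>J. V i (c i))" .
    have "(\<Prod>i=1..r. \<integral>x. g i (x i) \<partial>\<mu>) = (\<Prod>i\<in>J. \<integral>x. g i (x i) \<partial>\<mu>)"
      using J by (intro prod.mono_neutral_right) (auto simp: g_def prob_space)
    also have "\<dots> = (\<Prod>i\<in>J. prob (V i (c i)))"
    proof (intro prod.cong refl)
      fix i assume i: "i \<in> J"
      have "(\<integral>x. g i (x i) \<partial>\<mu>) = (\<integral>x. indicator (V i (c i)) x \<partial>\<mu>)"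
        using g_ind i by (intro Bochner_Integration.integral_cong) auto
      also have "\<dots> = prob (V i (c i))" by (simp add: V_def Int_assoc)
      finally show "(\<integral>x. g i (x i) \<partial>\<mu>) = prob (V i (c i))" .
    qed
    finally show ?thesis using lhs lim_eq by simp
  qed
  have "indep_sets G {1..r}"
  proof (rule indep_setsI)
    show "G i \<subseteq> events" if "i \<in> {1..r}" for i using V_sets[OF that] by (auto simp: G_def)
    fix A J assume J: "J \<noteq> {}" "J \<subseteq> {1..r}" "finite J" and A: "\<forall>j\<in>J. A j \<in> G j"
    then obtain c where c: "\<And>j. j \<in> J \<Longrightarrow> A j = V j (c j)" unfolding G_def by simp metis
    show "prob (\<Inter>j\<in>J. A j) = (\<Prod>j\<in>J. prob (A j))" using factor[OF J(2,1), of c] c by simp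
  qed
  moreover have "Int_stable (G i)" for i
  proof (rule Int_stableI)
    fix A B assume "A \<in> G i" "B \<in> G i"
    then obtain c c' where "A = V i c" "B = V i c'" by (auto simp: G_def)
    then have "A \<inter> B = V i (\<lambda>j. min (c j) (c' j))" by (auto simp: V_def Q_def)
    then show "A \<inter> B \<in> G i" by (auto simp: G_def)
  qed
  ultimately have "indep_sets (\<lambda>i. sigma_sets (space \<mu>) (G i)) {1..r}" by (intro indep_sets_sigma)
  moreover have "sigma_sets (space \<mu>) (G i) = {(\<lambda>x. x i) -` A \<inter> space \<mu> | A. A \<in> sets (leb (d i))}"
    if i: "i \<in> {1..r}" for i
  proof -
    have "G i = {(\<lambda>x. x i) -` A \<inter> space \<mu> | A. A \<in> {Q i c | c. True}}" by (auto simp: G_def V_def)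
    then have "sigma_sets (space \<mu>) (G i)
        = {(\<lambda>x. x i) -` A \<inter> space \<mu> | A. A \<in> sigma_sets (space (leb (d i))) {Q i c | c. True}}"
      using i by (subst sigma_sets_vimage_commute) (auto simp: sp PiE_iff)
    then show ?thesis unfolding Q_def sets_leb_lower_orthants[symmetric] .
  qed
  ultimately have "indep_sets (\<lambda>i. {(\<lambda>x. x i) -` A \<inter> space \<mu> | A. A \<in> sets (leb (d i))}) {1..r}"
    by (subst (asm) indep_sets_cong) auto
  then have "indep_vars (\<lambda>i. leb (d i)) (\<lambda>i x. x i) {1..r}"
    unfolding indep_vars_def2 by auto
  then have "distr \<mu> (leb_blocks r d) (\<lambda>x. \<lambda>i\<in>{1..r}. x i) = joint_indep r (marginal d \<mu>)"
    using r by (subst (asm) indep_vars_iff_distr_eq_PiM')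
      (auto simp: leb_blocks_def joint_indep_def marginal_def[abs_def])
  moreover have "distr \<mu> (leb_blocks r d) (\<lambda>x. \<lambda>i\<in>{1..r}. x i) = distr \<mu> (leb_blocks r d) (\<lambda>x. x)"
    by (rule distr_cong) (auto simp: sp)
  moreover have "distr \<mu> (leb_blocks r d) (\<lambda>x. x) = \<mu>"
    using \<mu>(2) by (intro distr_id2) simp
  ultimately show ?thesis by simp
qed

section \<open>The null distribution\<close>

lemma dcov_stat_cong:
  assumes "\<And>i a. i \<in> S \<Longrightarrow> a \<in> {1..n} \<Longrightarrow> R i a = R' i a"
  shows "dcov_stat d n S R = dcov_stat d n S R'"
proof -
  have char_dev: "char_dev (d i) n (R i) (t i) b = char_dev (d i) n (R' i) (t i) b"
    if "i \<in> S" "b \<in> {1..n}" for i b t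
    unfolding char_dev_def using assms that by (auto intro!: arg_cong2[where f="(-)"] sum.cong)
  have "dcov_char d n S R t = dcov_char d n S R' t" for t
    unfolding dcov_char_def using char_dev by (auto intro!: sum.cong prod.cong)
  then show ?thesis by (simp add: dcov_stat_def)
qed

definition rank_stat :: "nat \<Rightarrow> (nat \<Rightarrow> nat) \<Rightarrow> (nat \<Rightarrow> real) \<Rightarrow> nat \<Rightarrow> (nat \<Rightarrow> nat \<Rightarrow> vec) \<Rightarrow> real" where
  "rank_stat r d C n R = (\<Sum>s=2..r. C s * (\<Sum>S | S \<subseteq> {1..r} \<and> card S = s. dcov_stat d n S R))"

lemma RJdCov2_eq_rank_stat:
  "RJdCov2 r d h C n X = rank_stat r d C n
    (\<lambda>i a. h (d i) n (opt_perm (d i) n (h (d i) n) (\<lambda>a. X a i) a))"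
  unfolding RJdCov2_def rank_stat_def RdCov2_eq_dcov_stat
  by (simp add: emp_rank_def[abs_def])

lemma rank_stat_cong:
  assumes "\<And>i a. i \<in> {1..r} \<Longrightarrow> a \<in> {1..n} \<Longrightarrow> R i a = R' i a"
  shows "rank_stat r d C n R = rank_stat r d C n R'"
proof -
  have "dcov_stat d n S R = dcov_stat d n S R'" if "S \<subseteq> {1..r}" for S
    using assms that by (intro dcov_stat_cong) auto
  then show ?thesis unfolding rank_stat_def by (auto intro!: sum.cong arg_cong2[where f="(*)"])
qed

section \<open>Optimal matchings and uniqueness of the ranks\<close>

definition match_cost :: "nat \<Rightarrow> nat \<Rightarrow> (nat \<Rightarrow> vec) \<Rightarrow> (nat \<Rightarrow> vec) \<Rightarrow> (nat \<Rightarrow> nat) \<Rightarrow> real" where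
  "match_cost d n g y \<sigma> = (\<Sum>a=1..n. (vnorm d (\<lambda>j. y a j - g (\<sigma> a) j))\<^sup>2)"

definition perms :: "nat \<Rightarrow> (nat \<Rightarrow> nat) set" where
  "perms n = {\<sigma>. \<sigma> permutes {1..n}}"

lemma finite_perms [simp]: "finite (perms n)"
  unfolding perms_def by (rule finite_permutations) simp

lemma id_in_perms: "id \<in> perms n"
  by (simp add: perms_def permutes_id)

lemma perms_closed: "\<sigma> \<in> perms n \<Longrightarrow> a \<in> {1..n} \<Longrightarrow> \<sigma> a \<in> {1..n}"
  unfolding perms_def by (metis mem_Collect_eq permutes_in_image)

lemma sum_perms: "\<sigma> \<in> perms n \<Longrightarrow> (\<Sum>a=1..n. f (\<sigma> a)) = (\<Sum>a=1..n. f a)"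
  unfolding perms_def by (metis mem_Collect_eq sum.permute comp_def sum.cong)

definition matchings :: "nat \<Rightarrow> nat \<Rightarrow> (nat \<Rightarrow> vec) \<Rightarrow> (nat \<Rightarrow> vec) \<Rightarrow> (nat \<Rightarrow> nat) set" where
  "matchings d n g y = {\<sigma> \<in> perms n. \<forall>\<tau>\<in>perms n. match_cost d n g y \<sigma> \<le> match_cost d n g y \<tau>}"

text \<open>The choice depends on the data only through the set of minimizers. That set takes
  finitely many values, which makes the choice measurable.\<close>

lemma opt_perm_eq_some: "opt_perm d n g y = (SOME \<sigma>. \<sigma> \<in> matchings d n g y)"
  unfolding opt_perm_def arg_min_def is_arg_min_def matchings_def perms_def match_cost_def
  by (simp add: not_less Ball_def)

lemma opt_perm_in_matchings: "opt_perm d n g y \<in> matchings d n g y"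
proof -
  obtain \<sigma> where "\<sigma> \<in> perms n" "\<forall>\<tau>\<in>perms n. match_cost d n g y \<sigma> \<le> match_cost d n g y \<tau>"
    using finite_perms id_in_perms ex_min_if_finite[of "match_cost d n g y ` perms n"]
    by (auto simp: not_less)
  then have "\<exists>\<sigma>. \<sigma> \<in> matchings d n g y" by (auto simp: matchings_def)
  then show ?thesis unfolding opt_perm_eq_some by (rule someI_ex)
qed

lemma opt_perm_in_perms: "opt_perm d n g y \<in> perms n"
  using opt_perm_in_matchings by (auto simp: matchings_def)

lemma vnorm_power2: "(vnorm d v)\<^sup>2 = (\<Sum>j=1..d. (v j)\<^sup>2)"
  by (simp add: vnorm_def L2_set_def sum_nonneg)

text \<open>Only the cross term depends on \<open>\<sigma>\<close>. Costs are thus compared through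
  expressions that are linear in the data.\<close>

lemma match_cost_expand:
  assumes "\<sigma> \<in> perms n"
  shows "match_cost d n g y \<sigma> = (\<Sum>a=1..n. \<Sum>j=1..d. (y a j)\<^sup>2) + (\<Sum>a=1..n. \<Sum>j=1..d. (g a j)\<^sup>2)
    - 2 * (\<Sum>a=1..n. \<Sum>j=1..d. g (\<sigma> a) j * y a j)"
proof -
  have "match_cost d n g y \<sigma> = (\<Sum>a=1..n. (\<Sum>j=1..d. (y a j)\<^sup>2) + (\<Sum>j=1..d. (g (\<sigma> a) j)\<^sup>2)
      - 2 * (\<Sum>j=1..d. g (\<sigma> a) j * y a j))"
    unfolding match_cost_def vnorm_power2
    by (intro sum.cong refl) (simp add: power2_diff sum.distrib sum_subtractf sum_distrib_left algebra_simps)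
  also have "\<dots> = (\<Sum>a=1..n. \<Sum>j=1..d. (y a j)\<^sup>2) + (\<Sum>a=1..n. \<Sum>j=1..d. (g (\<sigma> a) j)\<^sup>2)
    - 2 * (\<Sum>a=1..n. \<Sum>j=1..d. g (\<sigma> a) j * y a j)"
    by (simp add: sum.distrib sum_subtractf sum_distrib_left)
  also have "(\<Sum>a=1..n. \<Sum>j=1..d. (g (\<sigma> a) j)\<^sup>2) = (\<Sum>a=1..n. \<Sum>j=1..d. (g a j)\<^sup>2)"
    using sum_perms[OF assms, of "\<lambda>a. \<Sum>j=1..d. (g a j)\<^sup>2"] .
  finally show ?thesis .
qed

lemma match_cost_eq_iff:
  assumes "\<sigma> \<in> perms n" "\<tau> \<in> perms n"
  shows "match_cost d n g y \<sigma> = match_cost d n g y \<tau> \<longleftrightarrow>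
    (\<Sum>a=1..n. \<Sum>j=1..d. (g (\<sigma> a) j - g (\<tau> a) j) * y a j) = 0"
  unfolding match_cost_expand[OF assms(1)] match_cost_expand[OF assms(2)]
  by (simp add: left_diff_distrib sum_subtractf)

text \<open>Uniqueness is required of the grid values, not of the permutations, because a grid may
  repeat points. It is required at every cost level, not only at the minimum, since equality of
  costs is the condition that defines a hyperplane in the data.\<close>

definition rank_unique :: "nat \<Rightarrow> nat \<Rightarrow> (nat \<Rightarrow> vec) \<Rightarrow> (nat \<Rightarrow> vec) \<Rightarrow> bool" where
  "rank_unique d n g y \<longleftrightarrow> (\<forall>\<sigma>\<in>perms n. \<forall>\<tau>\<in>perms n.
     match_cost d n g y \<sigma> = match_cost d n g y \<tau> \<longrightarrow> (\<forall>a\<in>{1..n}. g (\<sigma> a) = g (\<tau> a)))"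

lemma match_cost_permuted:
  assumes \<tau>: "\<tau> \<in> perms n" and y': "\<And>a. a \<in> {1..n} \<Longrightarrow> y' a = y (\<tau> a)"
  shows "match_cost d n g y' (\<sigma> \<circ> \<tau>) = match_cost d n g y \<sigma>"
proof -
  have "match_cost d n g y' (\<sigma> \<circ> \<tau>) = (\<Sum>a=1..n. (vnorm d (\<lambda>j. y (\<tau> a) j - g (\<sigma> (\<tau> a)) j))\<^sup>2)"
    unfolding match_cost_def using y' by (intro sum.cong) auto
  also have "\<dots> = match_cost d n g y \<sigma>"
    unfolding match_cost_def by (rule sum_perms[OF \<tau>, of "\<lambda>b. (vnorm d (\<lambda>j. y b j - g (\<sigma> b) j))\<^sup>2"])
  finally show ?thesis .
qed

lemma perms_comp: "\<sigma> \<in> perms n \<Longrightarrow> \<tau> \<in> perms n \<Longrightarrow> \<sigma> \<circ> \<tau> \<in> perms n"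
  by (simp add: perms_def permutes_compose)

text \<open>Composition with \<open>\<tau>\<close> transports matchings of \<open>y\<close> to
  matchings of \<open>y'\<close> at equal cost. An optimal matching of \<open>y'\<close> composed
  with the inverse of \<open>\<tau>\<close> is therefore optimal for \<open>y\<close>, and
  uniqueness identifies the matched values.\<close>

lemma opt_perm_permuted:
  assumes \<tau>: "\<tau> \<in> perms n" and y': "\<And>a. a \<in> {1..n} \<Longrightarrow> y' a = y (\<tau> a)"
    and uniq: "rank_unique d n g y" and a: "a \<in> {1..n}"
  shows "g (opt_perm d n g y' a) = g (opt_perm d n g y (\<tau> a))"
proof -
  define \<rho> where "\<rho> = inv \<tau>"
  have \<rho>: "\<rho> \<in> perms n" "\<tau> \<circ> \<rho> = id" "\<rho> \<circ> \<tau> = id"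
    using \<tau> permutes_inv_o[of \<tau> "{1..n}"] permutes_inv[of \<tau> "{1..n}"] by (auto simp: \<rho>_def perms_def)
  define \<sigma>' where "\<sigma>' = opt_perm d n g y'"
  define \<sigma> where "\<sigma> = opt_perm d n g y"
  have \<sigma>: "\<sigma> \<in> perms n" "\<And>\<pi>. \<pi> \<in> perms n \<Longrightarrow> match_cost d n g y \<sigma> \<le> match_cost d n g y \<pi>"
    using opt_perm_in_matchings[of d n g y] by (auto simp: \<sigma>_def matchings_def)
  have \<sigma>': "\<sigma>' \<in> perms n" "\<And>\<pi>. \<pi> \<in> perms n \<Longrightarrow> match_cost d n g y' \<sigma>' \<le> match_cost d n g y' \<pi>"
    using opt_perm_in_matchings[of d n g y'] by (auto simp: \<sigma>'_def matchings_def)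
  have c1: "match_cost d n g y' \<sigma>' = match_cost d n g y (\<sigma>' \<circ> \<rho>)"
  proof -
    have "match_cost d n g y' ((\<sigma>' \<circ> \<rho>) \<circ> \<tau>) = match_cost d n g y (\<sigma>' \<circ> \<rho>)"
      by (rule match_cost_permuted[OF \<tau>]) (rule y')
    then show ?thesis by (simp add: comp_assoc \<rho>)
  qed
  have "match_cost d n g y (\<sigma>' \<circ> \<rho>) \<le> match_cost d n g y' (\<sigma> \<circ> \<tau>)"
    unfolding c1[symmetric] using \<sigma> \<tau> by (intro \<sigma>' perms_comp)
  also have "\<dots> = match_cost d n g y \<sigma>" by (rule match_cost_permuted[OF \<tau>]) (rule y')
  finally have "match_cost d n g y (\<sigma>' \<circ> \<rho>) = match_cost d n g y \<sigma>"
    using \<sigma>(2)[OF perms_comp[OF \<sigma>'(1) \<rho>(1)]] by simp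
  moreover have "\<tau> a \<in> {1..n}" using perms_closed[OF \<tau> a] .
  ultimately have "g ((\<sigma>' \<circ> \<rho>) (\<tau> a)) = g (\<sigma> (\<tau> a))"
    using uniq perms_comp[OF \<sigma>'(1) \<rho>(1)] \<sigma>(1) unfolding rank_unique_def by blast
  moreover have "\<rho> (\<tau> a) = a" using \<rho>(3) by (metis comp_apply id_apply)
  ultimately show ?thesis by (simp add: \<sigma>_def \<sigma>'_def)
qed

text \<open>Fubini in one coordinate. It serves both for a coordinate of a vector and for an
  observation of a sample.\<close>

lemma (in product_sigma_finite) AE_PiM_slice:
  assumes I: "finite I" "i \<in> I" and Q: "{x \<in> space (Pi\<^sub>M I M). Q x} \<in> sets (Pi\<^sub>M I M)"
    and slice: "\<And>x. x \<in> space (Pi\<^sub>M (I - {i}) M) \<Longrightarrow> AE y in M i. \<not> Q (x(i := y))"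
  shows "AE x in Pi\<^sub>M I M. \<not> Q x"
proof -
  let ?N = "{x \<in> space (Pi\<^sub>M I M). Q x}" and ?J = "I - {i}"

  have ins: "insert i ?J = I" using I by auto
  have ind: "(indicator ?N :: _ \<Rightarrow> ennreal) \<in> borel_measurable (Pi\<^sub>M (insert i ?J) M)"
    using borel_measurable_indicator[OF Q] by (simp only: ins)
  have "emeasure (Pi\<^sub>M I M) ?N = (\<integral>\<^sup>+x. indicator ?N x \<partial>Pi\<^sub>M (insert i ?J) M)"
    using nn_integral_indicator[OF Q] by (simp only: ins)
  also have "\<dots> = (\<integral>\<^sup>+x. (\<integral>\<^sup>+y. indicator ?N (x(i := y)) \<partial>M i) \<partial>Pi\<^sub>M ?J M)"
    by (rule product_nn_integral_insert[OF _ _ ind]) (use I in auto)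
  also have "\<dots> = (\<integral>\<^sup>+x. 0 \<partial>Pi\<^sub>M ?J M)"
  proof (intro nn_integral_cong)
    fix x assume x: "x \<in> space (Pi\<^sub>M ?J M)"
    have "AE y in M i. indicator ?N (x(i := y)) = (0::ennreal)"
      using slice[OF x] by eventually_elim simp
    then have "(\<integral>\<^sup>+y. indicator ?N (x(i := y)) \<partial>M i) = (\<integral>\<^sup>+y. 0 \<partial>M i)" by (rule nn_integral_cong_AE)
    then show "(\<integral>\<^sup>+y. indicator ?N (x(i := y)) \<partial>M i) = 0" by simp
  qed
  finally have "emeasure (Pi\<^sub>M I M) ?N = 0" by simp
  then show ?thesis using Q by (intro AE_I[of _ _ ?N]) auto
qed

lemma AE_leb_hyperplane:
  assumes j: "j \<in> {1..d}" and w: "w j \<noteq> (0::real)"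
  shows "AE v in leb d. (\<Sum>l=1..d. w l * v l) \<noteq> c"
proof -
  interpret product_sigma_finite "\<lambda>_::nat. lborel :: real measure" by standard
  have meas: "{v \<in> space (leb d). (\<Sum>l=1..d. w l * v l) = c} \<in> sets (leb d)" by measurable
  show ?thesis
    unfolding leb_def
  proof (rule AE_PiM_slice[where i=j])
    fix x :: vec
    let ?s = "\<Sum>l\<in>{1..d} - {j}. w l * x l"
    have "(\<Sum>l=1..d. w l * (x(j := y)) l) = w j * y + ?s" for y
      using j by (subst sum.remove[of _ j]) (auto intro!: sum.cong)
    \<comment> \<open>With the other coordinates fixed, a single value of coordinate
      \<open>j\<close> meets the hyperplane.\<close>
    then have "(\<Sum>l=1..d. w l * (x(j := y)) l) = c \<longleftrightarrow> y = (c - ?s) / w j" for y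
      using w by (auto simp: field_simps)
    then show "AE y in lborel. (\<Sum>l=1..d. w l * (x(j := y)) l) \<noteq> c"
      using AE_lborel_singleton[of "(c - ?s) / w j"] by simp
  qed (use j meas in \<open>simp_all add: leb_def\<close>)
qed

section \<open>Exchangeability of the blocks under joint independence\<close>

locale ac_marginals =
  fixes r :: nat and d :: "nat \<Rightarrow> nat" and \<nu> :: "nat \<Rightarrow> vec measure"
  assumes r: "1 \<le> r" and ac: "\<And>i. i \<in> {1..r} \<Longrightarrow> ac_prob (leb (d i)) (\<nu> i)"
begin

lemma prob_space_\<nu>: "i \<in> {1..r} \<Longrightarrow> prob_space (\<nu> i)"
  and sets_\<nu>: "i \<in> {1..r} \<Longrightarrow> sets (\<nu> i) = sets (leb (d i))"
  using ac by (auto simp: ac_prob_def)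

abbreviation "\<kappa> \<equiv> joint_indep r \<nu>"

lemma prob_space_\<kappa>: "prob_space \<kappa>"
  unfolding joint_indep_def by (intro prob_space_PiM prob_space_\<nu>)

lemma sets_\<kappa>: "sets \<kappa> = sets (leb_blocks r d)"
  unfolding joint_indep_def leb_blocks_def by (intro sets_PiM_cong refl sets_\<nu>)

lemma measurable_block_\<kappa> [measurable]: "i \<in> {1..r} \<Longrightarrow> (\<lambda>x. x i) \<in> measurable \<kappa> (leb (d i))"
  unfolding joint_indep_def by (subst measurable_cong_sets[OF refl sets_\<nu>[symmetric]]) auto

lemma AE_sample_hyperplane:
  assumes i: "i \<in> {1..r}" and a: "a \<in> {1..n}" and j: "j \<in> {1..d i}" and w: "w a j \<noteq> (0::real)"
  shows "AE X in iid_sample n \<kappa>. (\<Sum>b=1..n. \<Sum>l=1..d i. w b l * X b i l) \<noteq> 0"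
proof -
  interpret K: prob_space \<kappa> by (rule prob_space_\<kappa>)
  interpret product_sigma_finite "\<lambda>_::nat. \<kappa>" by standard
  have comp: "(\<lambda>X. X b i l) \<in> borel_measurable (\<Pi>\<^sub>M a\<in>{1..n}. \<kappa>)" if "b \<in> {1..n}" "l \<in> {1..d i}" for b l
    using that i by measurable
  show ?thesis
    unfolding iid_sample_def
  proof (rule AE_PiM_slice[where i=a])
    show "{X \<in> space (\<Pi>\<^sub>M a\<in>{1..n}. \<kappa>). (\<Sum>b=1..n. \<Sum>l=1..d i. w b l * X b i l) = 0} \<in> sets (\<Pi>\<^sub>M a\<in>{1..n}. \<kappa>)"
      using comp by measurable
    fix X :: "nat \<Rightarrow> nat \<Rightarrow> vec"
    let ?s = "\<Sum>b\<in>{1..n} - {a}. \<Sum>l=1..d i. w b l * X b i l"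
    have eq: "(\<Sum>b=1..n. \<Sum>l=1..d i. w b l * (X(a := x)) b i l) = (\<Sum>l=1..d i. w a l * x i l) + ?s" for x
      using a by (subst sum.remove[of _ a]) (auto intro!: sum.cong)
    have "AE v in \<nu> i. (\<Sum>l=1..d i. w a l * v l) \<noteq> - ?s"
    proof (rule absolutely_continuous_AE[where M="leb (d i)"])
      show "AE v in leb (d i). (\<Sum>l=1..d i. w a l * v l) \<noteq> - ?s"
        by (rule AE_leb_hyperplane[of j "d i" "w a" "- ?s", OF j w])
    qed (use ac[OF i] in \<open>auto simp: ac_prob_def\<close>)
    then have "AE x in \<kappa>. (\<Sum>l=1..d i. w a l * x i l) \<noteq> - ?s"
      unfolding joint_indep_def using prob_space_\<nu> i by (intro AE_PiM_component) auto
    then show "AE x in \<kappa>. (\<Sum>b=1..n. \<Sum>l=1..d i. w b l * (X(a := x)) b i l) \<noteq> 0"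
      unfolding eq by eventually_elim linarith
  qed (use a in auto)
qed

text \<open>Two matchings of equal cost but different values confine the data of the block to a
  hyperplane with nonzero normal, a null event; there are finitely many pairs of matchings.\<close>

lemma AE_rank_unique:
  assumes i: "i \<in> {1..r}" and g: "\<And>a. a \<in> {1..n} \<Longrightarrow> g a \<in> unit_cube (d i)"
  shows "AE X in iid_sample n \<kappa>. rank_unique (d i) n g (\<lambda>a. X a i)"
proof -
  have "AE X in iid_sample n \<kappa>. match_cost (d i) n g (\<lambda>a. X a i) \<sigma> = match_cost (d i) n g (\<lambda>a. X a i) \<tau>
      \<longrightarrow> (\<forall>a\<in>{1..n}. g (\<sigma> a) = g (\<tau> a))" if \<sigma>: "\<sigma> \<in> perms n" and \<tau>: "\<tau> \<in> perms n" for \<sigma> \<tau>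
  proof (cases "\<forall>a\<in>{1..n}. g (\<sigma> a) = g (\<tau> a)")
    case False
    then obtain a where a: "a \<in> {1..n}" "g (\<sigma> a) \<noteq> g (\<tau> a)" by auto
    \<comment> \<open>Points of the cube agree outside the index range, where both are
      \<open>undefined\<close>, so distinct points differ in a genuine coordinate.\<close>
    have "\<exists>j\<in>{1..d i}. g (\<sigma> a) j \<noteq> g (\<tau> a) j"
    proof (rule ccontr)
      assume "\<not> ?thesis"
      moreover have "g (\<sigma> a) \<in> unit_cube (d i)" "g (\<tau> a) \<in> unit_cube (d i)"
        using g perms_closed[OF \<sigma> a(1)] perms_closed[OF \<tau> a(1)] by auto
      ultimately have "g (\<sigma> a) = g (\<tau> a)"
        unfolding unit_cube_def by (intro PiE_ext) auto
      then show False using a by simp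
    qed
    then obtain j where j: "j \<in> {1..d i}" "g (\<sigma> a) j - g (\<tau> a) j \<noteq> 0" by auto
    have "AE X in iid_sample n \<kappa>. (\<Sum>a=1..n. \<Sum>j=1..d i. (g (\<sigma> a) j - g (\<tau> a) j) * X a i j) \<noteq> 0"
      by (rule AE_sample_hyperplane[where w="\<lambda>a j. g (\<sigma> a) j - g (\<tau> a) j", OF i a(1) j])
    then show ?thesis
      unfolding match_cost_eq_iff[OF \<sigma> \<tau>] by eventually_elim blast
  qed simp
  then show ?thesis unfolding rank_unique_def by (subst AE_finite_all) (auto simp: AE_finite_all)
qed

text \<open>
  Under joint independence all blocks \<open>X\<^sub>a\<^sup>i\<close> are independent, so permuting the observations of
  each block separately preserves the law of the sample.
\<close>

definition permute_blocks :: "nat \<Rightarrow> (nat \<Rightarrow> nat \<Rightarrow> nat) \<Rightarrow> (nat \<Rightarrow> nat \<Rightarrow> vec) \<Rightarrow> nat \<Rightarrow> nat \<Rightarrow> vec" where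
  "permute_blocks n \<tau> X = (\<lambda>a\<in>{1..n}. \<lambda>i\<in>{1..r}. X (\<tau> i a) i)"

text \<open>The sample, a product of products, is represented as the image of one flat product over
  pairs of observation and block. In the flat product a blockwise permutation is a mere
  reindexing.\<close>

lemma distr_curry:
  assumes n: "1 \<le> n"
  shows "distr (\<Pi>\<^sub>M p\<in>{1..n} \<times> {1..r}. \<nu> (snd p)) (iid_sample n \<kappa>) (\<lambda>\<omega>. \<lambda>a\<in>{1..n}. \<lambda>i\<in>{1..r}. \<omega> (a, i))
    = iid_sample n \<kappa>"
proof -
  let ?K = "{1..n} \<times> {1..r}" and ?N = "\<lambda>p::nat \<times> nat. \<nu> (snd p)"
  let ?Q = "Pi\<^sub>M ?K ?N" and ?c = "\<lambda>a \<omega>. \<lambda>i\<in>{1..r}. \<omega> (a, i)"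
  have N: "prob_space (?N p)" if "p \<in> ?K" for p using that prob_space_\<nu> by auto
  interpret Q: prob_space ?Q by (intro prob_space_PiM N)
  have comp: "(\<lambda>\<omega>. \<omega> p) \<in> measurable ?Q (?N p)" if "p \<in> ?K" for p
    using that by (rule measurable_component_singleton)
  have "Q.indep_vars ?N (\<lambda>p \<omega>. \<omega> p) ?K"
  proof -
    have ne: "?K \<noteq> {}" using n r by auto
    have "(\<Pi>\<^sub>M p\<in>?K. distr ?Q (?N p) (\<lambda>\<omega>. \<omega> p)) = ?Q"
      by (rule PiM_cong[OF refl]) (rule distr_PiM_component[OF N])
    moreover have "distr ?Q ?Q (\<lambda>\<omega>. \<lambda>p\<in>?K. \<omega> p) = distr ?Q ?Q (\<lambda>\<omega>. \<omega>)"
      by (rule distr_cong) (auto simp: space_PiM)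
    moreover have "distr ?Q ?Q (\<lambda>\<omega>. \<omega>) = ?Q" by (rule distr_id)
    ultimately show ?thesis
      by (subst Q.indep_vars_iff_distr_eq_PiM'[OF ne comp]) (simp_all only:)
  qed
  then have "Q.indep_vars (\<lambda>a. Pi\<^sub>M ({a} \<times> {1..r}) ?N) (\<lambda>a \<omega>. restrict (\<lambda>p. \<omega> p) ({a} \<times> {1..r})) {1..n}"
    by (rule Q.indep_vars_restrict) (auto simp: disjoint_family_on_def)
  then have "Q.indep_vars (\<lambda>_. \<kappa>) (\<lambda>a \<omega>. ?c a (restrict (\<lambda>p. \<omega> p) ({a} \<times> {1..r}))) {1..n}"
  proof (rule Q.indep_vars_compose2)
    fix a assume "a \<in> {1..n}"
    show "?c a \<in> measurable (Pi\<^sub>M ({a} \<times> {1..r}) ?N) \<kappa>"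
      unfolding joint_indep_def
    proof (rule measurable_restrict)
      fix i assume "i \<in> {1..r}"
      then show "(\<lambda>\<omega>. \<omega> (a, i)) \<in> measurable (Pi\<^sub>M ({a} \<times> {1..r}) ?N) (\<nu> i)"
        using measurable_component_singleton[of "(a, i)" "{a} \<times> {1..r}" ?N] by simp
    qed
  qed
  moreover have "(\<lambda>a (\<omega> :: nat \<times> nat \<Rightarrow> vec). ?c a (restrict (\<lambda>p. \<omega> p) ({a} \<times> {1..r}))) = ?c"
    by (simp add: fun_eq_iff)
  ultimately have indep: "Q.indep_vars (\<lambda>_. \<kappa>) ?c {1..n}" by (rule subst[rotated])
  have c_meas: "?c a \<in> measurable ?Q \<kappa>" if a: "a \<in> {1..n}" for a
    using indep a unfolding Q.indep_vars_def by auto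
  have law: "distr ?Q \<kappa> (?c a) = \<kappa>" if a: "a \<in> {1..n}" for a
  proof -
    have "distr ?Q (\<Pi>\<^sub>M i\<in>{1..r}. ?N (a, i)) (\<lambda>\<omega>. \<lambda>i\<in>{1..r}. \<omega> (a, i)) = (\<Pi>\<^sub>M i\<in>{1..r}. ?N (a, i))"
      by (rule distr_PiM_reindex[OF N]) (use a in \<open>auto simp: inj_on_def\<close>)
    then show ?thesis by (simp only: joint_indep_def snd_conv)
  qed
  have "distr ?Q (\<Pi>\<^sub>M a\<in>{1..n}. \<kappa>) (\<lambda>\<omega>. \<lambda>a\<in>{1..n}. ?c a \<omega>) = (\<Pi>\<^sub>M a\<in>{1..n}. distr ?Q \<kappa> (?c a))"
    using indep n by (subst Q.indep_vars_iff_distr_eq_PiM'[OF _ c_meas, symmetric]) simp_all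
  also have "\<dots> = (\<Pi>\<^sub>M a\<in>{1..n}. \<kappa>)" by (rule PiM_cong[OF refl law])
  finally show ?thesis by (simp only: iid_sample_def)
qed

lemma measurable_permute_blocks:
  assumes "\<And>i. i \<in> {1..r} \<Longrightarrow> \<tau> i \<in> perms n"
  shows "permute_blocks n \<tau> \<in> measurable (iid_sample n \<kappa>) (iid_sample n \<kappa>)"
  unfolding iid_sample_def permute_blocks_def
proof (rule measurable_restrict)
  fix a assume a: "a \<in> {1..n}"
  show "(\<lambda>X. \<lambda>i\<in>{1..r}. X (\<tau> i a) i) \<in> measurable (\<Pi>\<^sub>M a\<in>{1..n}. \<kappa>) \<kappa>"
    unfolding joint_indep_def
  proof (rule measurable_restrict)
    fix i assume i: "i \<in> {1..r}"
    show "(\<lambda>X. X (\<tau> i a) i) \<in> measurable (\<Pi>\<^sub>M a\<in>{1..n}. \<Pi>\<^sub>M i\<in>{1..r}. \<nu> i) (\<nu> i)"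
      by (rule measurable_compose[OF measurable_component_singleton[OF perms_closed[OF assms[OF i] a]]
            measurable_component_singleton[OF i]])
  qed
qed

lemma distr_permute_blocks:
  assumes n: "1 \<le> n" and \<tau>: "\<And>i. i \<in> {1..r} \<Longrightarrow> \<tau> i \<in> perms n"
  shows "distr (iid_sample n \<kappa>) (iid_sample n \<kappa>) (permute_blocks n \<tau>) = iid_sample n \<kappa>"
proof -
  let ?K = "{1..n} \<times> {1..r}" and ?N = "\<lambda>p::nat \<times> nat. \<nu> (snd p)"
  let ?Q = "Pi\<^sub>M ?K ?N" and ?P = "iid_sample n \<kappa>"
  let ?c = "\<lambda>\<omega>. \<lambda>a\<in>{1..n}. \<lambda>i\<in>{1..r}. \<omega> (a, i)"
  \<comment> \<open>The reindexing permutes observations within each block and fixes the second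
    component, so every factor keeps its law.\<close>
  define f where "f = (\<lambda>p. (\<tau> (snd p) (fst p), snd p))"
  let ?T = "\<lambda>\<omega>. \<lambda>p\<in>?K. \<omega> (f p)"
  have mem: "\<tau> i a \<in> {1..n}" if "i \<in> {1..r}" "a \<in> {1..n}" for i a
    by (rule perms_closed[OF \<tau>[OF that(1)] that(2)])
  have f: "f \<in> ?K \<rightarrow> ?K" using mem unfolding f_def by auto
  have inj: "inj_on f ?K"
    unfolding f_def
  proof (rule inj_onI)
    fix p q assume p: "p \<in> ?K" "q \<in> ?K" and eq: "(\<tau> (snd p) (fst p), snd p) = (\<tau> (snd q) (fst q), snd q)"
    have "snd p \<in> {1..r}" using p(1) by (simp only: mem_Times_iff)
    then have "inj (\<tau> (snd p))" using \<tau> permutes_inj unfolding perms_def by blast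
    have snd: "snd p = snd q" using eq by (rule Pair_inject)
    have "\<tau> (snd p) (fst p) = \<tau> (snd p) (fst q)" using eq unfolding snd by (rule Pair_inject)
    then have "fst p = fst q" by (rule injD[OF \<open>inj (\<tau> (snd p))\<close>])
    then show "p = q" using snd by (rule prod_eqI)
  qed
  have reindex: "distr ?Q ?Q ?T = ?Q"
  proof -
    have "distr ?Q (\<Pi>\<^sub>M p\<in>?K. ?N (f p)) ?T = (\<Pi>\<^sub>M p\<in>?K. ?N (f p))"
      using prob_space_\<nu> by (intro distr_PiM_reindex inj f) auto
    then show ?thesis by (simp only: f_def snd_conv)
  qed
  have c_meas: "?c \<in> measurable ?Q ?P"
    unfolding iid_sample_def joint_indep_def
  proof (intro measurable_restrict)
    fix a i assume "a \<in> {1..n}" "i \<in> {1..r}"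
    then show "(\<lambda>\<omega>. \<omega> (a, i)) \<in> measurable ?Q (\<nu> i)"
      using measurable_component_singleton[of "(a, i)" ?K ?N] by simp
  qed
  have T_meas: "?T \<in> measurable ?Q ?Q"
  proof (rule measurable_restrict)
    fix p assume p: "p \<in> ?K"
    have "(\<lambda>\<omega>. \<omega> (f p)) \<in> measurable ?Q (?N (f p))"
      by (rule measurable_component_singleton) (use f p in blast)
    then show "(\<lambda>\<omega>. \<omega> (f p)) \<in> measurable ?Q (?N p)" by (simp only: f_def snd_conv)
  qed
  have P: "distr ?Q ?P ?c = ?P" by (rule distr_curry[OF n])
  have "distr ?P ?P (permute_blocks n \<tau>) = distr (distr ?Q ?P ?c) ?P (permute_blocks n \<tau>)"
    unfolding P ..
  also have "\<dots> = distr ?Q ?P (permute_blocks n \<tau> \<circ> ?c)"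
    by (rule distr_distr[OF measurable_permute_blocks[OF \<tau>] c_meas])
  also have "permute_blocks n \<tau> \<circ> ?c = ?c \<circ> ?T"
    unfolding permute_blocks_def f_def comp_def
    by (intro ext restrict_ext) (use mem in simp)
  also have "distr ?Q ?P (?c \<circ> ?T) = distr (distr ?Q ?Q ?T) ?P ?c"
    by (rule distr_distr[OF c_meas T_meas, symmetric])
  also have "\<dots> = ?P" unfolding reindex P ..
  finally show ?thesis .
qed

end

section \<open>Measurability of the ranks and of the statistic\<close>

lemma measurable_matchings:
  assumes M: "sets M = sets (\<Pi>\<^sub>M a\<in>{1..n}. leb_blocks r d)" and i: "i \<in> {1..r}"
  shows "(\<lambda>X. matchings (d i) n g (\<lambda>a. X a i)) \<in> measurable M (count_space (Pow (perms n)))"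
proof -
  have comp: "(\<lambda>X. X a i j) \<in> borel_measurable M" if "a \<in> {1..n}" "j \<in> {1..d i}" for a j
  proof -
    have "(\<lambda>x. x i j) \<in> borel_measurable (leb_blocks r d)"
      unfolding leb_blocks_def
      by (rule measurable_compose[where f="\<lambda>x. x i" and g="\<lambda>v. v j",
            OF measurable_component_singleton[where M="\<lambda>i. leb (d i)", OF i] measurable_leb_component[OF that(2)]])
    then have "(\<lambda>X. X a i j) \<in> borel_measurable (\<Pi>\<^sub>M a\<in>{1..n}. leb_blocks r d)"
      by (rule measurable_compose[where f="\<lambda>X. X a" and g="\<lambda>x. x i j",
            OF measurable_component_singleton[where M="\<lambda>_. leb_blocks r d", OF that(1)]])
    then show ?thesis by (simp only: measurable_cong_sets[OF M refl])
  qed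
  have cost: "(\<lambda>X. match_cost (d i) n g (\<lambda>a. X a i) \<sigma>) \<in> borel_measurable M" for \<sigma>
    unfolding match_cost_def vnorm_power2
    by (intro borel_measurable_sum borel_measurable_power borel_measurable_diff comp borel_measurable_const)
  \<comment> \<open>A set of minimizers is prescribed by finitely many comparisons of costs, each of
    them measurable in the data.\<close>
  have "{X \<in> space M. matchings (d i) n g (\<lambda>a. X a i) = A} \<in> sets M" if A: "A \<in> Pow (perms n)" for A
  proof -
    have "{X \<in> space M. matchings (d i) n g (\<lambda>a. X a i) = A} = {X \<in> space M. \<forall>\<sigma>\<in>perms n. \<sigma> \<in> A \<longleftrightarrow>
        (\<forall>\<tau>\<in>perms n. match_cost (d i) n g (\<lambda>a. X a i) \<sigma> \<le> match_cost (d i) n g (\<lambda>a. X a i) \<tau>)}"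
      using A unfolding matchings_def by blast
    also have "\<dots> \<in> sets M"
    proof (rule sets.sets_Collect_finite_All[OF _ finite_perms])
      fix \<sigma>
      have opt: "{X \<in> space M. \<forall>\<tau>\<in>perms n. match_cost (d i) n g (\<lambda>a. X a i) \<sigma>
          \<le> match_cost (d i) n g (\<lambda>a. X a i) \<tau>} \<in> sets M"
        by (intro sets.sets_Collect_finite_All finite_perms borel_measurable_le cost)
      then show "{X \<in> space M. \<sigma> \<in> A \<longleftrightarrow> (\<forall>\<tau>\<in>perms n. match_cost (d i) n g (\<lambda>a. X a i) \<sigma>
          \<le> match_cost (d i) n g (\<lambda>a. X a i) \<tau>)} \<in> sets M"
        using sets.sets_Collect_neg[OF opt] by (cases "\<sigma> \<in> A") simp_all
    qed
    finally show ?thesis .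
  qed
  moreover have "(\<lambda>X. matchings (d i) n g (\<lambda>a. X a i)) -` {A} \<inter> space M
      = {X \<in> space M. matchings (d i) n g (\<lambda>a. X a i) = A}" for A by auto
  ultimately show ?thesis
    by (subst measurable_count_space_eq2) (auto simp: matchings_def)
qed

lemma measurable_opt_perm:
  assumes "sets M = sets (\<Pi>\<^sub>M a\<in>{1..n}. leb_blocks r d)" "i \<in> {1..r}"
  shows "(\<lambda>X. opt_perm (d i) n g (\<lambda>a. X a i)) \<in> measurable M (count_space UNIV)"
  unfolding opt_perm_eq_some
  by (rule measurable_compose[OF measurable_matchings[OF assms]]) simp

definition perm_families :: "nat \<Rightarrow> nat \<Rightarrow> (nat \<Rightarrow> nat \<Rightarrow> nat) set" where
  "perm_families r n = {1..r} \<rightarrow>\<^sub>E perms n"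

lemma finite_perm_families [simp]: "finite (perm_families r n)"
  unfolding perm_families_def by (rule finite_PiE) auto

definition perm_stat ::
  "nat \<Rightarrow> (nat \<Rightarrow> nat) \<Rightarrow> (nat \<Rightarrow> nat \<Rightarrow> nat \<Rightarrow> vec) \<Rightarrow> (nat \<Rightarrow> real) \<Rightarrow> nat \<Rightarrow> (nat \<Rightarrow> nat \<Rightarrow> nat) \<Rightarrow> real" where
  "perm_stat r d h C n \<tau> = rank_stat r d C n (\<lambda>i a. h (d i) n (\<tau> i a))"

definition opt_perms ::
  "nat \<Rightarrow> (nat \<Rightarrow> nat) \<Rightarrow> (nat \<Rightarrow> nat \<Rightarrow> nat \<Rightarrow> vec) \<Rightarrow> nat \<Rightarrow> (nat \<Rightarrow> nat \<Rightarrow> vec) \<Rightarrow> nat \<Rightarrow> nat \<Rightarrow> nat" where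
  "opt_perms r d h n X = (\<lambda>i\<in>{1..r}. opt_perm (d i) n (h (d i) n) (\<lambda>a. X a i))"

lemma opt_perms_in: "opt_perms r d h n X \<in> perm_families r n"
  by (auto simp: opt_perms_def perm_families_def intro: opt_perm_in_perms)

lemma RJdCov2_eq_perm_stat: "RJdCov2 r d h C n X = perm_stat r d h C n (opt_perms r d h n X)"
  unfolding RJdCov2_eq_rank_stat perm_stat_def by (rule rank_stat_cong) (simp add: opt_perms_def)

lemma measurable_opt_perms:
  assumes M: "sets M = sets (\<Pi>\<^sub>M a\<in>{1..n}. leb_blocks r d)"
  shows "opt_perms r d h n \<in> measurable M (count_space (perm_families r n))"
proof -
  have "opt_perms r d h n -` {\<tau>} \<inter> space M \<in> sets M" if \<tau>: "\<tau> \<in> perm_families r n" for \<tau>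
  proof -
    have "opt_perms r d h n -` {\<tau>} \<inter> space M
        = {X \<in> space M. \<forall>i\<in>{1..r}. opt_perm (d i) n (h (d i) n) (\<lambda>a. X a i) = \<tau> i}"
    proof (intro set_eqI iffI)
      fix X assume X: "X \<in> {X \<in> space M. \<forall>i\<in>{1..r}. opt_perm (d i) n (h (d i) n) (\<lambda>a. X a i) = \<tau> i}"
      have "opt_perms r d h n X = \<tau>"
        using opt_perms_in[of r d h n X, unfolded perm_families_def] \<tau>[unfolded perm_families_def]
        by (rule PiE_ext) (use X in \<open>simp add: opt_perms_def\<close>)
      then show "X \<in> opt_perms r d h n -` {\<tau>} \<inter> space M" using X by simp
    qed (auto simp: opt_perms_def)
    also have "\<dots> \<in> sets M"
    proof (intro sets.sets_Collect_finite_All)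
      fix i assume i: "i \<in> {1..r}"
      have "(\<lambda>X. opt_perm (d i) n (h (d i) n) (\<lambda>a. X a i)) -` {\<tau> i} \<inter> space M \<in> sets M"
        using measurable_opt_perm[OF M i] by (rule measurable_sets) simp
      then show "{X \<in> space M. opt_perm (d i) n (h (d i) n) (\<lambda>a. X a i) = \<tau> i} \<in> sets M"
        by (simp add: vimage_def Int_def conj_commute)
    qed simp
    finally show ?thesis .
  qed
  then show ?thesis by (subst measurable_count_space_eq2) (auto intro: opt_perms_in)
qed

lemma measurable_RJdCov2:
  assumes M: "sets M = sets (\<Pi>\<^sub>M a\<in>{1..n}. leb_blocks r d)"
  shows "RJdCov2 r d h C n \<in> borel_measurable M"
  unfolding RJdCov2_eq_perm_stat[abs_def]
  by (rule measurable_compose[OF measurable_opt_perms[OF M]]) simp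

lemma sum_perm_families_translate:
  assumes \<sigma>: "\<sigma> \<in> perm_families r n"
  shows "(\<Sum>\<tau>\<in>perm_families r n. f (\<lambda>i\<in>{1..r}. \<sigma> i \<circ> \<tau> i)) = (\<Sum>\<tau>\<in>perm_families r n. f \<tau>)"
proof -
  have \<sigma>i: "\<sigma> i permutes {1..n}" if "i \<in> {1..r}" for i
    using \<sigma> that by (auto simp: perm_families_def perms_def)
  have closed: "(\<lambda>i\<in>{1..r}. p i \<circ> \<tau> i) \<in> perm_families r n"
    if "\<tau> \<in> perm_families r n" "\<And>i. i \<in> {1..r} \<Longrightarrow> p i permutes {1..n}" for p \<tau>
    using that unfolding perm_families_def perms_def by (auto intro!: permutes_compose)
  show ?thesis
  proof (rule sum.reindex_bij_witness[where i="\<lambda>\<tau>. \<lambda>i\<in>{1..r}. inv (\<sigma> i) \<circ> \<tau> i"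
        and j="\<lambda>\<tau>. \<lambda>i\<in>{1..r}. \<sigma> i \<circ> \<tau> i"])
    fix \<tau> assume \<tau>: "\<tau> \<in> perm_families r n"
    have ext: "(\<lambda>i\<in>{1..r}. \<tau> i) = \<tau>"
      using \<tau> unfolding perm_families_def by (rule PiE_restrict)
    have "(\<lambda>i\<in>{1..r}. inv (\<sigma> i) \<circ> (\<lambda>i\<in>{1..r}. \<sigma> i \<circ> \<tau> i) i) = (\<lambda>i\<in>{1..r}. \<tau> i)"
      by (rule restrict_ext) (simp add: o_assoc permutes_inv_o(2)[OF \<sigma>i])
    then show "(\<lambda>i\<in>{1..r}. inv (\<sigma> i) \<circ> (\<lambda>i\<in>{1..r}. \<sigma> i \<circ> \<tau> i) i) = \<tau>" unfolding ext .
    have "(\<lambda>i\<in>{1..r}. \<sigma> i \<circ> (\<lambda>i\<in>{1..r}. inv (\<sigma> i) \<circ> \<tau> i) i) = (\<lambda>i\<in>{1..r}. \<tau> i)"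
      by (rule restrict_ext) (simp add: o_assoc permutes_inv_o(1)[OF \<sigma>i])
    then show "(\<lambda>i\<in>{1..r}. \<sigma> i \<circ> (\<lambda>i\<in>{1..r}. inv (\<sigma> i) \<circ> \<tau> i) i) = \<tau>" unfolding ext .
    show "(\<lambda>i\<in>{1..r}. \<sigma> i \<circ> \<tau> i) \<in> perm_families r n" by (rule closed[OF \<tau> \<sigma>i])
    show "(\<lambda>i\<in>{1..r}. inv (\<sigma> i) \<circ> \<tau> i) \<in> perm_families r n"
      by (rule closed[OF \<tau>]) (rule permutes_inv[OF \<sigma>i])
  qed simp
qed

section \<open>The null law as a uniform law on families of permutations\<close>

context ac_marginals begin

lemma sets_iid_\<kappa>: "sets (iid_sample n \<kappa>) = sets (\<Pi>\<^sub>M a\<in>{1..n}. leb_blocks r d)"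
  unfolding iid_sample_def by (intro sets_PiM_cong refl sets_\<kappa>)

text \<open>Permuting the blocks of the sample by \<open>\<tau>\<close> leaves its law unchanged
  and, almost surely, composes the optimal permutations with \<open>\<tau>\<close> without affecting
  the matched grid values otherwise. Averaging over all \<open>\<tau>\<close> makes the arrangement
  uniform.\<close>

lemma null_prob:
  assumes n: "1 \<le> n"
    and h: "\<And>i a. i \<in> {1..r} \<Longrightarrow> a \<in> {1..n} \<Longrightarrow> h (d i) n a \<in> unit_cube (d i)"
    and B: "B \<in> sets borel"
  shows "measure (iid_sample n \<kappa>) {X \<in> space (iid_sample n \<kappa>). RJdCov2 r d h C n X \<in> B}
    = (\<Sum>\<tau>\<in>perm_families r n. of_bool (perm_stat r d h C n \<tau> \<in> B)) / real (card (perm_families r n))"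
proof -
  let ?P = "iid_sample n \<kappa>" and ?F = "perm_stat r d h C n" and ?\<Pi> = "perm_families r n"
  interpret P: prob_space ?P unfolding iid_sample_def by (intro prob_space_PiM prob_space_\<kappa>)
  have [measurable]: "RJdCov2 r d h C n \<in> borel_measurable ?P" by (rule measurable_RJdCov2[OF sets_iid_\<kappa>])
  define \<phi> :: "(nat \<Rightarrow> nat \<Rightarrow> vec) \<Rightarrow> real" where "\<phi> = (\<lambda>X. indicator B (RJdCov2 r d h C n X))"
  have \<phi> [measurable]: "\<phi> \<in> borel_measurable ?P" unfolding \<phi>_def using B by measurable
  have uniq: "AE X in ?P. \<forall>i\<in>{1..r}. rank_unique (d i) n (h (d i) n) (\<lambda>a. X a i)"
    using h by (subst AE_finite_all) (auto intro!: AE_rank_unique)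
  have F_meas: "(\<lambda>X. indicator B (?F (\<lambda>i\<in>{1..r}. opt_perms r d h n X i \<circ> \<tau> i)) :: real) \<in> borel_measurable ?P" for \<tau>
    by (rule measurable_compose[where g="\<lambda>\<sigma>. indicator B (?F (\<lambda>i\<in>{1..r}. \<sigma> i \<circ> \<tau> i))",
          OF measurable_opt_perms[where d=d and h=h, OF sets_iid_\<kappa>]]) simp
  have permuted: "(\<integral>X. \<phi> X \<partial>?P) = (\<integral>X. indicator B (?F (\<lambda>i\<in>{1..r}. opt_perms r d h n X i \<circ> \<tau> i)) \<partial>?P)"
    if \<tau>: "\<tau> \<in> ?\<Pi>" for \<tau>
  proof -
    have \<tau>i: "\<tau> i \<in> perms n" if "i \<in> {1..r}" for i using \<tau> that by (auto simp: perm_families_def)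
    note meas = measurable_permute_blocks[of \<tau> n, OF \<tau>i]
    have "(\<integral>X. \<phi> X \<partial>?P) = (\<integral>X. \<phi> X \<partial>distr ?P ?P (permute_blocks n \<tau>))"
      by (simp only: distr_permute_blocks[of n \<tau>, OF n \<tau>i])
    also have "\<dots> = (\<integral>X. \<phi> (permute_blocks n \<tau> X) \<partial>?P)"
      by (rule integral_distr[OF meas \<phi>])
    also have "\<dots> = (\<integral>X. indicator B (?F (\<lambda>i\<in>{1..r}. opt_perms r d h n X i \<circ> \<tau> i)) \<partial>?P)"
    proof (rule integral_cong_AE)
      show "(\<lambda>X. \<phi> (permute_blocks n \<tau> X)) \<in> borel_measurable ?P"
        by (rule measurable_compose[OF meas \<phi>])
      show "(\<lambda>X. indicator B (?F (\<lambda>i\<in>{1..r}. opt_perms r d h n X i \<circ> \<tau> i)) :: real) \<in> borel_measurable ?P"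
        by (rule F_meas)
      show "AE X in ?P. \<phi> (permute_blocks n \<tau> X) = indicator B (?F (\<lambda>i\<in>{1..r}. opt_perms r d h n X i \<circ> \<tau> i))"
        using uniq
      proof eventually_elim
        case (elim X)
        have "h (d i) n (opt_perm (d i) n (h (d i) n) (\<lambda>a. permute_blocks n \<tau> X a i) a)
            = h (d i) n (opt_perm (d i) n (h (d i) n) (\<lambda>a. X a i) (\<tau> i a))"
          if i: "i \<in> {1..r}" and a: "a \<in> {1..n}" for i a
        proof (rule opt_perm_permuted[OF \<tau>i[OF i] _ _ a])
          show "permute_blocks n \<tau> X a i = X (\<tau> i a) i" if "a \<in> {1..n}" for a
            using i that by (simp add: permute_blocks_def)
          show "rank_unique (d i) n (h (d i) n) (\<lambda>a. X a i)" using elim i by blast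
        qed
        then have "RJdCov2 r d h C n (permute_blocks n \<tau> X) = ?F (\<lambda>i\<in>{1..r}. opt_perms r d h n X i \<circ> \<tau> i)"
          unfolding RJdCov2_eq_rank_stat perm_stat_def by (intro rank_stat_cong) (simp add: opt_perms_def)
        then show ?case by (simp add: \<phi>_def)
      qed
    qed
    finally show ?thesis .
  qed
  have int: "integrable ?P (\<lambda>X. indicator B (?F (\<lambda>i\<in>{1..r}. opt_perms r d h n X i \<circ> \<tau> i)) :: real)" for \<tau>
    by (rule P.integrable_const_bound[where B=1, OF _ F_meas]) (simp add: indicator_def)
  \<comment> \<open>All permuted versions have the same integral. After summation over
    \<open>\<tau>\<close> the integrand is a full sum over a translate of the group, so it no longer
    depends on the sample.\<close>
  have "real (card ?\<Pi>) * (\<integral>X. \<phi> X \<partial>?P) = (\<Sum>\<tau>\<in>?\<Pi>. \<integral>X. \<phi> X \<partial>?P)" by simp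
  also have "\<dots> = (\<Sum>\<tau>\<in>?\<Pi>. \<integral>X. indicator B (?F (\<lambda>i\<in>{1..r}. opt_perms r d h n X i \<circ> \<tau> i)) \<partial>?P)"
    by (rule sum.cong[OF refl permuted])
  also have "\<dots> = (\<integral>X. (\<Sum>\<tau>\<in>?\<Pi>. indicator B (?F (\<lambda>i\<in>{1..r}. opt_perms r d h n X i \<circ> \<tau> i))) \<partial>?P)"
    by (rule Bochner_Integration.integral_sum[symmetric]) (rule int)
  also have "\<dots> = (\<integral>X. (\<Sum>\<tau>\<in>?\<Pi>. indicator B (?F \<tau>)) \<partial>?P)"
    by (rule Bochner_Integration.integral_cong[OF refl], rule sum_perm_families_translate[OF opt_perms_in])
  also have "\<dots> = (\<Sum>\<tau>\<in>?\<Pi>. indicator B (?F \<tau>))" by (simp add: P.prob_space)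
  finally have eq: "real (card ?\<Pi>) * (\<integral>X. \<phi> X \<partial>?P) = (\<Sum>\<tau>\<in>?\<Pi>. indicator B (?F \<tau>))" .
  have "(\<integral>X. \<phi> X \<partial>?P) = (\<integral>X. indicator {X \<in> space ?P. RJdCov2 r d h C n X \<in> B} X \<partial>?P)"
    by (rule Bochner_Integration.integral_cong[OF refl]) (simp add: \<phi>_def indicator_def)
  also have "\<dots> = measure ?P {X \<in> space ?P. RJdCov2 r d h C n X \<in> B}" using B by simp
  finally have int_\<phi>: "(\<integral>X. \<phi> X \<partial>?P) = measure ?P {X \<in> space ?P. RJdCov2 r d h C n X \<in> B}" .
  have "?\<Pi> \<noteq> {}" using opt_perms_in[of r d h n undefined] by blast
  then have "real (card ?\<Pi>) \<noteq> 0" by simp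
  then have "(\<integral>X. \<phi> X \<partial>?P) = (\<Sum>\<tau>\<in>?\<Pi>. indicator B (?F \<tau>)) / real (card ?\<Pi>)"
    unfolding eq[symmetric] by simp
  then show ?thesis unfolding int_\<phi> by (simp add: indicator_def of_bool_def)
qed

lemma measure_null_law:
  assumes n: "1 \<le> n"
    and h: "\<And>i a. i \<in> {1..r} \<Longrightarrow> a \<in> {1..n} \<Longrightarrow> h (d i) n a \<in> unit_cube (d i)"
    and B: "B \<in> sets borel"
  shows "measure (null_law r d h C n \<nu>) B
    = (\<Sum>\<tau>\<in>perm_families r n. of_bool (perm_stat r d h C n \<tau> \<in> B)) / real (card (perm_families r n))"
proof -
  let ?P = "iid_sample n \<kappa>"
  have "measure (null_law r d h C n \<nu>) B = measure ?P (RJdCov2 r d h C n -` B \<inter> space ?P)"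
    unfolding null_law_def by (rule measure_distr[OF measurable_RJdCov2[OF sets_iid_\<kappa>] B])
  also have "RJdCov2 r d h C n -` B \<inter> space ?P = {X \<in> space ?P. RJdCov2 r d h C n X \<in> B}" by auto
  also have "measure ?P \<dots> = (\<Sum>\<tau>\<in>perm_families r n. of_bool (perm_stat r d h C n \<tau> \<in> B))
      / real (card (perm_families r n))"
    by (rule null_prob[where h=h, OF n _ B]) (rule h)
  finally show ?thesis .
qed

lemma finite_measure_null_law: "finite_measure (null_law r d h C n \<nu>)"
proof -
  interpret P: prob_space "iid_sample n \<kappa>" unfolding iid_sample_def by (intro prob_space_PiM prob_space_\<kappa>)
  show ?thesis unfolding null_law_def
    by (intro prob_space.finite_measure P.prob_space_distr measurable_RJdCov2[OF sets_iid_\<kappa>])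
qed

end

text \<open>The counting formula for the probabilities of the statistic contains no
  marginals.\<close>

lemma null_law_eq:
  assumes \<nu>: "ac_marginals r d \<nu>" and \<nu>': "ac_marginals r d \<nu>'"
    and h: "\<And>i a. i \<in> {1..r} \<Longrightarrow> a \<in> {1..n} \<Longrightarrow> h (d i) n a \<in> unit_cube (d i)"
  shows "null_law r d h C n \<nu> = null_law r d h C n \<nu>'"
proof (cases "n = 0")
  \<comment> \<open>The counting formula is available for \<open>1 \<le> n\<close>; the empty
    product is the same for all marginals.\<close>
  case True
  then show ?thesis by (simp add: null_law_def iid_sample_def PiM_empty)
next
  case False
  then have n: "1 \<le> n" by simp
  interpret A: ac_marginals r d \<nu> by fact
  interpret B: ac_marginals r d \<nu>' by fact
  show ?thesis
  proof (rule measure_eqI)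
    fix B assume "B \<in> sets (null_law r d h C n \<nu>)"
    then have B: "B \<in> sets borel" by (simp add: null_law_def)
    have "measure (null_law r d h C n \<nu>) B = measure (null_law r d h C n \<nu>') B"
      unfolding A.measure_null_law[where h=h, OF n h B, simplified] B.measure_null_law[where h=h, OF n h B, simplified] ..
    then show "emeasure (null_law r d h C n \<nu>) B = emeasure (null_law r d h C n \<nu>') B"
      by (simp add: finite_measure.emeasure_eq_measure A.finite_measure_null_law B.finite_measure_null_law)
  qed (simp add: null_law_def)
qed

section \<open>Second moments under uniform random permutations\<close>

lemma sum_perms_comp:
  assumes "\<pi> \<in> perms n"
  shows "(\<Sum>\<tau>\<in>perms n. f (\<tau> \<circ> \<pi>)) = (\<Sum>\<tau>\<in>perms n. f \<tau>)"
proof (rule sum.reindex_bij_witness[where i="\<lambda>\<tau>. \<tau> \<circ> inv \<pi>" and j="\<lambda>\<tau>. \<tau> \<circ> \<pi>"])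
  have \<pi>: "\<pi> permutes {1..n}" using assms by (simp add: perms_def)
  then have inv: "inv \<pi> \<in> perms n" by (simp add: perms_def permutes_inv)
  show "\<tau> \<circ> \<pi> \<circ> inv \<pi> = \<tau>" "\<tau> \<circ> inv \<pi> \<circ> \<pi> = \<tau>" for \<tau> :: "nat \<Rightarrow> nat"
    by (simp_all add: comp_assoc permutes_inv_o[OF \<pi>])
  show "\<tau> \<circ> inv \<pi> \<in> perms n" "\<tau> \<circ> \<pi> \<in> perms n" if "\<tau> \<in> perms n" for \<tau>
    using that inv assms by (auto intro: perms_comp)
qed simp

text \<open>
  For \<open>b \<noteq> b'\<close> the sum does not depend on \<open>b'\<close>, and summing over all \<open>b'\<close> gives \<open>0\<close>.
\<close>

lemma norm_sum_perms_le:
  fixes z :: "nat \<Rightarrow> complex"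
  assumes n: "2 \<le> n" and centered: "(\<Sum>a=1..n. z a) = 0"
    and bd: "\<And>a. a \<in> {1..n} \<Longrightarrow> cmod (z a) \<le> D" and b: "b \<in> {1..n}" and b': "b' \<in> {1..n}"
  shows "cmod (\<Sum>\<tau>\<in>perms n. z (\<tau> b) * cnj (z (\<tau> b')))
    \<le> real (card (perms n)) * (D\<^sup>2 * (if b = b' then 1 else 1 / (real n - 1)))"
proof -
  define T where "T = (\<lambda>c. \<Sum>\<tau>\<in>perms n. z (\<tau> b) * cnj (z (\<tau> c)))"
  have Tb: "cmod (T b) \<le> real (card (perms n)) * D\<^sup>2"
    unfolding T_def
  proof (rule order.trans[OF sum_norm_le])
    fix \<tau> assume "\<tau> \<in> perms n"
    then have "cmod (z (\<tau> b)) \<le> D" using bd perms_closed b by blast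
    then have "cmod (z (\<tau> b)) * cmod (z (\<tau> b)) \<le> D * D" by (intro mult_mono') auto
    then show "cmod (z (\<tau> b) * cnj (z (\<tau> b))) \<le> D\<^sup>2" by (simp add: norm_mult power2_eq_square)
  qed simp
  show ?thesis
  proof (cases "b = b'")
    case True
    then show ?thesis using Tb by (simp add: T_def)
  next
    case False
    have const: "T c = T b'" if c: "c \<in> {1..n} - {b}" for c
    proof -
      \<comment> \<open>Neither \<open>c\<close> nor \<open>b'\<close> equals \<open>b\<close>, so
        this transposition keeps \<open>\<tau> b\<close> and carries \<open>\<tau> c\<close> to
        \<open>\<tau> b'\<close>.\<close>
      have "Transposition.transpose c b' \<in> perms n" using c b' by (simp add: perms_def permutes_swap_id)
      from sum_perms_comp[OF this, of "\<lambda>\<tau>. z (\<tau> b) * cnj (z (\<tau> c))"]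
      show ?thesis using c False by (simp add: T_def Transposition.transpose_def)
    qed
    have "(\<Sum>c=1..n. T c) = (\<Sum>\<tau>\<in>perms n. z (\<tau> b) * cnj (\<Sum>c=1..n. z (\<tau> c)))"
      unfolding T_def by (subst sum.swap) (simp add: sum_distrib_left)
    also have "\<dots> = (\<Sum>\<tau>\<in>perms n. 0)"
      by (intro sum.cong refl) (simp only: sum_perms centered complex_cnj_zero mult_zero_right)
    finally have "(\<Sum>c=1..n. T c) = 0" by simp
    moreover have "(\<Sum>c=1..n. T c) = T b + (\<Sum>c\<in>{1..n} - {b}. T c)"
      using b by (simp add: sum.remove)
    moreover have "(\<Sum>c\<in>{1..n} - {b}. T c) = of_nat (n - 1) * T b'"
      using const b by simp
    ultimately have "of_nat (n - 1) * T b' = - T b" by (simp add: eq_neg_iff_add_eq_0 add.commute)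
    then have "cmod (of_nat (n - 1) * T b') = cmod (T b)" by simp
    then have "real (n - 1) * cmod (T b') = cmod (T b)" by (simp only: norm_mult norm_of_nat)
    then have "(real n - 1) * cmod (T b') = cmod (T b)" using n by (simp add: of_nat_diff)
    then have "cmod (T b') = cmod (T b) / (real n - 1)" using n by (simp add: field_simps)
    also have "\<dots> \<le> real (card (perms n)) * D\<^sup>2 / (real n - 1)"
      using Tb n by (intro divide_right_mono) auto
    finally show ?thesis using False by (simp add: T_def)
  qed
qed

text \<open>The mean of the exponentials is invariant under permutations; only the evaluated index
  moves.\<close>

lemma char_dev_permuted:
  assumes "\<tau> \<in> perms n"
  shows "char_dev d n (\<lambda>a. g (\<tau> a)) t b = char_dev d n g t (\<tau> b)"
  unfolding char_dev_def using sum_perms[OF assms, of "\<lambda>a. exp (\<i> * complex_of_real (vinner d t (g a)))"] by simp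

lemma sum_char_dev: "1 \<le> n \<Longrightarrow> (\<Sum>b=1..n. char_dev d n u t b) = 0"
  unfolding char_dev_def by (simp add: sum_subtractf)

text \<open>The square of the mean expands into a double sum over \<open>b\<close> and
  \<open>b'\<close>, and each term factorizes over the blocks into sums over single permutations.
  The \<open>n\<close> diagonal terms have weight 1, and the \<open>n * (n - 1)\<close> others at
  most \<open>1 / (n - 1)\<close>. The total weight \<open>2 * n\<close> over the square of
  \<open>n\<close> gives the rate \<open>2 / n\<close>.\<close>

lemma sum_perm_families_dcov_char_le:
  assumes n: "2 \<le> n" and S: "S \<subseteq> {1..r}" "S \<noteq> {}"
    and h: "\<And>i a. i \<in> S \<Longrightarrow> a \<in> {1..n} \<Longrightarrow> h (d i) n a \<in> unit_cube (d i)"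
  shows "(\<Sum>\<tau>\<in>perm_families r n. (cmod (dcov_char d n S (\<lambda>i a. h (d i) n (\<tau> i a)) t))\<^sup>2)
    \<le> real (card (perm_families r n)) * (2 / real n * (\<Prod>i\<in>S. (dev_bound (d i) (t i))\<^sup>2))"
proof -
  have finS: "finite S" using S finite_subset by blast
  define z where "z = (\<lambda>i. char_dev (d i) n (h (d i) n) (t i))"
  define D where "D = (\<lambda>i. dev_bound (d i) (t i))"
  define N where "N = real (card (perms n))"
  define q where "q = (\<lambda>(b :: nat) b'. if b = b' then 1 else 1 / (real n - 1))"
  define w where "w = (\<lambda>(\<tau> :: nat \<Rightarrow> nat \<Rightarrow> nat) b. \<Prod>i\<in>S. z i (\<tau> i b))"
  define T where "T = (\<lambda>i b b'. \<Sum>\<sigma>\<in>perms n. if i \<in> S then z i (\<sigma> b) * cnj (z i (\<sigma> b')) else 1)"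
  have N: "0 \<le> N" by (simp add: N_def)
  have q: "0 \<le> q b b'" "q b b' \<le> 1" for b b' using n by (auto simp: q_def)
  have card: "real (card (perm_families r n)) = N ^ r"
    by (simp add: perm_families_def card_PiE N_def)
  have dcov: "dcov_char d n S (\<lambda>i a. h (d i) n (\<tau> i a)) t = (\<Sum>b=1..n. w \<tau> b) / of_nat n"
    if "\<tau> \<in> perm_families r n" for \<tau>
  proof -
    have "char_dev (d i) n (\<lambda>a. h (d i) n (\<tau> i a)) (t i) b = z i (\<tau> i b)" if "i \<in> S" for i b
      unfolding z_def using that S \<open>\<tau> \<in> perm_families r n\<close>
      by (intro char_dev_permuted) (auto simp: perm_families_def)
    then show ?thesis by (simp add: dcov_char_def w_def)
  qed
  have T_le: "cmod (T i b b') \<le> N * (if i \<in> S then (D i)\<^sup>2 * q b b' else 1)"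
    if "b \<in> {1..n}" "b' \<in> {1..n}" for i b b'
  proof (cases "i \<in> S")
    case True
    have "cmod (\<Sum>\<sigma>\<in>perms n. z i (\<sigma> b) * cnj (z i (\<sigma> b')))
      \<le> real (card (perms n)) * ((D i)\<^sup>2 * (if b = b' then 1 else 1 / (real n - 1)))"
    proof (rule norm_sum_perms_le[OF n _ _ that])
      show "(\<Sum>a=1..n. z i a) = 0" unfolding z_def using n by (intro sum_char_dev) simp
      show "cmod (z i a) \<le> D i" if "a \<in> {1..n}" for a
        unfolding z_def D_def using h True that by (intro char_dev_bound) auto
    qed
    then show ?thesis using True by (simp add: T_def N_def q_def)
  qed (simp add: T_def N_def)
  have cross: "(\<Sum>\<tau>\<in>perm_families r n. w \<tau> b * cnj (w \<tau> b')) = (\<Prod>i=1..r. T i b b')" for b b'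
  proof -
    have "w \<tau> b * cnj (w \<tau> b') = (\<Prod>i=1..r. if i \<in> S then z i (\<tau> i b) * cnj (z i (\<tau> i b')) else 1)" for \<tau>
    proof -
      have "w \<tau> b * cnj (w \<tau> b') = (\<Prod>i\<in>S. z i (\<tau> i b) * cnj (z i (\<tau> i b')))"
        by (simp add: w_def prod.distrib)
      also have "\<dots> = (\<Prod>i=1..r. if i \<in> S then z i (\<tau> i b) * cnj (z i (\<tau> i b')) else 1)"
        using S by (intro prod.mono_neutral_cong_left) auto
      finally show ?thesis .
    qed
    then show ?thesis
      unfolding T_def perm_families_def by (subst prod_sum_PiE) simp_all
  qed
  have cross_le: "cmod (\<Prod>i=1..r. T i b b') \<le> N ^ r * ((\<Prod>i\<in>S. (D i)\<^sup>2) * q b b')"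
    if b: "b \<in> {1..n}" "b' \<in> {1..n}" for b b'
  proof -
    have "cmod (\<Prod>i=1..r. T i b b') \<le> (\<Prod>i=1..r. N * (if i \<in> S then (D i)\<^sup>2 * q b b' else 1))"
      unfolding prod_norm[symmetric] using T_le[OF b] by (intro prod_mono) simp
    also have "\<dots> = N ^ r * (\<Prod>i=1..r. if i \<in> S then (D i)\<^sup>2 * q b b' else 1)"
      by (simp add: prod.distrib)
    also have "(\<Prod>i=1..r. if i \<in> S then (D i)\<^sup>2 * q b b' else 1) = (\<Prod>i\<in>S. (D i)\<^sup>2 * q b b')"
      using S by (intro prod.mono_neutral_cong_right) auto
    also have "\<dots> = (\<Prod>i\<in>S. (D i)\<^sup>2) * q b b' ^ card S" by (simp add: prod.distrib)
    also have "N ^ r * \<dots> \<le> N ^ r * ((\<Prod>i\<in>S. (D i)\<^sup>2) * q b b')"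
    proof (intro mult_left_mono)
      \<comment> \<open>Every block of \<open>S\<close> contributes a factor \<open>q b b'\<close>;
        since these are at most 1, keeping one of them suffices for the rate.\<close>
      have "1 \<le> card S" using S finS by (simp add: Suc_le_eq card_gt_0_iff)
      then have "q b b' ^ card S \<le> q b b' ^ 1" using q by (intro power_decreasing) auto
      then show "q b b' ^ card S \<le> q b b'" by simp
    qed (use N in \<open>auto intro: prod_nonneg\<close>)
    finally show ?thesis .
  qed
  have sum_q: "(\<Sum>b=1..n. \<Sum>b'=1..n. q b b') = 2 * real n"
  proof -
    have "(\<Sum>b'=1..n. q b b') = 2" if b: "b \<in> {1..n}" for b
    proof -
      have "(\<Sum>b'=1..n. q b b') = q b b + (\<Sum>b'\<in>{1..n} - {b}. q b b')" using b by (simp add: sum.remove)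
      also have "(\<Sum>b'\<in>{1..n} - {b}. q b b') = (\<Sum>b'\<in>{1..n} - {b}. 1 / (real n - 1))"
        by (intro sum.cong refl) (auto simp: q_def)
      also have "\<dots> = 1" using b n by (simp add: of_nat_diff)
      finally show ?thesis by (simp add: q_def)
    qed
    then show ?thesis by simp
  qed
  have square: "complex_of_real ((cmod (\<Sum>b=1..n. w \<tau> b))\<^sup>2)
      = (\<Sum>b=1..n. \<Sum>b'=1..n. w \<tau> b * cnj (w \<tau> b'))" for \<tau>
    by (simp only: complex_norm_square cnj_sum sum_product)
  have "complex_of_real (\<Sum>\<tau>\<in>perm_families r n. (cmod (\<Sum>b=1..n. w \<tau> b))\<^sup>2)
      = (\<Sum>\<tau>\<in>perm_families r n. \<Sum>b=1..n. \<Sum>b'=1..n. w \<tau> b * cnj (w \<tau> b'))"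
    by (simp only: of_real_sum square)
  also have "\<dots> = (\<Sum>b=1..n. \<Sum>b'=1..n. \<Sum>\<tau>\<in>perm_families r n. w \<tau> b * cnj (w \<tau> b'))"
  proof -
    have "(\<Sum>\<tau>\<in>perm_families r n. \<Sum>b=1..n. \<Sum>b'=1..n. w \<tau> b * cnj (w \<tau> b'))
      = (\<Sum>b=1..n. \<Sum>\<tau>\<in>perm_families r n. \<Sum>b'=1..n. w \<tau> b * cnj (w \<tau> b'))" by (rule sum.swap)
    also have "\<dots> = (\<Sum>b=1..n. \<Sum>b'=1..n. \<Sum>\<tau>\<in>perm_families r n. w \<tau> b * cnj (w \<tau> b'))"
      by (rule sum.cong[OF refl], rule sum.swap)
    finally show ?thesis .
  qed
  also have "\<dots> = (\<Sum>b=1..n. \<Sum>b'=1..n. \<Prod>i=1..r. T i b b')" by (simp only: cross)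
  finally have "(\<Sum>\<tau>\<in>perm_families r n. (cmod (\<Sum>b=1..n. w \<tau> b))\<^sup>2)
      = cmod (\<Sum>b=1..n. \<Sum>b'=1..n. \<Prod>i=1..r. T i b b')"
  proof -
    assume eq: "complex_of_real (\<Sum>\<tau>\<in>perm_families r n. (cmod (\<Sum>b=1..n. w \<tau> b))\<^sup>2)
      = (\<Sum>b=1..n. \<Sum>b'=1..n. \<Prod>i=1..r. T i b b')"
    have "0 \<le> (\<Sum>\<tau>\<in>perm_families r n. (cmod (\<Sum>b=1..n. w \<tau> b))\<^sup>2)" by (rule sum_nonneg) simp
    then show ?thesis unfolding eq[symmetric] norm_of_real by (rule abs_of_nonneg[symmetric])
  qed
  also have "\<dots> \<le> (\<Sum>b=1..n. \<Sum>b'=1..n. N ^ r * ((\<Prod>i\<in>S. (D i)\<^sup>2) * q b b'))"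
    by (intro sum_norm_le cross_le)
  also have "\<dots> = N ^ r * (\<Prod>i\<in>S. (D i)\<^sup>2) * (\<Sum>b=1..n. \<Sum>b'=1..n. q b b')"
    by (simp add: sum_distrib_left mult.assoc)
  also have "\<dots> = N ^ r * (\<Prod>i\<in>S. (D i)\<^sup>2) * (2 * real n)" unfolding sum_q ..
  finally have le: "(\<Sum>\<tau>\<in>perm_families r n. (cmod (\<Sum>b=1..n. w \<tau> b))\<^sup>2)
      \<le> N ^ r * (\<Prod>i\<in>S. (D i)\<^sup>2) * (2 * real n)" .
  have "(\<Sum>\<tau>\<in>perm_families r n. (cmod (dcov_char d n S (\<lambda>i a. h (d i) n (\<tau> i a)) t))\<^sup>2)
      = (\<Sum>\<tau>\<in>perm_families r n. (cmod (\<Sum>b=1..n. w \<tau> b))\<^sup>2) / (real n)\<^sup>2"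
    unfolding sum_divide_distrib by (intro sum.cong refl) (simp add: dcov norm_divide power_divide)
  also have "\<dots> \<le> N ^ r * (\<Prod>i\<in>S. (D i)\<^sup>2) * (2 * real n) / (real n)\<^sup>2"
    by (intro divide_right_mono le) simp
  also have "\<dots> = N ^ r * (2 / real n * (\<Prod>i\<in>S. (D i)\<^sup>2))"
    using n by (simp add: power2_eq_square)
  finally show ?thesis by (simp add: card D_def)
qed

lemma sum_perm_families_dcov_stat_le:
  assumes n: "2 \<le> n" and S: "S \<subseteq> {1..r}" "S \<noteq> {}" and d: "\<And>i. i \<in> S \<Longrightarrow> 1 \<le> d i"
    and h: "\<And>i a. i \<in> S \<Longrightarrow> a \<in> {1..n} \<Longrightarrow> h (d i) n a \<in> unit_cube (d i)"
  shows "(\<Sum>\<tau>\<in>perm_families r n. dcov_stat d n S (\<lambda>i a. h (d i) n (\<tau> i a)))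
    \<le> real (card (perm_families r n)) * (2 / real n *
        (\<integral>t. (\<Prod>i\<in>S. (dev_bound (d i) (t i))\<^sup>2) \<partial>(\<Pi>\<^sub>M i\<in>S. dcov_weight (d i))))"
proof -
  let ?M = "\<Pi>\<^sub>M i\<in>S. dcov_weight (d i)"
  have finS: "finite S" using S finite_subset by blast
  have cube: "h (d i) n (\<tau> i a) \<in> unit_cube (d i)"
    if "\<tau> \<in> perm_families r n" "i \<in> S" "a \<in> {1..n}" for \<tau> i a
  proof -
    have "\<tau> i \<in> perms n" using that S by (auto simp: perm_families_def)
    then show ?thesis using perms_closed h that by blast
  qed
  have int: "integrable ?M (\<lambda>t. (cmod (dcov_char d n S (\<lambda>i a. h (d i) n (\<tau> i a)) t))\<^sup>2)"
    if "\<tau> \<in> perm_families r n" for \<tau>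
    using cube[OF that] by (intro integrable_dcov_char finS d)
  have "(\<Sum>\<tau>\<in>perm_families r n. dcov_stat d n S (\<lambda>i a. h (d i) n (\<tau> i a)))
      = (\<integral>t. (\<Sum>\<tau>\<in>perm_families r n. (cmod (dcov_char d n S (\<lambda>i a. h (d i) n (\<tau> i a)) t))\<^sup>2) \<partial>?M)"
    unfolding dcov_stat_def by (rule Bochner_Integration.integral_sum[symmetric]) (rule int)
  also have "\<dots> \<le> (\<integral>t. real (card (perm_families r n)) * (2 / real n * (\<Prod>i\<in>S. (dev_bound (d i) (t i))\<^sup>2)) \<partial>?M)"
  proof (rule integral_mono)
    show "integrable ?M (\<lambda>t. \<Sum>\<tau>\<in>perm_families r n. (cmod (dcov_char d n S (\<lambda>i a. h (d i) n (\<tau> i a)) t))\<^sup>2)"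
      by (rule Bochner_Integration.integrable_sum) (rule int)
    show "integrable ?M (\<lambda>t. real (card (perm_families r n)) * (2 / real n * (\<Prod>i\<in>S. (dev_bound (d i) (t i))\<^sup>2)))"
      by (intro integrable_mult_right integrable_prod_dev_bound finS d)
    show "(\<Sum>\<tau>\<in>perm_families r n. (cmod (dcov_char d n S (\<lambda>i a. h (d i) n (\<tau> i a)) t))\<^sup>2)
        \<le> real (card (perm_families r n)) * (2 / real n * (\<Prod>i\<in>S. (dev_bound (d i) (t i))\<^sup>2))" for t
      by (rule sum_perm_families_dcov_char_le[OF n S]) (rule h)
  qed
  also have "\<dots> = real (card (perm_families r n)) * (2 / real n *
        (\<integral>t. (\<Prod>i\<in>S. (dev_bound (d i) (t i))\<^sup>2) \<partial>?M))"
    by (simp only: integral_mult_right_zero)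
  finally show ?thesis .
qed

section \<open>Vanishing critical values\<close>

lemma rank_stat_nonneg:
  assumes "\<And>s. s \<in> {2..r} \<Longrightarrow> 0 \<le> C s"
  shows "0 \<le> rank_stat r d C n R"
  unfolding rank_stat_def using assms by (intro sum_nonneg mult_nonneg_nonneg dcov_stat_nonneg) auto

definition null_mean_bound :: "nat \<Rightarrow> (nat \<Rightarrow> nat) \<Rightarrow> (nat \<Rightarrow> real) \<Rightarrow> real" where
  "null_mean_bound r d C = (\<Sum>s=2..r. C s * (\<Sum>S | S \<subseteq> {1..r} \<and> card S = s.
     \<integral>t. (\<Prod>i\<in>S. (dev_bound (d i) (t i))\<^sup>2) \<partial>(\<Pi>\<^sub>M i\<in>S. dcov_weight (d i))))"

lemma sum_perm_stat_le:
  assumes n: "2 \<le> n" and d: "\<And>i. i \<in> {1..r} \<Longrightarrow> 1 \<le> d i"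
    and h: "\<And>i a. i \<in> {1..r} \<Longrightarrow> a \<in> {1..n} \<Longrightarrow> h (d i) n a \<in> unit_cube (d i)"
    and C: "\<And>s. s \<in> {2..r} \<Longrightarrow> 0 \<le> C s"
  shows "(\<Sum>\<tau>\<in>perm_families r n. perm_stat r d h C n \<tau>)
    \<le> real (card (perm_families r n)) * (2 / real n * null_mean_bound r d C)"
proof -
  let ?\<Pi> = "perm_families r n" and ?I = "\<lambda>S. \<integral>t. (\<Prod>i\<in>S. (dev_bound (d i) (t i))\<^sup>2) \<partial>(\<Pi>\<^sub>M i\<in>S. dcov_weight (d i))"
  have "(\<Sum>\<tau>\<in>?\<Pi>. perm_stat r d h C n \<tau>)
      = (\<Sum>s=2..r. C s * (\<Sum>S | S \<subseteq> {1..r} \<and> card S = s. \<Sum>\<tau>\<in>?\<Pi>. dcov_stat d n S (\<lambda>i a. h (d i) n (\<tau> i a))))"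
  proof -
    have "(\<Sum>\<tau>\<in>?\<Pi>. perm_stat r d h C n \<tau>) = (\<Sum>s=2..r. \<Sum>\<tau>\<in>?\<Pi>.
        C s * (\<Sum>S | S \<subseteq> {1..r} \<and> card S = s. dcov_stat d n S (\<lambda>i a. h (d i) n (\<tau> i a))))"
      unfolding perm_stat_def rank_stat_def by (rule sum.swap)
    also have "\<dots> = (\<Sum>s=2..r. C s * (\<Sum>\<tau>\<in>?\<Pi>.
        \<Sum>S | S \<subseteq> {1..r} \<and> card S = s. dcov_stat d n S (\<lambda>i a. h (d i) n (\<tau> i a))))"
      unfolding sum_distrib_left ..
    also have "\<dots> = (\<Sum>s=2..r. C s * (\<Sum>S | S \<subseteq> {1..r} \<and> card S = s.
        \<Sum>\<tau>\<in>?\<Pi>. dcov_stat d n S (\<lambda>i a. h (d i) n (\<tau> i a))))"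
      by (rule sum.cong[OF refl], rule arg_cong[where f="(*) _"], rule sum.swap)
    finally show ?thesis .
  qed
  also have "\<dots> \<le> (\<Sum>s=2..r. C s * (\<Sum>S | S \<subseteq> {1..r} \<and> card S = s. real (card ?\<Pi>) * (2 / real n * ?I S)))"
  proof (intro sum_mono mult_left_mono C sum_perm_families_dcov_stat_le n)
    fix s S assume s: "s \<in> {2..r}" and S: "S \<in> {S. S \<subseteq> {1..r} \<and> card S = s}"
    show "S \<subseteq> {1..r}" "S \<noteq> {}" using s S by auto
    then show "1 \<le> d i" "a \<in> {1..n} \<Longrightarrow> h (d i) n a \<in> unit_cube (d i)" if "i \<in> S" for i a
      using that d h by auto
  qed
  also have "\<dots> = real (card ?\<Pi>) * (2 / real n * null_mean_bound r d C)"
    unfolding null_mean_bound_def sum_distrib_left by (intro sum.cong refl) simp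
  finally show ?thesis .
qed

context ac_marginals begin

text \<open>Markov's inequality: the statistic is nonnegative and its null mean is at most a
  multiple of \<open>1 / n\<close>, so eventually it exceeds \<open>\<eta>\<close> with probability
  at most \<open>\<alpha>\<close>.\<close>

lemma eventually_upper_quantile_le:
  assumes d: "\<And>i. i \<in> {1..r} \<Longrightarrow> 1 \<le> d i"
    and h: "\<And>i n a. i \<in> {1..r} \<Longrightarrow> a \<in> {1..n} \<Longrightarrow> h (d i) n a \<in> unit_cube (d i)"
    and C: "\<And>s. s \<in> {2..r} \<Longrightarrow> 0 \<le> C s" and \<alpha>: "0 < \<alpha>" "\<alpha> < 1" and \<eta>: "0 < \<eta>"
  shows "\<forall>\<^sub>F n in sequentially. upper_quantile \<alpha> (null_law r d h C n \<nu>) \<le> \<eta>"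
proof -
  let ?K = "null_mean_bound r d C"
  \<comment> \<open>From \<open>m\<close> on, the bound \<open>2 / n * ?K\<close> on the null mean
    is at most \<open>\<alpha> * \<eta>\<close>.\<close>
  obtain m :: nat where m: "2 * ?K / (\<alpha> * \<eta>) \<le> real m" using real_arch_simple by blast
  show ?thesis
  proof (rule eventually_sequentiallyI[of "max 2 m"])
    fix n assume "max 2 m \<le> n"
    then have n: "2 \<le> n" "1 \<le> n" "m \<le> n" by auto
    let ?\<Pi> = "perm_families r n" and ?F = "perm_stat r d h C n" and ?P = "null_law r d h C n \<nu>"
    note law = measure_null_law[where h=h and C=C, OF n(2) h]
    have F: "0 \<le> ?F \<tau>" for \<tau> unfolding perm_stat_def by (rule rank_stat_nonneg[OF C])
    have "?\<Pi> \<noteq> {}" using opt_perms_in[of r d h n undefined] by blast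
    then have card: "0 < real (card ?\<Pi>)" by (simp add: card_gt_0_iff)
    have "2 * ?K / (\<alpha> * \<eta>) \<le> real n" using m n(3) by linarith
    then have "2 / real n * ?K \<le> \<alpha> * \<eta>" using n \<alpha> \<eta> by (simp add: field_simps)
    then have mean: "(\<Sum>\<tau>\<in>?\<Pi>. ?F \<tau>) \<le> real (card ?\<Pi>) * (\<alpha> * \<eta>)"
      using sum_perm_stat_le[where h=h and C=C, OF n(1) d h C] card
      by (meson mult_left_mono less_imp_le order.trans)
    \<comment> \<open>Markov's inequality in counting form: each arrangement above
      \<open>\<eta>\<close> contributes at least \<open>\<eta>\<close> to the sum.\<close>
    have "(\<Sum>\<tau>\<in>?\<Pi>. \<eta> * (1 - of_bool (?F \<tau> \<le> \<eta>))) \<le> (\<Sum>\<tau>\<in>?\<Pi>. ?F \<tau>)"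
      using F by (intro sum_mono) (auto simp: of_bool_def)
    then have "\<eta> * (real (card ?\<Pi>) - (\<Sum>\<tau>\<in>?\<Pi>. of_bool (?F \<tau> \<le> \<eta>))) \<le> real (card ?\<Pi>) * (\<alpha> * \<eta>)"
      using mean by (simp add: sum_distrib_left[symmetric] sum_subtractf)
    then have "\<eta> * (real (card ?\<Pi>) - (\<Sum>\<tau>\<in>?\<Pi>. of_bool (?F \<tau> \<le> \<eta>))) \<le> \<eta> * (real (card ?\<Pi>) * \<alpha>)"
      by (simp add: mult_ac)
    then have "real (card ?\<Pi>) - (\<Sum>\<tau>\<in>?\<Pi>. of_bool (?F \<tau> \<le> \<eta>)) \<le> real (card ?\<Pi>) * \<alpha>"
      using \<eta> by (simp only: mult_le_cancel_left_pos)
    then have "(1 - \<alpha>) * real (card ?\<Pi>) \<le> (\<Sum>\<tau>\<in>?\<Pi>. of_bool (?F \<tau> \<le> \<eta>))" by (simp add: algebra_simps)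
    then have "1 - \<alpha> \<le> (\<Sum>\<tau>\<in>?\<Pi>. of_bool (?F \<tau> \<le> \<eta>)) / real (card ?\<Pi>)"
      using card by (simp only: pos_le_divide_eq)
    then have "1 - \<alpha> \<le> measure ?P {..\<eta>}" by (subst law) auto
    then have mem: "\<eta> \<in> {q. 1 - \<alpha> \<le> measure ?P {..q}}" by simp
    \<comment> \<open>The infimum of a set of reals is below its members only if the set is bounded
      below. Negative \<open>q\<close> are excluded since their mass is 0, whereas
      \<open>1 - \<alpha>\<close> is positive.\<close>
    have "bdd_below {q. 1 - \<alpha> \<le> measure ?P {..q}}"
    proof (rule bdd_belowI[of _ 0], rule ccontr)
      fix q assume q: "q \<in> {q. 1 - \<alpha> \<le> measure ?P {..q}}" and "\<not> 0 \<le> q"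
      then have "\<not> ?F \<tau> \<le> q" for \<tau> using F[of \<tau>] by linarith
      then have "measure ?P {..q} = 0" by (subst law) auto
      then show False using q \<alpha> by simp
    qed
    then show "upper_quantile \<alpha> ?P \<le> \<eta>"
      unfolding upper_quantile_def by (intro cInf_lower mem)
  qed
qed

end

section \<open>Consistency\<close>

text \<open>Exchanging the partners of \<open>a\<close> and \<open>b\<close> cannot lower the cost,
  and it changes the cost by exactly twice this inner product.\<close>

lemma matchings_monotone:
  assumes \<sigma>: "\<sigma> \<in> matchings d n g y" and a: "a \<in> {1..n}" and b: "b \<in> {1..n}"
  shows "0 \<le> (\<Sum>j=1..d. (y a j - y b j) * (g (\<sigma> a) j - g (\<sigma> b) j))"
proof (cases "a = b")
  case False
  define \<pi> where "\<pi> = Transposition.transpose a b"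
  define s where "s = (\<lambda>c e. \<Sum>j=1..d. g (\<sigma> c) j * y e j)"
  have \<sigma>': "\<sigma> \<in> perms n" "\<And>\<tau>. \<tau> \<in> perms n \<Longrightarrow> match_cost d n g y \<sigma> \<le> match_cost d n g y \<tau>"
    using \<sigma> by (auto simp: matchings_def)
  have "\<pi> \<in> perms n" using a b by (simp add: \<pi>_def perms_def permutes_swap_id)
  then have \<sigma>\<pi>: "\<sigma> \<circ> \<pi> \<in> perms n" by (rule perms_comp[OF \<sigma>'(1)])
  have "(\<Sum>c=1..n. s (\<pi> c) c) \<le> (\<Sum>c=1..n. s c c)"
    using \<sigma>'(2)[OF \<sigma>\<pi>] unfolding match_cost_expand[OF \<sigma>'(1)] match_cost_expand[OF \<sigma>\<pi>]
    by (simp add: s_def)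
  moreover have split: "(\<Sum>c=1..n. f c) = f a + f b + (\<Sum>c\<in>{1..n} - {a} - {b}. f c)" for f :: "nat \<Rightarrow> real"
  proof -
    have "(\<Sum>c=1..n. f c) = f a + (\<Sum>c\<in>{1..n} - {a}. f c)" using a by (intro sum.remove) auto
    also have "(\<Sum>c\<in>{1..n} - {a}. f c) = f b + (\<Sum>c\<in>{1..n} - {a} - {b}. f c)"
      using b False by (intro sum.remove) auto
    finally show ?thesis by simp
  qed
  moreover have "(\<Sum>c\<in>{1..n} - {a} - {b}. s (\<pi> c) c) = (\<Sum>c\<in>{1..n} - {a} - {b}. s c c)"
    by (intro sum.cong refl) (simp add: \<pi>_def Transposition.transpose_def)
  moreover have "\<pi> a = b" "\<pi> b = a" by (simp_all add: \<pi>_def)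
  ultimately have "s b a + s a b \<le> s a a + s b b" by simp
  moreover have "(\<Sum>j=1..d. (y a j - y b j) * (g (\<sigma> a) j - g (\<sigma> b) j)) = s a a + s b b - s b a - s a b"
    unfolding s_def sum.distrib[symmetric] sum_subtractf[symmetric]
    by (intro sum.cong refl) (simp add: algebra_simps)
  ultimately show ?thesis by simp
qed simp

section \<open>Tents under the grid limit\<close>

lemma continuous_on_hat_affine: "continuous_on A (\<lambda>s. hat (c * s - e))"
  unfolding hat_def by (intro continuous_intros)

lemma trig_limit_tent: "trig_limit d (\<lambda>v. complex_of_real (tent d m k v))"
  unfolding tent_def of_real_prod
  by (intro trig_limit_prod trig_limit_continuous_component[where f="\<lambda>s. hat (real m * s - real (k _))"]
      continuous_on_hat_affine)

lemma continuous_map_tent: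
  "continuous_map (product_topology (\<lambda>_. euclideanreal) {1..d}) euclideanreal (tent d m k)"
proof -
  have "continuous_map (product_topology (\<lambda>_. euclideanreal) {1..d}) euclideanreal
      (\<lambda>v. hat (real m * v j - real (k j)))" if "j \<in> {1..d}" for j
  proof (rule continuous_map_compose[where g="\<lambda>s. hat (real m * s - real (k j))", unfolded comp_def])
    show "continuous_map (product_topology (\<lambda>_. euclideanreal) {1..d}) euclideanreal (\<lambda>v. v j)"
      using that by (rule continuous_map_product_projection)
    show "continuous_map euclideanreal euclideanreal (\<lambda>s. hat (real m * s - real (k j)))"
      by (simp add: continuous_on_hat_affine)
  qed
  then show ?thesis unfolding tent_def[abs_def] by (intro continuous_map_prod) auto
qed

lemma measurable_tent [measurable]: "tent d m k \<in> borel_measurable (leb d)"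
  unfolding tent_def[abs_def] hat_def by measurable

lemma unit_cube_sets: "unit_cube d \<in> sets (leb d)"
  unfolding unit_cube_def leb_def by (rule sets_PiM_I_finite) auto

lemma emeasure_unit_cube: "emeasure (leb d) (unit_cube d) = 1"
  unfolding unit_cube_def by (subst emeasure_leb_PiE) auto

text \<open>A tent is at most 1 and lives in a box of side \<open>2 / m\<close>, which may stick out
  of the cube.\<close>

lemma integral_uniform_tent_le:
  assumes m: "1 \<le> m"
  shows "(\<integral>v. tent d m k v \<partial>uniform_measure (leb d) (unit_cube d)) \<le> (2 / real m) ^ d"
proof -
  let ?U = "uniform_measure (leb d) (unit_cube d)"
  let ?B = "PiE {1..d} (\<lambda>j. {(real (k j) - 1) / real m..(real (k j) + 1) / real m})"
  have B: "?B \<in> sets (leb d)" unfolding leb_def by (rule sets_PiM_I_finite) auto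
  interpret U: prob_space ?U by (rule prob_space_uniform_measure) (simp_all add: emeasure_unit_cube)
  have "(\<integral>v. tent d m k v \<partial>?U) \<le> (\<integral>v. indicator ?B v \<partial>?U)"
  proof (rule integral_mono_AE)
    show "integrable ?U (tent d m k)"
    proof (rule U.integrable_const_bound[where B=1])
      show "tent d m k \<in> borel_measurable ?U"
        by (subst measurable_cong_sets[OF sets_uniform_measure refl]) (rule measurable_tent)
    qed (simp add: tent_le_1 tent_nonneg)
    show "integrable ?U (indicator ?B :: _ \<Rightarrow> real)"
    proof (rule U.integrable_const_bound[where B=1, OF _ borel_measurable_indicator])
      show "?B \<in> sets ?U" using B by simp
    qed (simp add: indicator_def)
    show "AE v in ?U. tent d m k v \<le> indicator ?B v"
    proof (rule AE_I2)
      fix v assume "v \<in> space ?U"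
      then have v: "v \<in> space (leb d)" by simp
      show "tent d m k v \<le> indicator ?B v"
      proof (cases "0 < tent d m k v")
        case True
        have "v \<in> ?B"
        proof (rule PiE_I)
          fix j assume j: "j \<in> {1..d}"
          show "v j \<in> {(real (k j) - 1) / real m..(real (k j) + 1) / real m}"
            using tent_posD[OF True j] m by (auto simp: field_simps abs_less_iff)
        next
          fix j assume "j \<notin> {1..d}"
          then show "v j = undefined" using v by (auto simp: space_leb PiE_iff extensional_def)
        qed
        then show ?thesis by (simp add: tent_le_1)
      qed (simp add: indicator_def)
    qed
  qed
  also have "\<dots> = measure ?U ?B" using B by simp
  also have "\<dots> \<le> (2 / real m) ^ d"
  proof -
    have "emeasure ?U ?B = emeasure (leb d) (unit_cube d \<inter> ?B)"
      using B unit_cube_sets by (simp add: emeasure_unit_cube divide_ennreal_def)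
    also have "\<dots> \<le> emeasure (leb d) ?B" using B by (intro emeasure_mono) auto
    also have "\<dots> = (\<Prod>j=1..d. ennreal (2 / real m))"
      using m by (subst emeasure_leb_PiE) (auto simp: field_simps diff_divide_distrib[symmetric] intro!: prod.cong)
    also have "\<dots> = ennreal ((2 / real m) ^ d)" by (simp add: ennreal_power)
    finally show ?thesis by (simp add: U.emeasure_eq_measure)
  qed
  finally show ?thesis .
qed

lemma integral_grid_measure:
  assumes n: "1 \<le> n" and g: "\<And>a. a \<in> {1..n} \<Longrightarrow> g a \<in> unit_cube d"
    and f: "f \<in> borel_measurable (leb d)"
  shows "(\<integral>v. f v \<partial>grid_measure d n g) = (\<Sum>a=1..n. f (g a)) / real n"
proof -
  have "g \<in> measurable (uniform_count_measure {1..n}) (leb d)"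
  proof -
    have "g a \<in> space (leb d)" if "a \<in> {1..n}" for a
      using g[OF that] by (auto simp: space_leb unit_cube_def PiE_iff)
    then show ?thesis
      by (simp add: measurable_def space_uniform_count_measure sets_uniform_count_measure Pi_iff)
  qed
  then have "(\<integral>v. f v \<partial>grid_measure d n g) = (\<integral>a. f (g a) \<partial>uniform_count_measure {1..n})"
    unfolding grid_measure_def using f by (rule integral_distr)
  also have "\<dots> = (\<Sum>a=1..n. f (g a)) / real n"
    by (subst integral_uniform_count_measure) simp_all
  finally show ?thesis .
qed

text \<open>The factor 2 is the slack that turns a bound on the limit into a bound for all large
  \<open>n\<close>, simultaneously for the finitely many cells.\<close>

lemma eventually_grid_tents_le:
  assumes m: "1 \<le> m" and g: "\<And>n a. a \<in> {1..n} \<Longrightarrow> g n a \<in> unit_cube d"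
    and conv: "weak_conv_vec d (\<lambda>n. grid_measure d n (g n)) (uniform_measure (leb d) (unit_cube d))"
  shows "\<forall>\<^sub>F n in sequentially. \<forall>k\<in>cells d m. (\<Sum>a=1..n. tent d m k (g n a)) / real n \<le> 2 * (2 / real m) ^ d"
proof (rule eventually_ball_finite[OF finite_cells], rule ballI)
  fix k
  have "bounded (tent d m k ` A)" for A
    unfolding bounded_iff using tent_nonneg tent_le_1 by (intro exI[of _ 1]) (auto simp: abs_of_nonneg)
  then have "(\<lambda>n. \<integral>v. tent d m k v \<partial>grid_measure d n (g n))
      \<longlonglongrightarrow> (\<integral>v. tent d m k v \<partial>uniform_measure (leb d) (unit_cube d))"
    using conv continuous_map_tent unfolding weak_conv_vec_def by blast
  moreover have "(\<integral>v. tent d m k v \<partial>uniform_measure (leb d) (unit_cube d)) < 2 * (2 / real m) ^ d"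
  proof -
    have "0 < (2 / real m) ^ d" using m by simp
    then show ?thesis using integral_uniform_tent_le[OF m, of d k] by linarith
  qed
  ultimately have "\<forall>\<^sub>F n in sequentially. (\<integral>v. tent d m k v \<partial>grid_measure d n (g n)) < 2 * (2 / real m) ^ d"
    by (rule order_tendstoD(2))
  then show "\<forall>\<^sub>F n in sequentially. (\<Sum>a=1..n. tent d m k (g n a)) / real n \<le> 2 * (2 / real m) ^ d"
    using eventually_ge_at_top[of 1]
  proof eventually_elim
    case (elim n)
    then show ?case using integral_grid_measure[OF elim(2) g measurable_tent[of d m k]] by simp
  qed
qed

definition ranks ::
  "(nat \<Rightarrow> nat) \<Rightarrow> (nat \<Rightarrow> nat \<Rightarrow> nat \<Rightarrow> vec) \<Rightarrow> nat \<Rightarrow> (nat \<Rightarrow> nat \<Rightarrow> vec) \<Rightarrow> nat \<Rightarrow> nat \<Rightarrow> vec" where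
  "ranks d h n X i a = h (d i) n (opt_perm (d i) n (h (d i) n) (\<lambda>a. X a i) a)"

lemma RJdCov2_eq_ranks: "RJdCov2 r d h C n X = rank_stat r d C n (ranks d h n X)"
  unfolding RJdCov2_eq_rank_stat ranks_def[abs_def] ..

lemma dcov_stat_le_rank_stat:
  assumes C: "\<And>s. s \<in> {2..r} \<Longrightarrow> 0 \<le> C s" and S: "S \<subseteq> {1..r}" "2 \<le> card S"
  shows "C (card S) * dcov_stat d n S R \<le> rank_stat r d C n R"
proof -
  have s: "card S \<in> {2..r}" using S card_mono[of "{1..r}" S] by simp
  let ?A = "\<lambda>s. {S. S \<subseteq> {1..r} \<and> card S = s}"
  have "C (card S) * dcov_stat d n S R \<le> C (card S) * (\<Sum>S\<in>?A (card S). dcov_stat d n S R)"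
    using C[OF s] S by (intro mult_left_mono member_le_sum dcov_stat_nonneg) auto
  also have "\<dots> \<le> rank_stat r d C n R"
    unfolding rank_stat_def using C s
    by (intro member_le_sum[where f="\<lambda>s. C s * (\<Sum>S\<in>?A s. dcov_stat d n S R)"])
      (auto intro!: mult_nonneg_nonneg sum_nonneg dcov_stat_nonneg)
  finally show ?thesis .
qed

lemma abs_prod_diff_le:
  fixes z w :: "nat \<Rightarrow> real"
  assumes "\<And>i. i \<in> I \<Longrightarrow> 0 \<le> z i \<and> z i \<le> 1" "\<And>i. i \<in> I \<Longrightarrow> 0 \<le> w i \<and> w i \<le> 1"
  shows "\<bar>prod z I - prod w I\<bar> \<le> (\<Sum>i\<in>I. \<bar>z i - w i\<bar>)"
  using norm_prod_diff[of I z w] assms by (simp add: abs_le_iff) 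

lemma avg_bounds:
  fixes z :: "nat \<Rightarrow> real"
  assumes "\<And>a. a \<in> {1..n} \<Longrightarrow> 0 \<le> z a \<and> z a \<le> 1"
  shows "0 \<le> avg n z \<and> avg n z \<le> 1"
proof
  show "0 \<le> avg n z" unfolding avg_def using assms by (intro divide_nonneg_nonneg sum_nonneg) auto
  have "norm (avg n z) \<le> 1" using assms by (intro norm_avg_le) (auto simp: abs_le_iff)
  then show "avg n z \<le> 1" by simp
qed

section \<open>Near independence of the data when the statistic is small\<close>

definition prod_gap :: "nat \<Rightarrow> nat set \<Rightarrow> (nat \<Rightarrow> nat \<Rightarrow> real) \<Rightarrow> real" where
  "prod_gap n I z = avg n (\<lambda>a. \<Prod>i\<in>I. z i a) - (\<Prod>i\<in>I. avg n (z i))"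

text \<open>For values in the unit interval, both the mean of the product and the product of the
  means are Lipschitz with constant 1 in the sum of the mean distances; hence the factor 2.\<close>

lemma prod_gap_close:
  assumes z: "\<And>i a. i \<in> I \<Longrightarrow> a \<in> {1..n} \<Longrightarrow> 0 \<le> z i a \<and> z i a \<le> 1"
    and w: "\<And>i a. i \<in> I \<Longrightarrow> a \<in> {1..n} \<Longrightarrow> 0 \<le> w i a \<and> w i a \<le> 1"
  shows "\<bar>prod_gap n I z - prod_gap n I w\<bar> \<le> 2 * (\<Sum>i\<in>I. avg n (\<lambda>a. \<bar>z i a - w i a\<bar>))"
proof -
  let ?s = "\<Sum>i\<in>I. avg n (\<lambda>a. \<bar>z i a - w i a\<bar>)"
  have "\<bar>avg n (\<lambda>a. \<Prod>i\<in>I. z i a) - avg n (\<lambda>a. \<Prod>i\<in>I. w i a)\<bar>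
      \<le> avg n (\<lambda>a. \<bar>(\<Prod>i\<in>I. z i a) - (\<Prod>i\<in>I. w i a)\<bar>)"
    using norm_avg_le_avg_norm[of n "\<lambda>a. (\<Prod>i\<in>I. z i a) - (\<Prod>i\<in>I. w i a)"] by (simp add: avg_diff)
  also have "\<dots> \<le> avg n (\<lambda>a. \<Sum>i\<in>I. \<bar>z i a - w i a\<bar>)"
    using z w by (intro avg_mono abs_prod_diff_le) auto
  also have "\<dots> = ?s" by (rule avg_sum)
  finally have 1: "\<bar>avg n (\<lambda>a. \<Prod>i\<in>I. z i a) - avg n (\<lambda>a. \<Prod>i\<in>I. w i a)\<bar> \<le> ?s" .
  have "\<bar>(\<Prod>i\<in>I. avg n (z i)) - (\<Prod>i\<in>I. avg n (w i))\<bar> \<le> (\<Sum>i\<in>I. \<bar>avg n (z i) - avg n (w i)\<bar>)"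
    using z w by (intro abs_prod_diff_le avg_bounds) auto
  also have "\<dots> \<le> ?s"
  proof (rule sum_mono)
    fix i
    show "\<bar>avg n (z i) - avg n (w i)\<bar> \<le> avg n (\<lambda>a. \<bar>z i a - w i a\<bar>)"
      using norm_avg_le_avg_norm[of n "\<lambda>a. z i a - w i a"] by (simp add: avg_diff)
  qed
  finally have 2: "\<bar>(\<Prod>i\<in>I. avg n (z i)) - (\<Prod>i\<in>I. avg n (w i))\<bar> \<le> ?s" .
  show ?thesis unfolding prod_gap_def using 1 2 by linarith
qed

text \<open>The gap is multilinear. Expanding it over the choices of one tent per block leaves gaps
  of pure tent products, with coefficients in the unit interval.\<close>

lemma prod_gap_tents_le:
  fixes gc :: "nat \<Rightarrow> (nat \<Rightarrow> nat) \<Rightarrow> real"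
  assumes I: "finite I" and gc: "\<And>i k. i \<in> I \<Longrightarrow> 0 \<le> gc i k \<and> gc i k \<le> 1"
  shows "\<bar>prod_gap n I (\<lambda>i a. \<Sum>k\<in>cells (d i) (m i). gc i k * tent (d i) (m i) k (u i a))\<bar>
    \<le> (\<Sum>k\<in>PiE I (\<lambda>i. cells (d i) (m i)).
        cmod (joint_gap n I (\<lambda>i v. complex_of_real (tent (d i) (m i) (k i) v)) u))"
proof -
  let ?K = "PiE I (\<lambda>i. cells (d i) (m i))" and ?t = "\<lambda>k i a. tent (d i) (m i) (k i) (u i a)"
  have 1: "avg n (\<lambda>a. \<Prod>i\<in>I. \<Sum>k\<in>cells (d i) (m i). gc i k * tent (d i) (m i) k (u i a))
      = (\<Sum>k\<in>?K. (\<Prod>i\<in>I. gc i (k i)) * avg n (\<lambda>a. \<Prod>i\<in>I. ?t k i a))"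
    by (subst prod_sum_PiE) (use I in \<open>simp_all add: prod.distrib avg_sum avg_cmult\<close>)
  have 2: "(\<Prod>i\<in>I. avg n (\<lambda>a. \<Sum>k\<in>cells (d i) (m i). gc i k * tent (d i) (m i) k (u i a)))
      = (\<Sum>k\<in>?K. (\<Prod>i\<in>I. gc i (k i)) * (\<Prod>i\<in>I. avg n (?t k i)))"
    unfolding avg_sum avg_cmult by (subst prod_sum_PiE) (use I in \<open>simp_all add: prod.distrib\<close>)
  have J: "joint_gap n I (\<lambda>i v. complex_of_real (tent (d i) (m i) (k i) v)) u
      = complex_of_real (avg n (\<lambda>a. \<Prod>i\<in>I. ?t k i a) - (\<Prod>i\<in>I. avg n (?t k i)))" for k
    by (simp only: joint_gap_def of_real_prod[symmetric] avg_of_real of_real_diff)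
  have eq: "prod_gap n I (\<lambda>i a. \<Sum>k\<in>cells (d i) (m i). gc i k * tent (d i) (m i) k (u i a))
      = (\<Sum>k\<in>?K. (\<Prod>i\<in>I. gc i (k i)) * (avg n (\<lambda>a. \<Prod>i\<in>I. ?t k i a) - (\<Prod>i\<in>I. avg n (?t k i))))"
    unfolding prod_gap_def 1 2 sum_subtractf[symmetric] right_diff_distrib ..
  have "\<bar>prod_gap n I (\<lambda>i a. \<Sum>k\<in>cells (d i) (m i). gc i k * tent (d i) (m i) k (u i a))\<bar>
      \<le> (\<Sum>k\<in>?K. \<bar>(\<Prod>i\<in>I. gc i (k i)) * (avg n (\<lambda>a. \<Prod>i\<in>I. ?t k i a) - (\<Prod>i\<in>I. avg n (?t k i)))\<bar>)"
    unfolding eq by (rule sum_abs)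
  also have "\<dots> \<le> (\<Sum>k\<in>?K. cmod (joint_gap n I (\<lambda>i v. complex_of_real (tent (d i) (m i) (k i) v)) u))"
  proof (rule sum_mono)
    fix k
    let ?P = "\<Prod>i\<in>I. gc i (k i)" and ?x = "avg n (\<lambda>a. \<Prod>i\<in>I. ?t k i a) - (\<Prod>i\<in>I. avg n (?t k i))"
    have P: "0 \<le> ?P" "?P \<le> 1" by (rule prod_nonneg, rule gc[THEN conjunct1], assumption) (rule prod_le_1, rule gc)
    have "\<bar>?P * ?x\<bar> = ?P * \<bar>?x\<bar>" unfolding abs_mult abs_of_nonneg[OF P(1)] ..
    also have "\<dots> \<le> \<bar>?x\<bar>" by (rule mult_left_le_one_le[OF abs_ge_zero P])
    also have "\<dots> = cmod (joint_gap n I (\<lambda>i v. complex_of_real (tent (d i) (m i) (k i) v)) u)"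
      unfolding J[of k] norm_of_real ..
    finally show "\<bar>(\<Prod>i\<in>I. gc i (k i)) * (avg n (\<lambda>a. \<Prod>i\<in>I. ?t k i a) - (\<Prod>i\<in>I. avg n (?t k i)))\<bar>
        \<le> cmod (joint_gap n I (\<lambda>i v. complex_of_real (tent (d i) (m i) (k i) v)) u)"
      .
  qed
  finally show ?thesis .
qed

lemma tent_combination_bounds:
  assumes "u \<in> unit_cube d" "\<And>k. 0 \<le> gc k \<and> gc k \<le> (1::real)"
  shows "0 \<le> (\<Sum>k\<in>cells d m. gc k * tent d m k u) \<and> (\<Sum>k\<in>cells d m. gc k * tent d m k u) \<le> 1"
proof
  show "0 \<le> (\<Sum>k\<in>cells d m. gc k * tent d m k u)"
    using assms(2) by (intro sum_nonneg mult_nonneg_nonneg tent_nonneg) auto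
  have "(\<Sum>k\<in>cells d m. gc k * tent d m k u) \<le> (\<Sum>k\<in>cells d m. 1 * tent d m k u)"
    using assms(2) by (intro sum_mono mult_right_mono tent_nonneg) auto
  then show "(\<Sum>k\<in>cells d m. gc k * tent d m k u) \<le> 1" by (simp add: sum_tent[OF assms(1)])
qed

text \<open>The dependence may be carried by any subset of at least two blocks. Strict positivity of
  every weight lets a small statistic control the term of each such subset.\<close>

locale grids =
  fixes r :: nat and d :: "nat \<Rightarrow> nat" and h :: "nat \<Rightarrow> nat \<Rightarrow> nat \<Rightarrow> vec" and C :: "nat \<Rightarrow> real"
  assumes d: "\<And>i. i \<in> {1..r} \<Longrightarrow> 1 \<le> d i"
    and h: "\<And>i n a. i \<in> {1..r} \<Longrightarrow> a \<in> {1..n} \<Longrightarrow> h (d i) n a \<in> unit_cube (d i)"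
    and grid: "\<And>i. i \<in> {1..r} \<Longrightarrow>
           weak_conv_vec (d i) (\<lambda>n. grid_measure (d i) n (h (d i) n))
             (uniform_measure (leb (d i)) (unit_cube (d i)))"
    and C: "\<And>s. s \<in> {2..r} \<Longrightarrow> 0 < C s"
begin

lemma ranks_in_cube:
  assumes "i \<in> {1..r}" "a \<in> {1..n}"
  shows "ranks d h n X i a \<in> unit_cube (d i)"
  unfolding ranks_def using perms_closed[OF opt_perm_in_perms assms(2)] by (intro h assms(1))

lemma dcov_char_ranks_tendsto:
  assumes RJ: "((\<lambda>c. RJdCov2 r d h C (fst c) (snd c)) \<longlongrightarrow> 0) F" and S: "S \<subseteq> {1..r}" "2 \<le> card S"
  shows "((\<lambda>c. dcov_char d (fst c) S (ranks d h (fst c) (snd c)) t) \<longlongrightarrow> 0) F"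
proof (rule tendstoI)
  fix \<epsilon> :: real assume \<epsilon>: "0 < \<epsilon>"
  have finS: "finite S" using S finite_subset by blast
  have dS: "1 \<le> d i" if "i \<in> S" for i using d S that by auto
  obtain \<eta> where \<eta>: "0 < \<eta>"
    "\<And>n R. (\<And>i a. i \<in> S \<Longrightarrow> a \<in> {1..n} \<Longrightarrow> R i a \<in> unit_cube (d i)) \<Longrightarrow>
      dcov_stat d n S R < \<eta> \<Longrightarrow> cmod (dcov_char d n S R t) < \<epsilon>"
    using dcov_char_small_of_dcov_stat_small[of S d \<epsilon> t, OF finS dS \<epsilon>] by blast
  have "card S \<in> {2..r}" using S card_mono[of "{1..r}" S] by simp
  then have Cs: "0 < C (card S)" by (rule C)
  have "\<forall>\<^sub>F c in F. RJdCov2 r d h C (fst c) (snd c) < C (card S) * \<eta>"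
    using RJ Cs \<eta>(1) by (intro order_tendstoD(2)) auto
  then show "\<forall>\<^sub>F c in F. dist (dcov_char d (fst c) S (ranks d h (fst c) (snd c)) t) 0 < \<epsilon>"
  proof eventually_elim
    case (elim c)
    have "C (card S) * dcov_stat d (fst c) S (ranks d h (fst c) (snd c)) \<le> RJdCov2 r d h C (fst c) (snd c)"
      unfolding RJdCov2_eq_ranks using C less_imp_le by (intro dcov_stat_le_rank_stat S) blast
    then have "C (card S) * dcov_stat d (fst c) S (ranks d h (fst c) (snd c)) < C (card S) * \<eta>"
      using elim by linarith
    then have "dcov_stat d (fst c) S (ranks d h (fst c) (snd c)) < \<eta>"
      using Cs by (simp only: mult_less_cancel_left_pos)
    then have "cmod (dcov_char d (fst c) S (ranks d h (fst c) (snd c)) t) < \<epsilon>"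
      using S by (intro \<eta>(2) ranks_in_cube) auto
    then show ?case by simp
  qed
qed

text \<open>No probability is involved: the filter lives on pairs of a sample size and a sample.
  Each \<open>f i\<close> of the data is replaced by a tent combination of the ranks, at the cost of
  \<open>\<kappa>\<close> plus the fraction of large observations, and products of tents of the
  ranks have vanishing gaps.\<close>

lemma eventually_prod_gap_le:
  fixes f :: "nat \<Rightarrow> vec \<Rightarrow> real" and F :: "(nat \<times> (nat \<Rightarrow> nat \<Rightarrow> vec)) filter"
  assumes n: "filterlim fst at_top F"
    and RJ: "((\<lambda>c. RJdCov2 r d h C (fst c) (snd c)) \<longlongrightarrow> 0) F"
    and f: "\<And>i y. 0 \<le> f i y \<and> f i y \<le> 1"
    and lip: "\<And>i y z. \<bar>f i y - f i z\<bar> \<le> real \<Lambda> * (\<Sum>j=1..d i. \<bar>y j - z j\<bar>)"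
    and K: "0 \<le> K" and \<kappa>: "0 < \<kappa>"
  shows "\<forall>\<^sub>F c in F. \<bar>prod_gap (fst c) {1..r} (\<lambda>i a. f i (snd c a i))\<bar>
    \<le> \<kappa> + 2 * (\<Sum>i=1..r. \<kappa> + real (card {a\<in>{1..fst c}. \<exists>j\<in>{1..d i}. K < \<bar>snd c a i j\<bar>}) / real (fst c))"
proof -
  let ?I = "{1..r}"
  define bad where "bad = (\<lambda>n X i. real (card {a\<in>{1..n}. \<exists>j\<in>{1..d i}. K < \<bar>X a i j\<bar>}) / real n)"
  \<comment> \<open>The approximation property is stated for each block and mesh, so that a mesh can
    be chosen for each block before any sample is considered.\<close>
  define approx where "approx = (\<lambda>i m. \<forall>n u x. 1 \<le> n \<longrightarrow> (\<forall>a\<in>{1..n}. u a \<in> unit_cube (d i)) \<longrightarrow>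
      (\<forall>a\<in>{1..n}. \<forall>b\<in>{1..n}. 0 \<le> (\<Sum>j=1..d i. (x a j - x b j) * (u a j - u b j))) \<longrightarrow>
      (\<forall>k\<in>cells (d i) m. (\<Sum>a=1..n. tent (d i) m k (u a)) / real n \<le> 2 * (2 / real m) ^ d i) \<longrightarrow>
      (\<exists>g. (\<forall>k. 0 \<le> g k \<and> g k \<le> (1::real)) \<and>
        (\<Sum>a=1..n. \<bar>f i (x a) - (\<Sum>k\<in>cells (d i) m. g k * tent (d i) m k (u a))\<bar>) / real n
          \<le> \<kappa> + real (card {a\<in>{1..n}. \<exists>j\<in>{1..d i}. K < \<bar>x a j\<bar>}) / real n))"
  have "\<exists>m\<ge>1. approx i m" if i: "i \<in> ?I" for i
  proof -
    have \<Lambda>: "0 \<le> real \<Lambda>" by simp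
    obtain m where "1 \<le> m" and *: "\<And>n u x f. 1 \<le> n \<Longrightarrow> (\<And>a. a \<in> {1..n} \<Longrightarrow> u a \<in> unit_cube (d i)) \<Longrightarrow>
      (\<And>a b. a \<in> {1..n} \<Longrightarrow> b \<in> {1..n} \<Longrightarrow> 0 \<le> (\<Sum>j=1..d i. (x a j - x b j) * (u a j - u b j))) \<Longrightarrow>
      (\<And>y. 0 \<le> f y \<and> f y \<le> 1) \<Longrightarrow>
      (\<And>y z. \<bar>f y - f z\<bar> \<le> real \<Lambda> * (\<Sum>j=1..d i. \<bar>y j - z j\<bar>)) \<Longrightarrow>
      (\<And>k. k \<in> cells (d i) m \<Longrightarrow> (\<Sum>a=1..n. tent (d i) m k (u a)) / real n \<le> 2 * (2 / real m) ^ d i) \<Longrightarrow>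
      \<exists>g. (\<forall>k. 0 \<le> g k \<and> g k \<le> (1::real)) \<and>
        (\<Sum>a=1..n. \<bar>f (x a) - (\<Sum>k\<in>cells (d i) m. g k * tent (d i) m k (u a))\<bar>) / real n
          \<le> \<kappa> + real (card {a\<in>{1..n}. \<exists>j\<in>{1..d i}. K < \<bar>x a j\<bar>}) / real n"
      using block_approx[OF d[OF i] \<kappa> K \<Lambda>] by blast
    have "approx i m"
      unfolding approx_def by (intro allI impI *[where f="f i"]) (use f lip in blast)+
    then show ?thesis using \<open>1 \<le> m\<close> by blast
  qed
  then obtain m where m: "\<And>i. i \<in> ?I \<Longrightarrow> 1 \<le> m i" "\<And>i. i \<in> ?I \<Longrightarrow> approx i (m i)" by metis
  let ?G = "\<lambda>c. \<Sum>k\<in>PiE ?I (\<lambda>i. cells (d i) (m i)). cmod (joint_gap (fst c) ?I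
      (\<lambda>i v. complex_of_real (tent (d i) (m i) (k i) v)) (ranks d h (fst c) (snd c)))"
  have n1: "\<forall>\<^sub>F c in F. 1 \<le> fst c"
    using n eventually_ge_at_top[of "1::nat"] by (simp add: filterlim_iff)
  have "(?G \<longlongrightarrow> 0) F"
  proof (intro tendsto_null_sum tendsto_norm_zero joint_gap_tendsto_trig_limit[where N=fst and d=d])
    show "ranks d h (fst c) (snd c) i a \<in> unit_cube (d i)" if "i \<in> ?I" "a \<in> {1..fst c}" for c i a
      using that by (rule ranks_in_cube)
    show "((\<lambda>c. dcov_char d (fst c) S (ranks d h (fst c) (snd c)) t) \<longlongrightarrow> 0) F"
      if "S \<subseteq> ?I" "2 \<le> card S" for S t
      by (rule dcov_char_ranks_tendsto[OF RJ that])
    show "\<forall>\<^sub>F c in F. 1 \<le> fst c" by (rule n1)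
  qed (simp_all add: trig_limit_tent)
  then have G: "\<forall>\<^sub>F c in F. ?G c < \<kappa>" using \<kappa> by (rule order_tendstoD(2))
  have "\<forall>\<^sub>F n in sequentially. \<forall>i\<in>?I. \<forall>k\<in>cells (d i) (m i).
      (\<Sum>a=1..n. tent (d i) (m i) k (h (d i) n a)) / real n \<le> 2 * (2 / real (m i)) ^ d i"
    using m(1) h grid by (intro eventually_ball_finite ballI eventually_grid_tents_le) auto
  then have "\<forall>\<^sub>F c in F. \<forall>i\<in>?I. \<forall>k\<in>cells (d i) (m i).
      (\<Sum>a=1..fst c. tent (d i) (m i) k (h (d i) (fst c) a)) / real (fst c) \<le> 2 * (2 / real (m i)) ^ d i"
    using n by (rule eventually_compose_filterlim)
  then show ?thesis
    using n1 G
  proof eventually_elim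
    case (elim c)
    obtain n X where c: "c = (n, X)" by (cases c)
    let ?u = "ranks d h n X"
    have n: "1 \<le> n" and G: "?G (n, X) < \<kappa>" using elim c by simp_all
    have "\<exists>g. (\<forall>k. 0 \<le> g k \<and> g k \<le> (1::real)) \<and>
        (\<Sum>a=1..n. \<bar>f i (X a i) - (\<Sum>k\<in>cells (d i) (m i). g k * tent (d i) (m i) k (?u i a))\<bar>) / real n
          \<le> \<kappa> + bad n X i" if i: "i \<in> ?I" for i
    proof -
      have cube: "\<forall>a\<in>{1..n}. ?u i a \<in> unit_cube (d i)" using ranks_in_cube[OF i] by blast
      have mono: "\<forall>a\<in>{1..n}. \<forall>b\<in>{1..n}. 0 \<le> (\<Sum>j=1..d i. (X a i j - X b i j) * (?u i a j - ?u i b j))"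
        unfolding ranks_def by (intro ballI matchings_monotone[OF opt_perm_in_matchings])
      have unif: "\<forall>k\<in>cells (d i) (m i). (\<Sum>a=1..n. tent (d i) (m i) k (?u i a)) / real n \<le> 2 * (2 / real (m i)) ^ d i"
      proof
        fix k assume k: "k \<in> cells (d i) (m i)"
        \<comment> \<open>The ranks are a rearrangement of the grid, so the uniformity of the grid
          is inherited whatever the data.\<close>
        have "(\<Sum>a=1..n. tent (d i) (m i) k (?u i a)) = (\<Sum>a=1..n. tent (d i) (m i) k (h (d i) n a))"
          unfolding ranks_def by (rule sum_perms[OF opt_perm_in_perms])
        then show "(\<Sum>a=1..n. tent (d i) (m i) k (?u i a)) / real n \<le> 2 * (2 / real (m i)) ^ d i"
          using elim(1) i k c by simp
      qed
      show ?thesis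
        unfolding bad_def
        by (rule m(2)[OF i, unfolded approx_def, THEN spec[where x=n], THEN spec[where x="?u i"],
              THEN spec[where x="\<lambda>a. X a i"], THEN mp, OF n, THEN mp, OF cube, THEN mp, OF mono, THEN mp, OF unif])
    qed
    then have "\<forall>i\<in>?I. \<exists>g. (\<forall>k. 0 \<le> g k \<and> g k \<le> (1::real)) \<and>
        (\<Sum>a=1..n. \<bar>f i (X a i) - (\<Sum>k\<in>cells (d i) (m i). g k * tent (d i) (m i) k (?u i a))\<bar>) / real n
          \<le> \<kappa> + bad n X i" by (rule ballI)
    from bchoice[OF this] obtain gc where gc': "\<forall>i\<in>?I. (\<forall>k. 0 \<le> gc i k \<and> gc i k \<le> (1::real)) \<and>
        (\<Sum>a=1..n. \<bar>f i (X a i) - (\<Sum>k\<in>cells (d i) (m i). gc i k * tent (d i) (m i) k (?u i a))\<bar>) / real n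
          \<le> \<kappa> + bad n X i" by (rule exE)
    have gc: "0 \<le> gc i k \<and> gc i k \<le> (1::real)" if "i \<in> ?I" for i k
      using bspec[OF gc' that, THEN conjunct1] by (rule spec)
    note gc_le = bspec[OF gc', THEN conjunct2]
    define w where "w = (\<lambda>i a. \<Sum>k\<in>cells (d i) (m i). gc i k * tent (d i) (m i) k (?u i a))"
    have w: "0 \<le> w i a \<and> w i a \<le> 1" if "i \<in> ?I" "a \<in> {1..n}" for i a
      unfolding w_def using that by (intro tent_combination_bounds ranks_in_cube gc)
    have "\<bar>prod_gap n ?I (\<lambda>i a. f i (X a i)) - prod_gap n ?I w\<bar>
        \<le> 2 * (\<Sum>i\<in>?I. avg n (\<lambda>a. \<bar>f i (X a i) - w i a\<bar>))"
      by (rule prod_gap_close) (use f w in auto)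
    also have "\<dots> \<le> 2 * (\<Sum>i=1..r. \<kappa> + bad n X i)"
      unfolding avg_def w_def of_nat_id by (intro mult_left_mono sum_mono gc_le) simp_all
    finally have close: "\<bar>prod_gap n ?I (\<lambda>i a. f i (X a i)) - prod_gap n ?I w\<bar> \<le> 2 * (\<Sum>i=1..r. \<kappa> + bad n X i)" .
    have "\<bar>prod_gap n ?I w\<bar> \<le> ?G (n, X)"
      unfolding w_def fst_conv snd_conv by (rule prod_gap_tents_le) (use gc in auto)
    then have "\<bar>prod_gap n ?I (\<lambda>i a. f i (X a i))\<bar> \<le> \<kappa> + 2 * (\<Sum>i=1..r. \<kappa> + bad n X i)"
      using close G by linarith
    then show ?case by (simp add: c bad_def)
  qed
qed

end

section \<open>Lower bound for the statistic under dependence\<close>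

lemma exists_gap_if_dependent:
  assumes r: "1 \<le> r" and \<mu>: "prob_space \<mu>" "sets \<mu> = sets (leb_blocks r d)"
    and dep: "\<mu> \<noteq> joint_indep r (marginal d \<mu>)"
  obtains f :: "nat \<Rightarrow> vec \<Rightarrow> real" and \<Lambda> :: nat where "\<And>i y. 0 \<le> f i y \<and> f i y \<le> 1"
    and "\<And>i y z. \<bar>f i y - f i z\<bar> \<le> real \<Lambda> * (\<Sum>j=1..d i. \<bar>y j - z j\<bar>)"
    and "\<And>i. f i \<in> borel_measurable (leb (d i))"
    and "(\<integral>x. (\<Prod>i=1..r. f i (x i)) \<partial>\<mu>) \<noteq> (\<Prod>i=1..r. \<integral>x. f i (x i) \<partial>\<mu>)"
proof -
  have "\<exists>f \<Lambda>. (\<forall>i y. 0 \<le> f i y \<and> f i y \<le> (1::real)) \<and>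
      (\<forall>i y z. \<bar>f i y - f i z\<bar> \<le> real \<Lambda> * (\<Sum>j=1..d i. \<bar>y j - z j\<bar>)) \<and>
      (\<forall>i. f i \<in> borel_measurable (leb (d i))) \<and>
      (\<integral>x. (\<Prod>i=1..r. f i (x i)) \<partial>\<mu>) \<noteq> (\<Prod>i=1..r. \<integral>x. f i (x i) \<partial>\<mu>)"
  proof (rule ccontr)
    assume no: "\<not> ?thesis"
    have "\<mu> = joint_indep r (marginal d \<mu>)"
      by (rule eq_joint_indep_if_factorizes[OF r \<mu>]) (use no in blast)
    then show False using dep by contradiction
  qed
  then show thesis using that by blast
qed

lemma tail_prob_tendsto_0:
  assumes \<mu>: "prob_space \<mu>" "sets \<mu> = sets (leb_blocks r d)" and i: "i \<in> {1..r}"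
  shows "(\<lambda>m. \<integral>x. of_bool (\<exists>j\<in>{1..d i}. real m < \<bar>x i j\<bar>) \<partial>\<mu>) \<longlonglongrightarrow> (0::real)"
proof -
  interpret prob_space \<mu> by fact
  have [measurable]: "(\<lambda>x. x i) \<in> measurable \<mu> (leb (d i))"
    using measurable_block[OF i, of d] by (simp add: measurable_cong_sets[OF \<mu>(2) refl])
  have meas: "(\<lambda>x. of_bool (\<exists>j\<in>{1..d i}. real m < \<bar>x i j\<bar>) :: real) \<in> borel_measurable \<mu>" for m
  proof (rule measurable_compose[where g="\<lambda>v. of_bool (\<exists>j\<in>{1..d i}. real m < \<bar>v j\<bar>)" and N="leb (d i)"])
    show "(\<lambda>v. of_bool (\<exists>j\<in>{1..d i}. real m < \<bar>v j\<bar>) :: real) \<in> borel_measurable (leb (d i))"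
      unfolding of_bool_def by measurable
  qed measurable
  have lim: "(\<lambda>m. of_bool (\<exists>j\<in>{1..d i}. real m < \<bar>x i j\<bar>) :: real) \<longlonglongrightarrow> 0" for x :: "nat \<Rightarrow> vec"
  proof -
    obtain m0 :: nat where m0: "(\<Sum>j=1..d i. \<bar>x i j\<bar>) \<le> real m0" using real_arch_simple by blast
    have "of_bool (\<exists>j\<in>{1..d i}. real m < \<bar>x i j\<bar>) = (0::real)" if "m0 \<le> m" for m
    proof -
      have "\<bar>x i j\<bar> \<le> real m" if "j \<in> {1..d i}" for j
      proof -
        have "\<bar>x i j\<bar> \<le> (\<Sum>j=1..d i. \<bar>x i j\<bar>)" using that by (intro member_le_sum) auto
        then show ?thesis using m0 \<open>m0 \<le> m\<close> by linarith
      qed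
      then show ?thesis by (auto simp: not_less)
    qed
    then have "\<forall>\<^sub>F m in sequentially. of_bool (\<exists>j\<in>{1..d i}. real m < \<bar>x i j\<bar>) = (0::real)"
      by (rule eventually_sequentiallyI)
    then show ?thesis by (rule tendsto_eventually)
  qed
  have "(\<lambda>m. \<integral>x. of_bool (\<exists>j\<in>{1..d i}. real m < \<bar>x i j\<bar>) \<partial>\<mu>) \<longlonglongrightarrow> (\<integral>x. 0 \<partial>\<mu> :: real)"
  proof (rule integral_dominated_convergence[where w="\<lambda>_. 1"])
    show "(\<lambda>x. of_bool (\<exists>j\<in>{1..d i}. real m < \<bar>x i j\<bar>) :: real) \<in> borel_measurable \<mu>" for m by (rule meas)
    show "AE x in \<mu>. (\<lambda>m. of_bool (\<exists>j\<in>{1..d i}. real m < \<bar>x i j\<bar>) :: real) \<longlonglongrightarrow> 0"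
      by (rule AE_I2) (rule lim)
  qed simp_all
  then show ?thesis by simp
qed

context grids begin

lemma RJdCov2_nonneg: "0 \<le> RJdCov2 r d h C n X"
  unfolding RJdCov2_eq_ranks using C less_imp_le by (intro rank_stat_nonneg) blast

text \<open>Converts the asymptotic statement along a filter into explicit thresholds that hold for
  all samples at once.\<close>

lemma uniform_prod_gap_le:
  fixes f :: "nat \<Rightarrow> vec \<Rightarrow> real"
  assumes f: "\<And>i y. 0 \<le> f i y \<and> f i y \<le> 1"
    and lip: "\<And>i y z. \<bar>f i y - f i z\<bar> \<le> real \<Lambda> * (\<Sum>j=1..d i. \<bar>y j - z j\<bar>)"
    and K: "0 \<le> K" and \<kappa>: "0 < \<kappa>"
  obtains \<eta> N where "0 < \<eta>"
    and "\<And>n X. N \<le> n \<Longrightarrow> RJdCov2 r d h C n X < \<eta> \<Longrightarrow>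
      \<bar>prod_gap n {1..r} (\<lambda>i a. f i (X a i))\<bar>
        \<le> \<kappa> + 2 * (\<Sum>i=1..r. \<kappa> + avg n (\<lambda>a. of_bool (\<exists>j\<in>{1..d i}. K < \<bar>X a i j\<bar>)))"
proof -
  define \<phi> where "\<phi> = (\<lambda>c. (fst c, RJdCov2 r d h C (fst c) (snd c)))"
  \<comment> \<open>The pullback of the product filter makes the sample size tend to infinity and
    the statistic to 0, and its eventual statements unpack into a bound \<open>N\<close> and a
    radius \<open>\<eta>\<close>.\<close>
  define F where "F = filtercomap \<phi> (at_top \<times>\<^sub>F nhds 0)"
  have \<phi>: "filterlim \<phi> (at_top \<times>\<^sub>F nhds 0) F" unfolding F_def by (rule filterlim_filtercomap)
  have n: "filterlim fst at_top F"
    using filterlim_compose[OF filterlim_fst \<phi>] by (simp add: \<phi>_def)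
  have RJ: "((\<lambda>c. RJdCov2 r d h C (fst c) (snd c)) \<longlongrightarrow> 0) F"
    using filterlim_compose[OF filterlim_snd \<phi>] by (simp add: \<phi>_def)
  have card_eq: "real (card {a\<in>{1..n}. \<exists>j\<in>{1..d i}. K < \<bar>X a i j\<bar>}) / real n
      = avg n (\<lambda>a. of_bool (\<exists>j\<in>{1..d i}. K < \<bar>X a i j\<bar>))" for n i and X :: "nat \<Rightarrow> nat \<Rightarrow> vec"
    by (simp add: avg_def of_bool_def sum.If_cases Int_def)
  from eventually_prod_gap_le[OF n RJ f lip K \<kappa>]
  obtain Q where Q: "eventually Q (at_top \<times>\<^sub>F nhds 0)"
    and bound: "\<And>c. Q (\<phi> c) \<Longrightarrow> \<bar>prod_gap (fst c) {1..r} (\<lambda>i a. f i (snd c a i))\<bar>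
      \<le> \<kappa> + 2 * (\<Sum>i=1..r. \<kappa> + avg (fst c) (\<lambda>a. of_bool (\<exists>j\<in>{1..d i}. K < \<bar>snd c a i j\<bar>)))"
    unfolding F_def eventually_filtercomap card_eq by blast
  obtain P1 P2 where P: "eventually P1 at_top" "eventually P2 (nhds (0::real))"
    "\<And>n x. P1 n \<Longrightarrow> P2 x \<Longrightarrow> Q (n, x)"
    using Q unfolding eventually_prod_filter by blast
  obtain N where N: "\<And>n. N \<le> n \<Longrightarrow> P1 n" using P(1) unfolding eventually_at_top_linorder by blast
  obtain \<eta> where \<eta>: "0 < \<eta>" "\<And>x. dist x 0 < \<eta> \<Longrightarrow> P2 x" using P(2) unfolding eventually_nhds_metric by blast
  show thesis
  proof (rule that[OF \<eta>(1)])
    fix n X assume "N \<le> n" "RJdCov2 r d h C n X < \<eta>"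
    then have "Q (\<phi> (n, X))" unfolding \<phi>_def using N \<eta>(2) P(3) RJdCov2_nonneg[of n X] by simp
    from bound[OF this] show "\<bar>prod_gap n {1..r} (\<lambda>i a. f i (X a i))\<bar>
        \<le> \<kappa> + 2 * (\<Sum>i=1..r. \<kappa> + avg n (\<lambda>a. of_bool (\<exists>j\<in>{1..d i}. K < \<bar>X a i j\<bar>)))"
      by (simp only: fst_conv snd_conv)
  qed
qed

text \<open>A small statistic forces a small empirical gap, while the population gap
  \<open>\<gamma>\<close> is fixed. Both can hold only if one of finitely many averages is at least
  \<open>\<kappa>\<close> away from its mean, which has vanishing probability.\<close>

lemma RJdCov2_bounded_away:
  assumes r: "1 \<le> r" and \<mu>: "prob_space \<mu>" "sets \<mu> = sets (leb_blocks r d)"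
    and dep: "\<mu> \<noteq> joint_indep r (marginal d \<mu>)"
  obtains \<eta> where "0 < \<eta>"
    and "(\<lambda>n. measure (iid_sample n \<mu>) {X \<in> space (iid_sample n \<mu>). RJdCov2 r d h C n X < \<eta>}) \<longlonglongrightarrow> 0"
proof -
  interpret M: prob_space \<mu> by fact
  obtain f \<Lambda> where f: "\<And>i y. 0 \<le> f i y \<and> f i y \<le> 1"
    and lip: "\<And>i y z. \<bar>f i y - f i z\<bar> \<le> real \<Lambda> * (\<Sum>j=1..d i. \<bar>y j - z j\<bar>)"
    and f_meas: "\<And>i. f i \<in> borel_measurable (leb (d i))"
    and gap: "(\<integral>x. (\<Prod>i=1..r. f i (x i)) \<partial>\<mu>) \<noteq> (\<Prod>i=1..r. \<integral>x. f i (x i) \<partial>\<mu>)"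
    using exists_gap_if_dependent[OF r \<mu> dep] by blast
  define \<gamma> where "\<gamma> = \<bar>(\<integral>x. (\<Prod>i=1..r. f i (x i)) \<partial>\<mu>) - (\<Prod>i=1..r. \<integral>x. f i (x i) \<partial>\<mu>)\<bar>"
  \<comment> \<open>The errors add up to \<open>(7 * r + 2) * \<kappa>\<close>: the empirical gap
    costs \<open>\<kappa>\<close> and, per block, twice \<open>\<kappa>\<close> plus a tail average
    of at most \<open>2 * \<kappa>\<close>; the mean of the product costs \<open>\<kappa>\<close>,
    and the \<open>r\<close> separate means \<open>\<kappa>\<close> each. The remaining
    \<open>\<kappa>\<close> makes the contradiction strict.\<close>
  define \<kappa> where "\<kappa> = \<gamma> / (7 * real r + 3)"
  have \<gamma>: "0 < \<gamma>" using gap by (simp add: \<gamma>_def)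
  then have \<kappa>: "0 < \<kappa>" by (simp add: \<kappa>_def)
  have \<gamma>_eq: "\<gamma> = (7 * real r + 3) * \<kappa>" by (simp add: \<kappa>_def)
  have "\<forall>\<^sub>F m in sequentially. \<forall>i\<in>{1..r}. (\<integral>x. of_bool (\<exists>j\<in>{1..d i}. real m < \<bar>x i j\<bar>) \<partial>\<mu>) < \<kappa>"
    using tail_prob_tendsto_0[OF \<mu>] \<kappa>
    by (intro eventually_ball_finite ballI order_tendstoD(2)[where y=0]) auto
  then obtain m where m: "\<And>i. i \<in> {1..r} \<Longrightarrow> (\<integral>x. of_bool (\<exists>j\<in>{1..d i}. real m < \<bar>x i j\<bar>) \<partial>\<mu>) < \<kappa>"
    using eventually_happens'[OF sequentially_bot] by blast
  obtain \<eta> N where \<eta>: "0 < \<eta>" and bound: "\<And>n X. N \<le> n \<Longrightarrow> RJdCov2 r d h C n X < \<eta> \<Longrightarrow>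
      \<bar>prod_gap n {1..r} (\<lambda>i a. f i (X a i))\<bar>
        \<le> \<kappa> + 2 * (\<Sum>i=1..r. \<kappa> + avg n (\<lambda>a. of_bool (\<exists>j\<in>{1..d i}. real m < \<bar>X a i j\<bar>)))"
    using uniform_prod_gap_le[where f=f and \<Lambda>=\<Lambda> and K="real m" and \<kappa>=\<kappa>, OF f lip _ \<kappa>] by auto
  \<comment> \<open>All averages to be controlled form one family: tag 0 for the full product, 1 for
    the single factors, 2 for the tails. A single union bound over \<open>Q\<close> then covers
    them.\<close>
  define \<phi> :: "nat \<times> nat \<Rightarrow> (nat \<Rightarrow> vec) \<Rightarrow> real" where "\<phi> = (\<lambda>(s, i) x.
      if s = 0 then \<Prod>i=1..r. f i (x i) else if s = 1 then f i (x i)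
      else of_bool (\<exists>j\<in>{1..d i}. real m < \<bar>x i j\<bar>))"
  have \<phi>_0: "\<phi> (0, 0) = (\<lambda>x. \<Prod>i=1..r. f i (x i))"
    and \<phi>_1: "\<phi> (1, i) = (\<lambda>x. f i (x i))"
    and \<phi>_2: "\<phi> (2, i) = (\<lambda>x. of_bool (\<exists>j\<in>{1..d i}. real m < \<bar>x i j\<bar>))" for i
    by (simp_all add: \<phi>_def)
  define Q :: "(nat \<times> nat) set" where "Q = insert (0, 0) ({1, 2} \<times> {1..r})"
  have block: "(\<lambda>x. x i) \<in> measurable \<mu> (leb (d i))" if "i \<in> {1..r}" for i
    using measurable_block[OF that, of d] by (simp add: measurable_cong_sets[OF \<mu>(2) refl])
  have f_block: "(\<lambda>x. f i (x i)) \<in> borel_measurable \<mu>" if "i \<in> {1..r}" for i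
    by (rule measurable_compose[OF block[OF that] f_meas])
  have tail: "(\<lambda>x. of_bool (\<exists>j\<in>{1..d i}. real m < \<bar>x i j\<bar>) :: real) \<in> borel_measurable \<mu>" if "i \<in> {1..r}" for i
  proof (rule measurable_compose[OF block[OF that], where g="\<lambda>v. of_bool (\<exists>j\<in>{1..d i}. real m < \<bar>v j\<bar>)"])
    show "(\<lambda>v. of_bool (\<exists>j\<in>{1..d i}. real m < \<bar>v j\<bar>) :: real) \<in> borel_measurable (leb (d i))"
      unfolding of_bool_def by measurable
  qed
  have \<phi>_meas: "\<phi> q \<in> borel_measurable \<mu>" if q: "q \<in> Q" for q
  proof -
    consider "q = (0, 0)" | i where "q = (1, i)" "i \<in> {1..r}" | i where "q = (2, i)" "i \<in> {1..r}"
      using q unfolding Q_def by blast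
    then show ?thesis
    proof cases
      case 1
      have "(\<lambda>x. \<Prod>i=1..r. f i (x i)) \<in> borel_measurable \<mu>"
        by (rule borel_measurable_prod) (rule f_block)
      then show ?thesis unfolding 1 \<phi>_0 .
    next
      case (2 i)
      show ?thesis unfolding 2(1) \<phi>_1 by (rule f_block[OF 2(2)])
    next
      case (3 i)
      show ?thesis unfolding 3(1) \<phi>_2 by (rule tail[OF 3(2)])
    qed
  qed
  have \<phi>_bd: "0 \<le> \<phi> q x \<and> \<phi> q x \<le> 1" for q x
  proof -
    have "0 \<le> (\<Prod>i=1..r. f i (x i))" "(\<Prod>i=1..r. f i (x i)) \<le> 1"
      using f by (auto intro!: prod_nonneg prod_le_1)
    then show ?thesis using f[of "snd q" "x (snd q)"] by (simp add: \<phi>_def split_beta)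
  qed
  define A where "A = (\<lambda>n q. {X \<in> space (iid_sample n \<mu>). \<kappa> \<le> \<bar>avg n (\<lambda>a. \<phi> q (X a)) - (\<integral>x. \<phi> q x \<partial>\<mu>)\<bar>})"
  have A_meas: "A n q \<in> sets (iid_sample n \<mu>)" if q: "q \<in> Q" for n q
  proof -
    have "(\<lambda>X. \<phi> q (X a)) \<in> borel_measurable (iid_sample n \<mu>)" if "a \<in> {1..n}" for a
      unfolding iid_sample_def
      by (rule measurable_compose[OF measurable_component_singleton[where M="\<lambda>_. \<mu>", OF that] \<phi>_meas[OF q]])
    then show ?thesis unfolding A_def avg_def by measurable
  qed
  have sub: "{X \<in> space (iid_sample n \<mu>). RJdCov2 r d h C n X < \<eta>} \<subseteq> (\<Union>q\<in>Q. A n q)" if n: "N \<le> n" for n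
  proof (rule subsetI, rule ccontr)
    fix X assume X: "X \<in> {X \<in> space (iid_sample n \<mu>). RJdCov2 r d h C n X < \<eta>}" and "X \<notin> (\<Union>q\<in>Q. A n q)"
    then have small: "\<bar>avg n (\<lambda>a. \<phi> q (X a)) - (\<integral>x. \<phi> q x \<partial>\<mu>)\<bar> < \<kappa>" if "q \<in> Q" for q
      using that by (auto simp: A_def not_le)
    have "(0, 0) \<in> Q" by (simp add: Q_def)
    from small[OF this] have s0: "\<bar>avg n (\<lambda>a. \<Prod>i=1..r. f i (X a i)) - (\<integral>x. (\<Prod>i=1..r. f i (x i)) \<partial>\<mu>)\<bar> < \<kappa>"
      by (simp only: \<phi>_0)
    have s1: "\<bar>avg n (\<lambda>a. f i (X a i)) - (\<integral>x. f i (x i) \<partial>\<mu>)\<bar> < \<kappa>" if "i \<in> {1..r}" for i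
    proof -
      have "(1, i) \<in> Q" using that by (simp add: Q_def)
      from small[OF this] show ?thesis by (simp only: \<phi>_1)
    qed
    have s2: "avg n (\<lambda>a. of_bool (\<exists>j\<in>{1..d i}. real m < \<bar>X a i j\<bar>)) \<le> 2 * \<kappa>" if "i \<in> {1..r}" for i
    proof -
      have "(2, i) \<in> Q" using that by (simp add: Q_def)
      from small[OF this] show ?thesis using m[OF that] unfolding \<phi>_2 by linarith
    qed
    have bd_int: "0 \<le> (\<integral>x. f i (x i) \<partial>\<mu>) \<and> (\<integral>x. f i (x i) \<partial>\<mu>) \<le> 1" if "i \<in> {1..r}" for i
    proof -
      have "integrable \<mu> (\<lambda>x. f i (x i))"
        using f by (intro M.integrable_const_bound[where B=1] f_block that) auto
      then have "(\<integral>x. f i (x i) \<partial>\<mu>) \<le> (\<integral>x. 1 \<partial>\<mu>)" using f by (intro integral_mono) auto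
      then show ?thesis using f by (simp add: M.prob_space)
    qed
    have "\<bar>(\<Prod>i=1..r. avg n (\<lambda>a. f i (X a i))) - (\<Prod>i=1..r. \<integral>x. f i (x i) \<partial>\<mu>)\<bar>
        \<le> (\<Sum>i=1..r. \<bar>avg n (\<lambda>a. f i (X a i)) - (\<integral>x. f i (x i) \<partial>\<mu>)\<bar>)"
      using f bd_int by (intro abs_prod_diff_le avg_bounds) auto
    also have "\<dots> \<le> (\<Sum>i=1..r. \<kappa>)" using s1 by (intro sum_mono less_imp_le)
    finally have s3: "\<bar>(\<Prod>i=1..r. avg n (\<lambda>a. f i (X a i))) - (\<Prod>i=1..r. \<integral>x. f i (x i) \<partial>\<mu>)\<bar> \<le> real r * \<kappa>"
      by simp
    have "(\<Sum>i=1..r. \<kappa> + avg n (\<lambda>a. of_bool (\<exists>j\<in>{1..d i}. real m < \<bar>X a i j\<bar>))) \<le> (\<Sum>i=1..r. \<kappa> + 2 * \<kappa>)"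
      using s2 by (intro sum_mono add_left_mono)
    then have "\<bar>prod_gap n {1..r} (\<lambda>i a. f i (X a i))\<bar> \<le> \<kappa> + 2 * (real r * (3 * \<kappa>))"
      using bound[OF n, of X] X by simp
    then have "\<gamma> \<le> (\<kappa> + 2 * (real r * (3 * \<kappa>))) + \<kappa> + real r * \<kappa>"
      using s0 s3 unfolding \<gamma>_def prod_gap_def by linarith
    then have "(7 * real r + 3) * \<kappa> \<le> (7 * real r + 2) * \<kappa>" unfolding \<gamma>_eq by (simp add: algebra_simps)
    then show False using \<kappa> by simp
  qed
  have "(\<lambda>n. measure (iid_sample n \<mu>) {X \<in> space (iid_sample n \<mu>). RJdCov2 r d h C n X < \<eta>}) \<longlonglongrightarrow> 0"
  proof (rule Lim_null_comparison)
    show "(\<lambda>n. \<Sum>q\<in>Q. measure (iid_sample n \<mu>) (A n q)) \<longlonglongrightarrow> 0"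
      unfolding A_def using \<phi>_meas \<phi>_bd \<kappa> by (intro tendsto_null_sum avg_iid_concentrates \<mu>(1)) auto
    show "\<forall>\<^sub>F n in sequentially. norm (measure (iid_sample n \<mu>)
        {X \<in> space (iid_sample n \<mu>). RJdCov2 r d h C n X < \<eta>}) \<le> (\<Sum>q\<in>Q. measure (iid_sample n \<mu>) (A n q))"
    proof (rule eventually_sequentiallyI[of N])
      fix n assume n: "N \<le> n"
      interpret P: prob_space "iid_sample n \<mu>" by (rule prob_space_iid_sample[OF \<mu>(1)])
      have finQ: "finite Q" by (simp add: Q_def)
      have "P.prob {X \<in> space (iid_sample n \<mu>). RJdCov2 r d h C n X < \<eta>} \<le> P.prob (\<Union>q\<in>Q. A n q)"
        using A_meas finQ by (intro P.finite_measure_mono sub n sets.finite_UN) auto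
      also have "\<dots> \<le> (\<Sum>q\<in>Q. P.prob (A n q))"
        using A_meas finQ by (intro P.finite_measure_subadditive_finite) auto
      finally show "norm (P.prob {X \<in> space (iid_sample n \<mu>). RJdCov2 r d h C n X < \<eta>})
          \<le> (\<Sum>q\<in>Q. P.prob (A n q))" by simp
    qed
  qed
  then show thesis by (rule that[OF \<eta>])
qed

end

theorem proposition3p2:
  fixes r :: nat and d :: "nat \<Rightarrow> nat"
    and h :: "nat \<Rightarrow> nat \<Rightarrow> nat \<Rightarrow> vec"
    and C :: "nat \<Rightarrow> real" and \<alpha> :: real
    and \<mu> :: "(nat \<Rightarrow> vec) measure" and \<nu> :: "nat \<Rightarrow> vec measure"
  assumes "2 \<le> r"
    and "\<And>i. i \<in> {1..r} \<Longrightarrow> 1 \<le> d i"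
    and "\<And>i n a. i \<in> {1..r} \<Longrightarrow> a \<in> {1..n} \<Longrightarrow> h (d i) n a \<in> unit_cube (d i)"
    and "\<And>i. i \<in> {1..r} \<Longrightarrow>
           weak_conv_vec (d i) (\<lambda>n. grid_measure (d i) n (h (d i) n))
             (uniform_measure (leb (d i)) (unit_cube (d i)))"
    and "\<And>s. s \<in> {2..r} \<Longrightarrow> 0 < C s"
    and "0 < \<alpha>" and "\<alpha> < 1"
    and "ac_prob (leb_blocks r d) \<mu>"
    and "\<And>i. i \<in> {1..r} \<Longrightarrow> ac_prob (leb (d i)) (marginal d \<mu> i)"
    and "\<And>i. i \<in> {1..r} \<Longrightarrow> ac_prob (leb (d i)) (\<nu> i)"
    and "\<mu> \<noteq> joint_indep r (marginal d \<mu>)"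
  shows "(\<forall>n \<nu>'. (\<forall>i\<in>{1..r}. ac_prob (leb (d i)) (\<nu>' i)) \<longrightarrow>
             null_law r d h C n \<nu>' = null_law r d h C n \<nu>) \<and>
         (\<lambda>n. \<integral>X. indep_test r d h C \<alpha> \<nu> n X \<partial>iid_sample n \<mu>) \<longlonglongrightarrow> 1"
proof
  have \<nu>: "ac_marginals r d \<nu>" using assms(1,10) by (intro ac_marginals.intro) auto
  show "\<forall>n \<nu>'. (\<forall>i\<in>{1..r}. ac_prob (leb (d i)) (\<nu>' i)) \<longrightarrow>
             null_law r d h C n \<nu>' = null_law r d h C n \<nu>"
  proof (intro allI impI)
    fix n and \<nu>' :: "nat \<Rightarrow> vec measure" assume \<nu>': "\<forall>i\<in>{1..r}. ac_prob (leb (d i)) (\<nu>' i)"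
    have "ac_marginals r d \<nu>'" using assms(1) \<nu>' by (intro ac_marginals.intro) auto
    then show "null_law r d h C n \<nu>' = null_law r d h C n \<nu>"
      by (rule null_law_eq[OF _ \<nu>]) (rule assms(3))
  qed
  interpret grids r d h C by (rule grids.intro) (fact assms)+
  have \<mu>: "prob_space \<mu>" "sets \<mu> = sets (leb_blocks r d)" using assms(8) by (auto simp: ac_prob_def)
  have r: "1 \<le> r" using assms(1) by simp
  obtain \<eta> where \<eta>: "0 < \<eta>"
    and null: "(\<lambda>n. measure (iid_sample n \<mu>) {X \<in> space (iid_sample n \<mu>). RJdCov2 r d h C n X < \<eta>}) \<longlonglongrightarrow> 0"
    using RJdCov2_bounded_away[OF r \<mu> assms(11)] by blast
  have "(\<lambda>n. 1 - measure (iid_sample n \<mu>) {X \<in> space (iid_sample n \<mu>). RJdCov2 r d h C n X < \<eta>}) \<longlonglongrightarrow> 1 - 0"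
    by (intro tendsto_diff tendsto_const null)
  then have lower: "(\<lambda>n. 1 - measure (iid_sample n \<mu>) {X \<in> space (iid_sample n \<mu>). RJdCov2 r d h C n X < \<eta>}) \<longlonglongrightarrow> 1"
    by simp
  have quantile: "\<forall>\<^sub>F n in sequentially. upper_quantile \<alpha> (null_law r d h C n \<nu>) \<le> \<eta>"
    by (intro ac_marginals.eventually_upper_quantile_le[OF \<nu>] d h less_imp_le[OF C] assms(6,7) \<eta>)
  \<comment> \<open>Once the critical value is at most \<open>\<eta>\<close>, acceptance forces the
    statistic below \<open>\<eta>\<close>, so the power is at least the probability of the
    complement.\<close>
  have bounds: "(\<integral>X. indep_test r d h C \<alpha> \<nu> n X \<partial>iid_sample n \<mu>) \<le> 1"
    "upper_quantile \<alpha> (null_law r d h C n \<nu>) \<le> \<eta> \<Longrightarrow>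
      1 - measure (iid_sample n \<mu>) {X \<in> space (iid_sample n \<mu>). RJdCov2 r d h C n X < \<eta>}
        \<le> (\<integral>X. indep_test r d h C \<alpha> \<nu> n X \<partial>iid_sample n \<mu>)" for n
  proof -
    let ?P = "iid_sample n \<mu>" and ?q = "upper_quantile \<alpha> (null_law r d h C n \<nu>)"
    interpret P: prob_space ?P by (rule prob_space_iid_sample[OF \<mu>(1)])
    have "sets ?P = sets (\<Pi>\<^sub>M a\<in>{1..n}. leb_blocks r d)"
      unfolding iid_sample_def by (intro sets_PiM_cong refl \<mu>(2))
    then have RJ [measurable]: "RJdCov2 r d h C n \<in> borel_measurable ?P" by (rule measurable_RJdCov2)
    have "(\<integral>X. indep_test r d h C \<alpha> \<nu> n X \<partial>?P)
        = (\<integral>X. indicator {X \<in> space ?P. ?q \<le> RJdCov2 r d h C n X} X \<partial>?P)"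
      by (rule Bochner_Integration.integral_cong) (auto simp: indep_test_def indicator_def)
    also have "\<dots> = P.prob {X \<in> space ?P. ?q \<le> RJdCov2 r d h C n X}" by simp
    finally have eq: "(\<integral>X. indep_test r d h C \<alpha> \<nu> n X \<partial>?P) = P.prob {X \<in> space ?P. ?q \<le> RJdCov2 r d h C n X}" .
    show "(\<integral>X. indep_test r d h C \<alpha> \<nu> n X \<partial>?P) \<le> 1" unfolding eq by simp
    assume q: "?q \<le> \<eta>"
    have "1 - P.prob {X \<in> space ?P. RJdCov2 r d h C n X < \<eta>} = P.prob (space ?P - {X \<in> space ?P. RJdCov2 r d h C n X < \<eta>})"
      by (rule P.prob_compl[symmetric]) measurable
    also have "\<dots> \<le> P.prob {X \<in> space ?P. ?q \<le> RJdCov2 r d h C n X}"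
      using q by (intro P.finite_measure_mono) auto
    finally show "1 - P.prob {X \<in> space ?P. RJdCov2 r d h C n X < \<eta>} \<le> (\<integral>X. indep_test r d h C \<alpha> \<nu> n X \<partial>?P)"
      unfolding eq .
  qed
  show "(\<lambda>n. \<integral>X. indep_test r d h C \<alpha> \<nu> n X \<partial>iid_sample n \<mu>) \<longlonglongrightarrow> 1"
  proof (rule tendsto_sandwich[OF _ _ lower tendsto_const])
    show "\<forall>\<^sub>F n in sequentially.
        1 - measure (iid_sample n \<mu>) {X \<in> space (iid_sample n \<mu>). RJdCov2 r d h C n X < \<eta>}
          \<le> (\<integral>X. indep_test r d h C \<alpha> \<nu> n X \<partial>iid_sample n \<mu>)"
      using quantile by eventually_elim (rule bounds(2))
  qed (simp add: bounds(1))
qed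

end
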